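(* Let $G$ be a finite-dimensional Lie group with Lie algebra $\mathfrak g$ and $\tau:\mathfrak g\to G$ a retraction map. Suppose the Hamiltonians on $T^*G$ are left $G$-invariant, so that they are given by smooth reduced Hamiltonians $h,h_1,\dots,h_N:\mathfrak g^*\to\mathbb R$. Then the discrete stochastic flow $\mathcal F^{\rm red}_{0,T}:\mathfrak g^*\to\mathfrak g^*$, $\mu_0\mapsto\mu_M$, of the reduced stochastic midpoint scheme (described in the context) preserves the Lie–Poisson structure: $$\{f\circ\mathcal F^{\rm red}_{0,T},\,g\circ\mathcal F^{\rm red}_{0,T}\}=\{f,g\}\circ\mathcal F^{\rm red}_{0,T}\qquad\text{for all smooth } f,g:\mathfrak g^*\to\mathbb R.$$ Moreover, the flow is symplectic on each coadjoint orbit with respect to the Kirillov–Kostant–Souriau symplectic form.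
   Context: Conventions. A retraction map $\tau:\mathfrak g\to G$ is a local diffeomorphism (near $0$) with $\tau(0)=e$. For $\xi,\eta\in\mathfrak g$, $g=\tau(\xi)$: $\mathrm d_\xi\tau^{-1}(\eta):=\mathrm D\tau^{-1}(g)\cdot(\eta g)$, with dual $[\mathrm d_\xi\tau^{-1}]^*:\mathfrak g^*\to\mathfrak g^*$. $\langle\mathrm{Ad}^*_g\mu,\eta\rangle=\langle\mu,\mathrm{Ad}_g\eta\rangle$ and $\langle\mathrm{ad}^*_\xi\mu,\eta\rangle=\langle\mu,[\xi,\eta]\rangle$. The Lie–Poisson bracket is $\{f,g\}(\mu)=-\langle\mu,[\frac{\delta f}{\delta\mu},\frac{\delta g}{\delta\mu}]\rangle$. The coadjoint orbit of $\mu$ is $\mathcal O(\mu)=\{\mathrm{Ad}^*_g\mu\mid g\in G\}$, with Kirillov–Kostant–Souriau form $\omega_{\mathcal O(\mu)}(\nu)(\mathrm{ad}^*_\xi\nu,\mathrm{ad}^*_\eta\nu)=-\langle\nu,[\xi,\eta]\rangle$ for $\nu\in\mathcal O(\mu)$, $\xi,\eta\in\mathfrak g$. Reduced scheme. Let $\Delta t>0$, $M\ge1$, $T=M\Delta t$, and $\Delta W^i_k$ ($k=1,\dots,M$) the increments of independent Wiener processes over the $k$-th step (everything is pathwise). The unknowns are $\tilde\mu^1_k,\tilde\mu^2_k\in\mathfrak g^*$, $k=1,\dots,M$, with $$\tilde\xi_k=\xi_k=\tfrac12\tfrac{\partial h}{\partial\mu}\Big(\tfrac{\tilde\mu^1_k+\tilde\mu^2_k}2\Big)+\tfrac12\sum_{i=1}^N\tfrac{\partial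 h_i}{\partial\mu}\Big(\tfrac{\tilde\mu^1_k+\tilde\mu^2_k}2\Big)\tfrac{\Delta W^i_k}{\Delta t},$$ $$\mathrm{Ad}^*_{\tau(\Delta t\tilde\xi_k)}[\mathrm d_{\Delta t\tilde\xi_k}\tau^{-1}]^*\tilde\mu^1_k=[\mathrm d_{\Delta t\xi_k}\tau^{-1}]^*\tilde\mu^2_k\quad(k=1,\dots,M),$$ $$\mathrm{Ad}^*_{\tau(\Delta t\xi_k)}[\mathrm d_{\Delta t\xi_k}\tau^{-1}]^*\tilde\mu^2_k=[\mathrm d_{\Delta t\tilde\xi_{k+1}}\tau^{-1}]^*\tilde\mu^1_{k+1}\quad(k=1,\dots,M-1).$$ The trivialized momenta at the endpoints are $\mu_0=[\mathrm d_{\Delta t\tilde\xi_1}\tau^{-1}]^*\tilde\mu^1_1$ and $\mu_M=\mathrm{Ad}^*_{\tau(\Delta t\xi_M)}[\mathrm d_{\Delta t\xi_M}\tau^{-1}]^*\tilde\mu^2_M$, and $\mathcal F^{\rm red}_{0,T}(\mu_0)=\mu_M$. (This is the quotient by left translation, $(g,p)\mapsto g^{-1}p$, of the flow $(g_0,p_0)\mapsto(g_M,p_M)$ on $T^*G$ with $g_M=g_0\prod_{k=1}^M\tau(\Delta t\tilde\xi_k)\tau(\Delta t\xi_k)$, $p_0=g_0\mu_0$, $p_M=g_M\mu_M$.) Standing assumption: the implicit equations are solvable, with $\Delta t\xi_k,\Delta t\tilde\xi_k$ in the neighbourhood of $0$ where $\tau$ is a diffeomorphism, and define a smooth flow (a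 diffeomorphism) on $\mathfrak g^*$ (if only locally, the statement is understood on its domain). *)

theory Defs
  imports "HOL-Analysis.Analysis" "HOL-Probability.Probability" "HOL-Algebra.Group"
begin

section \<open>Smooth maps and manifolds\<close>

text \<open>On open sets, \<open>smooth_on\<close> is \<open>C\<^sup>\<infinity>\<close>: \<open>f\<close> is differentiable and all its
  directional derivatives are again smooth.\<close>

primrec higher_differentiable_on ::
    "'a::real_normed_vector set \<Rightarrow> ('a \<Rightarrow> 'b::real_normed_vector) \<Rightarrow> nat \<Rightarrow> bool" where
  "higher_differentiable_on S f 0 \<longleftrightarrow> continuous_on S f"
| "higher_differentiable_on S f (Suc n) \<longleftrightarrow>
     (\<forall>x\<in>S. f differentiable (at x)) \<and>
     (\<forall>v. higher_differentiable_on S (\<lambda>x. frechet_derivative f (at x) v) n)"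

definition smooth_on ::
    "'a::real_normed_vector set \<Rightarrow> ('a \<Rightarrow> 'b::real_normed_vector) \<Rightarrow> bool" where
  "smooth_on S f \<longleftrightarrow> (\<forall>n. higher_differentiable_on S f n)"

text \<open>A chart is a pair of its domain and its coordinate map; outside the domain the
  coordinate map is irrelevant.\<close>

type_synonym ('m, 'a) chart = "'m set \<times> ('m \<Rightarrow> 'a)"

definition chart_inv :: "('m, 'a) chart \<Rightarrow> 'a \<Rightarrow> 'm" where
  "chart_inv c = inv_into (fst c) (snd c)"

definition is_chart :: "('m::topological_space, 'a::real_normed_vector) chart \<Rightarrow> bool" where
  "is_chart c \<longleftrightarrow> open (fst c) \<and> open (snd c ` fst c) \<and>
     homeomorphism (fst c) (snd c ` fst c) (snd c) (chart_inv c)"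

definition smooth_atlas :: "('m::topological_space, 'a::real_normed_vector) chart set \<Rightarrow> bool" where
  "smooth_atlas A \<longleftrightarrow> (\<forall>c\<in>A. is_chart c) \<and> (\<Union>c\<in>A. fst c) = UNIV \<and>
     (\<forall>c\<in>A. \<forall>d\<in>A. smooth_on (snd c ` (fst c \<inter> fst d)) (snd d \<circ> chart_inv c))"

definition vec_atlas :: "('a, 'a) chart set" where
  "vec_atlas = {(UNIV, \<lambda>x. x)}"

definition prod_atlas ::
    "('m, 'a) chart set \<Rightarrow> ('n, 'b) chart set \<Rightarrow> ('m \<times> 'n, 'a \<times> 'b) chart set" where
  "prod_atlas A B = {(fst c \<times> fst d, map_prod (snd c) (snd d)) | c d. c \<in> A \<and> d \<in> B}"

definition smooth_map_on ::
    "('m::topological_space, 'a::real_normed_vector) chart set \<Rightarrow>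
     ('n::topological_space, 'b::real_normed_vector) chart set \<Rightarrow> 'm set \<Rightarrow> ('m \<Rightarrow> 'n) \<Rightarrow> bool" where
  "smooth_map_on A B S f \<longleftrightarrow> open S \<and> continuous_on S f \<and>
     (\<forall>c\<in>A. \<forall>d\<in>B. smooth_on (snd c ` (S \<inter> fst c \<inter> f -` fst d)) (snd d \<circ> f \<circ> chart_inv c))"

definition diffeomorphism_on ::
    "('m::topological_space, 'a::real_normed_vector) chart set \<Rightarrow>
     ('n::topological_space, 'b::real_normed_vector) chart set \<Rightarrow> 'm set \<Rightarrow> ('m \<Rightarrow> 'n) \<Rightarrow> bool" where
  "diffeomorphism_on A B S f \<longleftrightarrow>
     inj_on f S \<and> smooth_map_on A B S f \<and> smooth_map_on B A (f ` S) (inv_into S f)"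

text \<open>Every point \<open>p\<close> gets a preferred chart of the atlas, and the tangent space at \<open>p\<close> is the
  model space \<open>'a\<close>, a tangent vector being given by its components in the preferred chart at \<open>p\<close>.
  Covectors at \<open>p\<close> are accordingly elements of the dual of the model space.\<close>

definition chart_at :: "('m, 'a) chart set \<Rightarrow> 'm \<Rightarrow> ('m, 'a) chart" where
  "chart_at A p = (SOME c. c \<in> A \<and> p \<in> fst c)"

definition tangent_map ::
    "('m, 'a::real_normed_vector) chart set \<Rightarrow> ('n, 'b::real_normed_vector) chart set \<Rightarrow>
     ('m \<Rightarrow> 'n) \<Rightarrow> 'm \<Rightarrow> 'a \<Rightarrow> 'b" where
  "tangent_map A B f p =
     frechet_derivative (snd (chart_at B (f p)) \<circ> f \<circ> chart_inv (chart_at A p))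
       (at (snd (chart_at A p) p))"

type_synonym 'a dual_space = "'a \<Rightarrow>\<^sub>L real"

text \<open>The dual (transpose) of a linear map; here all model spaces are finite-dimensional, so
  linear maps are bounded and \<open>Blinfun\<close> is not applied outside its proper domain.\<close>

definition dual_map ::
    "('a::real_normed_vector \<Rightarrow> 'b::real_normed_vector) \<Rightarrow> 'b dual_space \<Rightarrow> 'a dual_space" where
  "dual_map L \<mu> = Blinfun (\<lambda>\<eta>. blinfun_apply \<mu> (L \<eta>))"


section \<open>Lie groups\<close>

record ('g, 'a) lie_group = "'g monoid" +
  atlas :: "('g, 'a) chart set"

locale lie_group = group G
  for G :: "('g::{t2_space, second_countable_topology}, 'a::euclidean_space) lie_group" (structure) +
  assumes carrier_eq: "carrier G = UNIV"
    and atlas: "smooth_atlas (atlas G)"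
    and smooth_mult:
      "smooth_map_on (prod_atlas (atlas G) (atlas G)) (atlas G) UNIV (\<lambda>(x, y). x \<otimes> y)"
    and smooth_inv: "smooth_map_on (atlas G) (atlas G) UNIV (\<lambda>x. inv x)"

text \<open>The Lie algebra is the tangent space at the unit, i.e. \<open>'a\<close>. Its bracket is the value at the
  unit of the bracket of left-invariant vector fields, computed in the preferred chart at the unit
  by \<open>[X, Y] = DY \<cdot> X - DX \<cdot> Y\<close>.\<close>

definition left_invariant_field :: "('g, 'a::real_normed_vector) lie_group \<Rightarrow> 'a \<Rightarrow> 'g \<Rightarrow> 'a" where
  "left_invariant_field G \<xi> g =
     tangent_map (atlas G) (atlas G) (\<lambda>x. g \<otimes>\<^bsub>G\<^esub> x) \<one>\<^bsub>G\<^esub> \<xi>"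

definition field_at_unit_chart ::
    "('g, 'a::real_normed_vector) lie_group \<Rightarrow> ('g \<Rightarrow> 'a) \<Rightarrow> 'a \<Rightarrow> 'a" where
  "field_at_unit_chart G X x =
     (let c = chart_at (atlas G) \<one>\<^bsub>G\<^esub>; p = chart_inv c x
      in tangent_map (atlas G) vec_atlas (snd c) p (X p))"

definition lie_bracket :: "('g, 'a::real_normed_vector) lie_group \<Rightarrow> 'a \<Rightarrow> 'a \<Rightarrow> 'a" where
  "lie_bracket G \<xi> \<eta> =
     (let x0 = snd (chart_at (atlas G) \<one>\<^bsub>G\<^esub>) \<one>\<^bsub>G\<^esub>;
          X = field_at_unit_chart G (left_invariant_field G \<xi>);
          Y = field_at_unit_chart G (left_invariant_field G \<eta>)
      in frechet_derivative Y (at x0) (X x0) - frechet_derivative X (at x0) (Y x0))"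

definition Ad :: "('g, 'a::real_normed_vector) lie_group \<Rightarrow> 'g \<Rightarrow> 'a \<Rightarrow> 'a" where
  "Ad G g = tangent_map (atlas G) (atlas G) (\<lambda>x. g \<otimes>\<^bsub>G\<^esub> x \<otimes>\<^bsub>G\<^esub> inv\<^bsub>G\<^esub> g) \<one>\<^bsub>G\<^esub>"

definition Ad_star ::
    "('g, 'a::real_normed_vector) lie_group \<Rightarrow> 'g \<Rightarrow> 'a dual_space \<Rightarrow> 'a dual_space" where
  "Ad_star G g = dual_map (Ad G g)"

definition ad_star ::
    "('g, 'a::real_normed_vector) lie_group \<Rightarrow> 'a \<Rightarrow> 'a dual_space \<Rightarrow> 'a dual_space" where
  "ad_star G \<xi> = dual_map (lie_bracket G \<xi>)"

text \<open>A Hamiltonian on \<open>T\<^sup>*G\<close> is a function of a base point \<open>g\<close> and a covector at \<open>g\<close>. The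
  left translate \<open>g p\<close> of \<open>p \<in> T\<^sup>*\<^sub>a G\<close> is the covector \<open>p \<circ> T L\<close> at \<open>g a\<close>, where \<open>L\<close> is left
  translation by the inverse of \<open>g\<close>.\<close>

definition left_translate_covector ::
    "('g, 'a::real_normed_vector) lie_group \<Rightarrow> 'g \<Rightarrow> 'g \<Rightarrow> 'a dual_space \<Rightarrow> 'a dual_space" where
  "left_translate_covector G g a p =
     dual_map (tangent_map (atlas G) (atlas G) (\<lambda>x. inv\<^bsub>G\<^esub> g \<otimes>\<^bsub>G\<^esub> x) (g \<otimes>\<^bsub>G\<^esub> a)) p"

definition left_invariant_hamiltonian ::
    "('g, 'a::real_normed_vector) lie_group \<Rightarrow> ('g \<Rightarrow> 'a dual_space \<Rightarrow> real) \<Rightarrow> bool" where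
  "left_invariant_hamiltonian G H \<longleftrightarrow>
     (\<forall>g a p. H (g \<otimes>\<^bsub>G\<^esub> a) (left_translate_covector G g a p) = H a p)"

definition reduced_hamiltonian ::
    "('g, 'a::real_normed_vector) lie_group \<Rightarrow> ('g \<Rightarrow> 'a dual_space \<Rightarrow> real) \<Rightarrow> 'a dual_space \<Rightarrow> real" where
  "reduced_hamiltonian G H = H \<one>\<^bsub>G\<^esub>"


section \<open>Lie--Poisson structure and coadjoint orbits\<close>

text \<open>\<open>\<delta>f/\<delta>\<mu>\<close> is the element of the Lie algebra representing the derivative of \<open>f\<close> at \<open>\<mu>\<close>.\<close>

definition momentum_derivative :: "('a::real_normed_vector dual_space \<Rightarrow> real) \<Rightarrow> 'a dual_space \<Rightarrow> 'a" where
  "momentum_derivative f \<mu> =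
     (THE v. \<forall>\<nu>. frechet_derivative f (at \<mu>) \<nu> = blinfun_apply \<nu> v)"

definition lie_poisson ::
    "('g, 'a::real_normed_vector) lie_group \<Rightarrow> ('a dual_space \<Rightarrow> real) \<Rightarrow> ('a dual_space \<Rightarrow> real) \<Rightarrow>
     'a dual_space \<Rightarrow> real" where
  "lie_poisson G f g \<mu> =
     - blinfun_apply \<mu> (lie_bracket G (momentum_derivative f \<mu>) (momentum_derivative g \<mu>))"

definition coadjoint_orbit ::
    "('g, 'a::real_normed_vector) lie_group \<Rightarrow> 'a dual_space \<Rightarrow> 'a dual_space set" where
  "coadjoint_orbit G \<mu> = range (\<lambda>g. Ad_star G g \<mu>)"

definition orbit_tangent_space ::
    "('g, 'a::real_normed_vector) lie_group \<Rightarrow> 'a dual_space \<Rightarrow> 'a dual_space set" where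
  "orbit_tangent_space G \<nu> = range (\<lambda>\<xi>. ad_star G \<xi> \<nu>)"

text \<open>The value does not depend on the choice of \<open>\<xi>\<close> and \<open>\<eta>\<close>, so \<open>THE\<close> is meaningful for
  tangent vectors \<open>v\<close> and \<open>w\<close> of the orbit at \<open>\<nu>\<close>.\<close>

definition kks_form ::
    "('g, 'a::real_normed_vector) lie_group \<Rightarrow> 'a dual_space \<Rightarrow> 'a dual_space \<Rightarrow> 'a dual_space \<Rightarrow> real" where
  "kks_form G \<nu> v w =
     (THE r. \<exists>\<xi> \<eta>. v = ad_star G \<xi> \<nu> \<and> w = ad_star G \<eta> \<nu> \<and>
        r = - blinfun_apply \<nu> (lie_bracket G \<xi> \<eta>))"

text \<open>The orbit of \<open>\<mu>\<close> carries the manifold structure of the quotient of \<open>G\<close> by the stabilizer of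
  \<open>\<mu>\<close>, for which \<open>\<pi>(x) = Ad\<^sup>*\<^sub>x \<mu>\<close> is a surjective submersion. A map \<open>F\<close> from the part of the orbit
  in \<open>D\<close> to the orbit is therefore smooth iff \<open>F \<circ> \<pi>\<close> locally has the form \<open>\<pi> \<circ> \<Phi>\<close>
  with \<open>\<Phi>\<close> smooth.\<close>

definition smooth_on_orbit ::
    "('g::topological_space, 'a::real_normed_vector) lie_group \<Rightarrow> 'a dual_space \<Rightarrow> 'a dual_space set \<Rightarrow>
     ('a dual_space \<Rightarrow> 'a dual_space) \<Rightarrow> bool" where
  "smooth_on_orbit G \<mu> D F \<longleftrightarrow>
     (\<forall>g. Ad_star G g \<mu> \<in> D \<longrightarrow>
        (\<exists>V \<Phi>. g \<in> V \<and> smooth_map_on (atlas G) (atlas G) V \<Phi> \<and>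
           (\<forall>x\<in>V. Ad_star G x \<mu> \<in> D \<and> F (Ad_star G x \<mu>) = Ad_star G (\<Phi> x) \<mu>)))"

text \<open>For \<open>F\<close> differentiable on the open set \<open>D\<close>: its restriction to the orbit of \<open>\<mu>\<close> is a smooth map
  into that orbit which pulls the Kirillov--Kostant--Souriau form back to itself.\<close>

definition symplectic_on_orbit ::
    "('g::topological_space, 'a::real_normed_vector) lie_group \<Rightarrow> 'a dual_space \<Rightarrow> 'a dual_space set \<Rightarrow>
     ('a dual_space \<Rightarrow> 'a dual_space) \<Rightarrow> bool" where
  "symplectic_on_orbit G \<mu> D F \<longleftrightarrow>
     F ` (coadjoint_orbit G \<mu> \<inter> D) \<subseteq> coadjoint_orbit G \<mu> \<and>
     smooth_on_orbit G \<mu> D F \<and>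
     (\<forall>\<nu> \<in> coadjoint_orbit G \<mu> \<inter> D.
        \<forall>v \<in> orbit_tangent_space G \<nu>. \<forall>w \<in> orbit_tangent_space G \<nu>.
          frechet_derivative F (at \<nu>) v \<in> orbit_tangent_space G (F \<nu>) \<and>
          frechet_derivative F (at \<nu>) w \<in> orbit_tangent_space G (F \<nu>) \<and>
          kks_form G (F \<nu>) (frechet_derivative F (at \<nu>) v) (frechet_derivative F (at \<nu>) w)
            = kks_form G \<nu> v w)"


section \<open>The reduced stochastic midpoint scheme\<close>

text \<open>\<open>U\<close> is the neighbourhood of \<open>0\<close> on which \<open>\<tau>\<close> is a diffeomorphism.\<close>

definition lie_retraction ::
    "('g::topological_space, 'a::real_normed_vector) lie_group \<Rightarrow> 'a set \<Rightarrow> ('a \<Rightarrow> 'g) \<Rightarrow> bool" where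
  "lie_retraction G U \<tau> \<longleftrightarrow> 0 \<in> U \<and> \<tau> 0 = \<one>\<^bsub>G\<^esub> \<and> diffeomorphism_on vec_atlas (atlas G) U \<tau>"

definition dtau_inv ::
    "('g, 'a::real_normed_vector) lie_group \<Rightarrow> 'a set \<Rightarrow> ('a \<Rightarrow> 'g) \<Rightarrow> 'a \<Rightarrow> 'a \<Rightarrow> 'a" where
  "dtau_inv G U \<tau> \<xi> \<eta> =
     tangent_map (atlas G) vec_atlas (inv_into U \<tau>) (\<tau> \<xi>)
       (tangent_map (atlas G) (atlas G) (\<lambda>x. x \<otimes>\<^bsub>G\<^esub> \<tau> \<xi>) \<one>\<^bsub>G\<^esub> \<eta>)"

definition dtau_inv_star ::
    "('g, 'a::real_normed_vector) lie_group \<Rightarrow> 'a set \<Rightarrow> ('a \<Rightarrow> 'g) \<Rightarrow> 'a \<Rightarrow>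
     'a dual_space \<Rightarrow> 'a dual_space" where
  "dtau_inv_star G U \<tau> \<xi> = dual_map (dtau_inv G U \<tau> \<xi>)"

definition wiener_process :: "'w measure \<Rightarrow> (real \<Rightarrow> 'w \<Rightarrow> real) \<Rightarrow> bool" where
  "wiener_process P W \<longleftrightarrow>
     prob_space P \<and>
     (\<forall>t\<ge>0. W t \<in> borel_measurable P) \<and>
     (\<forall>\<omega>\<in>space P. W 0 \<omega> = 0 \<and> continuous_on {0..} (\<lambda>t. W t \<omega>)) \<and>
     (\<forall>s t. 0 \<le> s \<longrightarrow> s < t \<longrightarrow>
        distributed P lborel (\<lambda>\<omega>. W t \<omega> - W s \<omega>) (normal_density 0 (sqrt (t - s)))) \<and>
     (\<forall>(n::nat) t. 0 \<le> t 0 \<longrightarrow> strict_mono t \<longrightarrow>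
        prob_space.indep_vars P (\<lambda>_. borel) (\<lambda>k \<omega>. W (t (Suc k)) \<omega> - W (t k) \<omega>) {..<n})"

definition independent_wiener_processes ::
    "'w measure \<Rightarrow> nat \<Rightarrow> (nat \<Rightarrow> real \<Rightarrow> 'w \<Rightarrow> real) \<Rightarrow> bool" where
  "independent_wiener_processes P N W \<longleftrightarrow>
     prob_space P \<and> (\<forall>i\<in>{1..N}. wiener_process P (W i)) \<and>
     prob_space.indep_vars P (\<lambda>_. Pi\<^sub>M {0..} (\<lambda>_. borel)) (\<lambda>i \<omega>. \<lambda>t\<in>{0..}. W i t \<omega>) {1..N}"

definition wiener_increment ::
    "real \<Rightarrow> (nat \<Rightarrow> real \<Rightarrow> 'w \<Rightarrow> real) \<Rightarrow> 'w \<Rightarrow> nat \<Rightarrow> nat \<Rightarrow> real" where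
  "wiener_increment \<Delta>t W \<omega> i k = W i (real k * \<Delta>t) \<omega> - W i ((real k - 1) * \<Delta>t) \<omega>"

text \<open>The common value of \<open>\<xi>\<^sub>k\<close> and its tilde counterpart, as a function of the two momenta; \<open>dW i\<close>
  is the increment of the \<open>i\<close>-th Wiener process over the step.\<close>

definition midpoint_velocity ::
    "('a::real_normed_vector dual_space \<Rightarrow> real) \<Rightarrow> (nat \<Rightarrow> 'a dual_space \<Rightarrow> real) \<Rightarrow> nat \<Rightarrow> real \<Rightarrow>
     (nat \<Rightarrow> real) \<Rightarrow> 'a dual_space \<Rightarrow> 'a dual_space \<Rightarrow> 'a" where
  "midpoint_velocity h hs N \<Delta>t dW m1 m2 =
     (1/2) *\<^sub>R momentum_derivative h ((1/2) *\<^sub>R (m1 + m2)) +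
     (1/2) *\<^sub>R (\<Sum>i=1..N. (dW i / \<Delta>t) *\<^sub>R momentum_derivative (hs i) ((1/2) *\<^sub>R (m1 + m2)))"

text \<open>The momenta \<open>m1 k\<close>, \<open>m2 k\<close> for \<open>k = 1, \<dots>, M\<close> solve the scheme, with trivialized endpoint
  momenta \<open>\<mu>0\<close> and \<open>\<mu>M\<close>; \<open>dW i k\<close> is the increment of the \<open>i\<close>-th Wiener process over step \<open>k\<close>.\<close>

definition reduced_midpoint_scheme ::
    "('g, 'a::real_normed_vector) lie_group \<Rightarrow> 'a set \<Rightarrow> ('a \<Rightarrow> 'g) \<Rightarrow>
     ('a dual_space \<Rightarrow> real) \<Rightarrow> (nat \<Rightarrow> 'a dual_space \<Rightarrow> real) \<Rightarrow> nat \<Rightarrow> real \<Rightarrow> nat \<Rightarrow>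
     (nat \<Rightarrow> nat \<Rightarrow> real) \<Rightarrow> (nat \<Rightarrow> 'a dual_space) \<Rightarrow> (nat \<Rightarrow> 'a dual_space) \<Rightarrow>
     'a dual_space \<Rightarrow> 'a dual_space \<Rightarrow> bool" where
  "reduced_midpoint_scheme G U \<tau> h hs N \<Delta>t M dW m1 m2 \<mu>0 \<mu>M \<longleftrightarrow>
     (let \<zeta> = (\<lambda>k. \<Delta>t *\<^sub>R midpoint_velocity h hs N \<Delta>t (\<lambda>i. dW i k) (m1 k) (m2 k))
      in (\<forall>k\<in>{1..M}. \<zeta> k \<in> U) \<and>
         (\<forall>k\<in>{1..M}. Ad_star G (\<tau> (\<zeta> k)) (dtau_inv_star G U \<tau> (\<zeta> k) (m1 k))
            = dtau_inv_star G U \<tau> (\<zeta> k) (m2 k)) \<and>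
         (\<forall>k\<in>{1..<M}. Ad_star G (\<tau> (\<zeta> k)) (dtau_inv_star G U \<tau> (\<zeta> k) (m2 k))
            = dtau_inv_star G U \<tau> (\<zeta> (k + 1)) (m1 (k + 1))) \<and>
         \<mu>0 = dtau_inv_star G U \<tau> (\<zeta> 1) (m1 1) \<and>
         \<mu>M = Ad_star G (\<tau> (\<zeta> M)) (dtau_inv_star G U \<tau> (\<zeta> M) (m2 M)))"

text \<open>For given increments, the implicit equations define the smooth flow \<open>F\<close> on the open domain
  \<open>D\<close>: each initial momentum in \<open>D\<close> has a solution of the scheme, depending smoothly on it,
  and the resulting map \<open>F\<close> is a diffeomorphism of \<open>D\<close> onto its image. Uniqueness of the solution
  is not demanded; \<open>F\<close> may be any smooth branch.\<close>

definition reduced_midpoint_flow ::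
    "('g, 'a::real_normed_vector) lie_group \<Rightarrow> 'a set \<Rightarrow> ('a \<Rightarrow> 'g) \<Rightarrow>
     ('a dual_space \<Rightarrow> real) \<Rightarrow> (nat \<Rightarrow> 'a dual_space \<Rightarrow> real) \<Rightarrow> nat \<Rightarrow> real \<Rightarrow> nat \<Rightarrow>
     (nat \<Rightarrow> nat \<Rightarrow> real) \<Rightarrow> 'a dual_space set \<Rightarrow> ('a dual_space \<Rightarrow> 'a dual_space) \<Rightarrow> bool" where
  "reduced_midpoint_flow G U \<tau> h hs N \<Delta>t M dW D F \<longleftrightarrow>
     diffeomorphism_on vec_atlas vec_atlas D F \<and>
     (\<exists>m1 m2. (\<forall>k\<in>{1..M}. smooth_on D (\<lambda>\<mu>. m1 \<mu> k) \<and> smooth_on D (\<lambda>\<mu>. m2 \<mu> k)) \<and>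
        (\<forall>\<mu>\<in>D. reduced_midpoint_scheme G U \<tau> h hs N \<Delta>t M dW (m1 \<mu>) (m2 \<mu>) \<mu> (F \<mu>)))"

end

theory Submission
  imports Defs
begin

text \<open>
  Every step of the scheme replaces a momentum by its image under the coadjoint action of a group
  element, so the whole flow has the form \<open>F \<mu> = Ad\<^sup>*\<^bsub>P(\<mu>)\<^esub> \<mu>\<close>, where
  \<open>P(\<mu>) = \<tau>(\<zeta>\<^sub>1)\<^sup>2 \<cdots> \<tau>(\<zeta>\<^sub>M)\<^sup>2\<close> and the increments \<open>\<zeta>\<^sub>k = \<Delta>t \<xi>\<^sub>k\<close> depend smoothly on the initial
  momentum. Such a map preserves every coadjoint orbit, and it is symplectic on the orbits as soon as
  the one-form \<open>\<alpha> = \<langle>\<mu>, dP P\<inverse>\<rangle>\<close> on the domain is closed. On \<open>T\<^sup>*G\<close> this form is the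
  difference between the pulled back and the original canonical one-form.

  The form \<open>\<alpha>\<close> is even exact. The identity \<open>d(PQ) (PQ)\<inverse> = dP P\<inverse> + Ad\<^bsub>P\<^esub>(dQ Q\<inverse>)\<close> splits \<open>\<alpha>\<close> into
  contributions of the single factors, in which \<open>dP P\<inverse>\<close> is paired with the momentum reached so far.
  That momentum is \<open>[d\<tau>\<inverse>]\<^sup>*\<close> applied to one of the unknowns \<open>m\<^sub>1\<close>, \<open>m\<^sub>2\<close> of the step, and \<open>d\<tau>\<inverse>\<close> undoes
  the right-trivialized derivative of \<open>\<tau>(\<zeta>)\<close>, so the two factors of a step contribute \<open>\<langle>m\<^sub>1 + m\<^sub>2, d\<zeta>\<rangle>\<close>.
  As \<open>\<zeta>\<close> is a multiple of the gradient of an energy at the midpoint \<open>(m\<^sub>1 + m\<^sub>2)/2\<close>, this is the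
  differential of a Legendre transform (\<open>step_action_has_derivative\<close>, \<open>midpoint_flow_generated\<close>). This
  is where the midpoint rule enters, and each step may have an energy of its own; the Wiener
  increments are just coefficients of that energy.

  Exactness and the Maurer--Cartan equation \<open>d(dP P\<inverse>) = [dP P\<inverse>, dP P\<inverse>]\<close> (\<open>maurer_cartan\<close>) give the identity
  \<open>action_form_closed\<close>, which on tangent vectors of the orbit says that \<open>\<mu>[M \<xi>, M \<eta>] = \<mu>[\<xi>, \<eta>]\<close>
  for \<open>M \<xi> = \<xi> + A(ad\<^sup>*\<^sub>\<xi> \<mu>)\<close> with \<open>A = dP P\<inverse>\<close> at \<open>\<mu>\<close> (\<open>orbit_lift_bracket\<close>). Since the derivative of \<open>F\<close>
  sends \<open>ad\<^sup>*\<^sub>\<xi> \<mu>\<close> to \<open>Ad\<^sup>*\<^bsub>P(\<mu>)\<^esub> (ad\<^sup>*\<^bsub>M \<xi>\<^esub> \<mu>)\<close> and the adjoint action respects brackets, the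
  Kirillov--Kostant--Souriau form is preserved. The Poisson property concerns all of the dual of the
  Lie algebra and not only the orbits; it follows by duality because \<open>M\<close> is injective, hence
  surjective on the finite-dimensional Lie algebra.

  The facts about the group itself reduce to the second-order Taylor expansion of the multiplication in
  the chart at the unit: with \<open>\<beta>\<close> its mixed second derivative, the bracket is \<open>\<beta>(\<xi>, \<eta>) - \<beta>(\<eta>, \<xi>)\<close>,
  and the derivative of the adjoint action and the Maurer--Cartan equation are expressed by \<open>\<beta>\<close> as well.
\<close>

section \<open>Finite-dimensional normed spaces\<close>

text \<open>The class contains the Euclidean spaces and their spaces of bounded linear maps, in particular the
  dual of the Lie algebra, which is not an inner product space here. Composition of smooth maps needs it
  for the space in the middle, and so does the product rule for families of linear maps: both
  expand a vector in finitely many continuous coordinates. The axiom spells out bounded linearity of the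
  coordinates \<open>c b\<close>, which within the class cannot be expressed by \<open>bounded_linear\<close>.\<close>

class finite_dim = real_normed_vector +
  assumes finite_coordinates: "\<exists>(B::'a set) c K. finite B \<and>
      (\<forall>b x y. c b (x + y) = c b x + (c b y :: real)) \<and>
      (\<forall>b r x. c b (scaleR r x) = r * c b x) \<and> (\<forall>b x. \<bar>c b x\<bar> \<le> norm x * K b) \<and>
      (\<forall>x. x = (\<Sum>b\<in>B. scaleR (c b x) b))"

lemma finite_coords:
  obtains B :: "'a::finite_dim set" and c :: "'a \<Rightarrow> 'a \<Rightarrow> real"
  where "finite B" "\<And>b. bounded_linear (c b)" "\<And>x. x = (\<Sum>b\<in>B. c b x *\<^sub>R b)"
proof -
  obtain B :: "'a set" and c :: "'a \<Rightarrow> 'a \<Rightarrow> real" and K where "finite B"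
    and "\<forall>b x y. c b (x + y) = c b x + c b y" "\<forall>b r x. c b (r *\<^sub>R x) = r * c b x"
    and "\<forall>b x. \<bar>c b x\<bar> \<le> norm x * K b" "\<forall>x. x = (\<Sum>b\<in>B. c b x *\<^sub>R b)"
    using finite_coordinates by (elim exE conjE) (rule that)
  moreover from this have "bounded_linear (c b)" for b
    by (intro bounded_linear_intro[where K = "K b"]) auto
  ultimately show ?thesis using that by blast
qed

lemma finite_dim_classI:
  fixes B :: "'a::real_normed_vector set"
  assumes "finite B" "\<And>b. bounded_linear (c b)" "\<And>x. x = (\<Sum>b\<in>B. c b x *\<^sub>R b)"
  shows "OFCLASS('a, finite_dim_class)"
proof
  have "\<exists>K. \<forall>x. \<bar>c b x\<bar> \<le> norm x * K" for b
    using bounded_linear.bounded[OF assms(2)] by simp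
  then obtain K where "\<And>b x. \<bar>c b x\<bar> \<le> norm x * K b" by metis
  moreover have "c b (x + y) = c b x + c b y" "c b (r *\<^sub>R x) = r * c b x" for b x y r
    using assms(2)[THEN bounded_linear.linear] by (simp_all add: linear_add linear_scale)
  ultimately show "\<exists>(B::'a set) c K. finite B \<and>
      (\<forall>b x y. c b (x + y) = c b x + (c b y :: real)) \<and>
      (\<forall>b r x. c b (scaleR r x) = r * c b x) \<and> (\<forall>b x. \<bar>c b x\<bar> \<le> norm x * K b) \<and>
      (\<forall>x. x = (\<Sum>b\<in>B. scaleR (c b x) b))"
    using assms(1,3) by (intro exI[of _ B] exI[of _ c] exI[of _ K]) blast
qed

instance euclidean_space \<subseteq> finite_dim
  by (rule finite_dim_classI[of Basis "\<lambda>b x. x \<bullet> b"])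
    (auto simp: euclidean_representation bounded_linear_inner_left)

lemma dual_representation:
  fixes \<mu> :: "'a::euclidean_space dual_space"
  shows "\<mu> = (\<Sum>b\<in>Basis. \<mu> b *\<^sub>R blinfun_inner_left b)"
proof (rule blinfun_euclidean_eqI)
  fix i :: 'a assume "i \<in> Basis"
  then show "\<mu> i = (\<Sum>b\<in>Basis. \<mu> b *\<^sub>R blinfun_inner_left b) i"
    by (simp add: blinfun.sum_left blinfun.scaleR_left inner_Basis if_distrib cong: if_cong)
qed

instance blinfun :: (euclidean_space, euclidean_space) finite_dim
proof -
  define E :: "'a \<times> 'b \<Rightarrow> 'a \<Rightarrow>\<^sub>L 'b"
    where "E p = blinfun_of_matrix (\<lambda>k l. if l = fst p then if k = snd p then 1 else 0 else 0)" for p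
  define c :: "'a \<times> 'b \<Rightarrow> ('a \<Rightarrow>\<^sub>L 'b) \<Rightarrow> real"
    where "c p f = blinfun_apply f (fst p) \<bullet> snd p" for p f
  let ?P = "(Basis :: 'a set) \<times> (Basis :: 'b set)"
  have E: "blinfun_apply (E (i,j)) x = (x \<bullet> i) *\<^sub>R j" if "i \<in> Basis" "j \<in> Basis" for i j x
    using that
    by (simp add: E_def blinfun_of_matrix_apply if_distrib[of "(*) _"] if_distrib[of "\<lambda>r. r *\<^sub>R _"]
        sum.delta cong: if_cong)
  have c_E: "c p (E q) = (if p = q then 1 else 0)" if "p \<in> ?P" "q \<in> ?P" for p q
    using that by (cases p, cases q) (auto simp: c_def E inner_Basis)
  have inj: "inj_on E ?P"
  proof (rule inj_onI)
    fix p q assume "p \<in> ?P" "q \<in> ?P" "E p = E q"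
    then show "p = q" using c_E[of p p] c_E[of p q] by (simp split: if_splits)
  qed
  have rep: "f = (\<Sum>p\<in>?P. c p f *\<^sub>R E p)" for f
  proof (rule blinfun_euclidean_eqI)
    fix i :: 'a assume i: "i \<in> Basis"
    have "blinfun_apply (\<Sum>p\<in>?P. c p f *\<^sub>R E p) i = (\<Sum>p\<in>?P. c p f *\<^sub>R blinfun_apply (E p) i)"
      by (simp add: blinfun.sum_left blinfun.scaleR_left)
    also have "\<dots> = (\<Sum>k\<in>Basis. \<Sum>j\<in>Basis. c (k,j) f *\<^sub>R blinfun_apply (E (k,j)) i)"
      by (simp add: sum.cartesian_product)
    also have "\<dots> = (\<Sum>k\<in>Basis. if k = i then \<Sum>j\<in>Basis. c (i,j) f *\<^sub>R j else 0)"
      by (rule sum.cong) (auto simp: E inner_Basis i intro!: sum.cong)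
    also have "\<dots> = (\<Sum>j\<in>Basis. (blinfun_apply f i \<bullet> j) *\<^sub>R j)"
      by (simp add: i c_def)
    finally show "blinfun_apply f i = blinfun_apply (\<Sum>p\<in>?P. c p f *\<^sub>R E p) i"
      by (simp add: euclidean_representation)
  qed
  show "OFCLASS('a \<Rightarrow>\<^sub>L 'b, finite_dim_class)"
  proof (rule finite_dim_classI)
    show "finite (E ` ?P)" by simp
    show "bounded_linear (c (inv_into ?P E b))" for b
      unfolding c_def by (intro bounded_linear_intros)
    show "f = (\<Sum>b\<in>E ` ?P. c (inv_into ?P E b) f *\<^sub>R b)" for f
      by (subst sum.reindex[OF inj], subst rep) (auto simp: inv_into_f_f[OF inj] intro!: sum.cong)
  qed
qed

section \<open>Calculus of smooth maps\<close>

lemma has_frechet_derivative: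
  "f differentiable (at x) \<Longrightarrow> (f has_derivative frechet_derivative f (at x)) (at x)"
  by (simp add: frechet_derivative_works)

lemma frechet_derivative_eqI:
  "(f has_derivative f') (at x) \<Longrightarrow> frechet_derivative f (at x) = f'"
  using frechet_derivative_at by metis

lemma higher_differentiable_on_cong:
  assumes "open S" "\<And>x. x \<in> S \<Longrightarrow> f x = g x"
  shows "higher_differentiable_on S f n = higher_differentiable_on S g n"
  using assms(2)
proof (induction n arbitrary: f g)
  case 0
  then show ?case by (simp cong: continuous_on_cong)
next
  case (Suc n)
  have d: "(f has_derivative D) (at x) \<longleftrightarrow> (g has_derivative D) (at x)" if "x \<in> S" for x D
    using has_derivative_transform_within_open[of f D x UNIV S g]
      has_derivative_transform_within_open[of g D x UNIV S f] Suc.prems that assms(1) by auto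
  have *: "frechet_derivative f (at x) v = frechet_derivative g (at x) v" if "x \<in> S" for x v
    using d[OF that] by (simp add: frechet_derivative_def)
  have **: "f differentiable (at x) \<longleftrightarrow> g differentiable (at x)" if "x \<in> S" for x
    using d[OF that] by (simp add: differentiable_def)
  show ?case
    using Suc.IH[OF *] ** by simp
qed

lemma higher_differentiable_on_subset:
  "higher_differentiable_on S f n \<Longrightarrow> T \<subseteq> S \<Longrightarrow> higher_differentiable_on T f n"
  by (induction n arbitrary: f) (auto intro: continuous_on_subset)

lemma higher_differentiable_on_mono:
  "higher_differentiable_on S f (Suc n) \<Longrightarrow> higher_differentiable_on S f n"
proof (induction n arbitrary: f)
  case 0
  then show ?case
    by (auto intro!: continuous_at_imp_continuous_on differentiable_imp_continuous_within)
next
  case (Suc n)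
  show ?case
    unfolding higher_differentiable_on.simps(2)
  proof (intro conjI allI)
    show "\<forall>x\<in>S. f differentiable (at x)"
      using Suc.prems by simp
    fix v
    have "higher_differentiable_on S (\<lambda>x. frechet_derivative f (at x) v) (Suc n)"
      using Suc.prems unfolding higher_differentiable_on.simps(2)[of S f "Suc n"] by blast
    then show "higher_differentiable_on S (\<lambda>x. frechet_derivative f (at x) v) n"
      by (rule Suc.IH)
  qed
qed

lemma higher_differentiable_on_SucI:
  assumes "open S" "\<And>x. x \<in> S \<Longrightarrow> (f has_derivative f' x) (at x)"
    and "\<And>v. higher_differentiable_on S (\<lambda>x. f' x v) n"
  shows "higher_differentiable_on S f (Suc n)"
  unfolding higher_differentiable_on.simps(2)
proof (intro conjI ballI allI)
  show "f differentiable (at x)" if "x \<in> S" for x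
    using assms(2)[OF that] by (auto simp: differentiable_def)
  fix v
  have "frechet_derivative f (at x) v = f' x v" if "x \<in> S" for x
    using frechet_derivative_eqI[OF assms(2)[OF that]] by simp
  then show "higher_differentiable_on S (\<lambda>x. frechet_derivative f (at x) v) n"
    using higher_differentiable_on_cong[OF assms(1), of "\<lambda>x. frechet_derivative f (at x) v"
        "\<lambda>x. f' x v"] assms(3) by simp
qed

lemma higher_differentiable_on_SucD:
  assumes "higher_differentiable_on S f (Suc n)"
  shows "x \<in> S \<Longrightarrow> (f has_derivative frechet_derivative f (at x)) (at x)"
    and "higher_differentiable_on S (\<lambda>x. frechet_derivative f (at x) v) n"
  using assms by (simp_all add: has_frechet_derivative)

lemma higher_differentiable_on_const: "open S \<Longrightarrow> higher_differentiable_on S (\<lambda>x. c) n"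
  by (induction n arbitrary: c) auto

lemma higher_differentiable_on_add:
  assumes "open S"
  shows "higher_differentiable_on S f n \<Longrightarrow> higher_differentiable_on S g n \<Longrightarrow>
    higher_differentiable_on S (\<lambda>x. f x + g x) n"
proof (induction n arbitrary: f g)
  case 0
  then show ?case by (simp add: continuous_on_add)
next
  case (Suc n)
  note f = higher_differentiable_on_SucD[OF Suc.prems(1)]
  note g = higher_differentiable_on_SucD[OF Suc.prems(2)]
  show ?case
  proof (rule higher_differentiable_on_SucI[OF assms])
    fix x assume "x \<in> S"
    show "((\<lambda>x. f x + g x) has_derivative
        (\<lambda>v. frechet_derivative f (at x) v + frechet_derivative g (at x) v)) (at x)"
      by (rule has_derivative_add[OF f(1)[OF \<open>x \<in> S\<close>] g(1)[OF \<open>x \<in> S\<close>]])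
  next
    fix v
    show "higher_differentiable_on S
        (\<lambda>x. frechet_derivative f (at x) v + frechet_derivative g (at x) v) n"
      by (rule Suc.IH[OF f(2) g(2)])
  qed
qed

lemma higher_differentiable_on_sum:
  assumes "open S" "\<And>i. i \<in> I \<Longrightarrow> higher_differentiable_on S (f i) n"
  shows "higher_differentiable_on S (\<lambda>x. \<Sum>i\<in>I. f i x) n"
  using assms(2)
proof (induction I rule: infinite_finite_induct)
  case (insert i I)
  have "higher_differentiable_on S (\<lambda>x. f i x + (\<Sum>i\<in>I. f i x)) n"
    by (rule higher_differentiable_on_add[OF assms(1) insert.prems[OF insertI1]
          insert.IH[OF insert.prems[OF insertI2]]])
  then show ?case using insert.hyps by simp
qed (simp_all add: higher_differentiable_on_const[OF assms(1)])

lemma higher_differentiable_on_bounded_linear: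
  assumes "open S" "bounded_linear L"
  shows "higher_differentiable_on S f n \<Longrightarrow> higher_differentiable_on S (\<lambda>x. L (f x)) n"
proof (induction n arbitrary: f)
  case 0
  then show ?case
    by (simp add: bounded_linear.continuous_on[OF assms(2)])
next
  case (Suc n)
  note f = higher_differentiable_on_SucD[OF Suc.prems(1)]
  show ?case
  proof (rule higher_differentiable_on_SucI[OF assms(1)])
    fix x assume "x \<in> S"
    show "((\<lambda>x. L (f x)) has_derivative (\<lambda>v. L (frechet_derivative f (at x) v))) (at x)"
      by (rule bounded_linear.has_derivative[OF assms(2) f(1)[OF \<open>x \<in> S\<close>]])
  next
    fix v
    show "higher_differentiable_on S (\<lambda>x. L (frechet_derivative f (at x) v)) n"
      by (rule Suc.IH[OF f(2)])
  qed
qed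

lemma higher_differentiable_on_bounded_bilinear:
  assumes "open S" "bounded_bilinear b"
  shows "higher_differentiable_on S f n \<Longrightarrow> higher_differentiable_on S g n \<Longrightarrow>
    higher_differentiable_on S (\<lambda>x. b (f x) (g x)) n"
proof (induction n arbitrary: f g)
  case 0
  then show ?case
    by (simp add: bounded_bilinear.continuous_on[OF assms(2)])
next
  case (Suc n)
  note f = higher_differentiable_on_SucD[OF Suc.prems(1)]
  note g = higher_differentiable_on_SucD[OF Suc.prems(2)]
  show ?case
  proof (rule higher_differentiable_on_SucI[OF assms(1)])
    fix x assume "x \<in> S"
    show "((\<lambda>x. b (f x) (g x)) has_derivative
        (\<lambda>v. b (f x) (frechet_derivative g (at x) v) + b (frechet_derivative f (at x) v) (g x))) (at x)"
      by (rule bounded_bilinear.FDERIV[OF assms(2) f(1)[OF \<open>x \<in> S\<close>] g(1)[OF \<open>x \<in> S\<close>]])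
  next
    fix v
    show "higher_differentiable_on S (\<lambda>x. b (f x) (frechet_derivative g (at x) v) +
        b (frechet_derivative f (at x) v) (g x)) n"
      by (rule higher_differentiable_on_add[OF assms(1)
            Suc.IH[OF higher_differentiable_on_mono[OF Suc.prems(1)] g(2)]
            Suc.IH[OF f(2) higher_differentiable_on_mono[OF Suc.prems(2)]]])
  qed
qed

text \<open>The chain rule alone does not close the induction, because \<open>g' (f x) (f' x v)\<close> is
  not a composition of maps of lower order: the direction depends on \<open>x\<close> too. Expanding \<open>f' x v\<close> in finitely
  many coordinates turns it into a sum of products of such maps.\<close>

lemma higher_differentiable_on_compose:
  fixes f :: "'a::real_normed_vector \<Rightarrow> 'b::finite_dim"
  assumes "open S" "f ` S \<subseteq> T"
  shows "higher_differentiable_on S f n \<Longrightarrow> higher_differentiable_on T g n \<Longrightarrow>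
    higher_differentiable_on S (\<lambda>x. g (f x)) n"
proof (induction n arbitrary: g)
  case 0
  then show ?case
    unfolding higher_differentiable_on.simps using assms(2) by (metis continuous_on_compose2)
next
  case (Suc n)
  obtain B :: "'b set" and c :: "'b \<Rightarrow> 'b \<Rightarrow> real" where B: "finite B" "\<And>b. bounded_linear (c b)"
    and rep: "\<And>x. x = (\<Sum>b\<in>B. c b x *\<^sub>R b)"
    using finite_coords by metis
  let ?g = "\<lambda>x v. frechet_derivative g (at x) v" and ?f = "\<lambda>x v. frechet_derivative f (at x) v"
  have d: "((\<lambda>x. g (f x)) has_derivative (\<lambda>v. \<Sum>b\<in>B. c b (?f x v) *\<^sub>R ?g (f x) b)) (at x)"
    if "x \<in> S" for x
  proof -
    have g: "(g has_derivative ?g (f x)) (at (f x))"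
      by (rule higher_differentiable_on_SucD(1)[OF Suc.prems(2)]) (use that assms(2) in blast)
    have *: "((\<lambda>x. g (f x)) has_derivative (\<lambda>v. ?g (f x) (?f x v))) (at x)"
      by (rule has_derivative_compose[OF higher_differentiable_on_SucD(1)[OF Suc.prems(1) that] g])
    interpret G: bounded_linear "?g (f x)"
      using g by (rule has_derivative_bounded_linear)
    have "?g (f x) (?f x v) = (\<Sum>b\<in>B. c b (?f x v) *\<^sub>R ?g (f x) b)" for v
    proof -
      have "?g (f x) (?f x v) = ?g (f x) (\<Sum>b\<in>B. c b (?f x v) *\<^sub>R b)"
        using rep[of "?f x v"] by simp
      then show ?thesis by (simp add: G.sum G.scaleR)
    qed
    with * show ?thesis by simp
  qed
  show ?case
  proof (rule higher_differentiable_on_SucI[OF assms(1) d])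
    fix v
    show "higher_differentiable_on S (\<lambda>x. \<Sum>b\<in>B. c b (?f x v) *\<^sub>R ?g (f x) b) n"
    proof (rule higher_differentiable_on_sum[OF assms(1)])
      fix b assume "b \<in> B"
      have "higher_differentiable_on S (\<lambda>x. c b (?f x v)) n"
        by (rule higher_differentiable_on_bounded_linear[OF assms(1) B(2)
              higher_differentiable_on_SucD(2)[OF Suc.prems(1)]])
      moreover have "higher_differentiable_on S (\<lambda>x. ?g (f x) b) n"
        by (rule Suc.IH[OF higher_differentiable_on_mono[OF Suc.prems(1)]
              higher_differentiable_on_SucD(2)[OF Suc.prems(2)]])
      ultimately show "higher_differentiable_on S (\<lambda>x. c b (?f x v) *\<^sub>R ?g (f x) b) n"
        by (rule higher_differentiable_on_bounded_bilinear[OF assms(1) bounded_bilinear_scaleR])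
    qed
  qed
qed

lemma higher_differentiable_on_id: "open S \<Longrightarrow> higher_differentiable_on S (\<lambda>x. x) n"
  by (cases n) (simp_all add: higher_differentiable_on_const)

lemma higher_differentiable_on_local:
  assumes "\<And>x. x \<in> S \<Longrightarrow> \<exists>T. open T \<and> x \<in> T \<and> higher_differentiable_on T f n"
  shows "higher_differentiable_on S f n"
  using assms
proof (induction n arbitrary: f)
  case 0
  show ?case
    unfolding higher_differentiable_on.simps continuous_on_eq_continuous_within
  proof
    fix x assume "x \<in> S"
    then obtain T where "open T" "x \<in> T" "continuous_on T f"
      using 0[OF \<open>x \<in> S\<close>] by auto
    then show "continuous (at x within S) f"
      using continuous_at_imp_continuous_at_within continuous_on_eq_continuous_at by blast
  qed
next
  case (Suc n)
  show ?case
    unfolding higher_differentiable_on.simps(2)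
  proof (intro conjI ballI allI)
    show "f differentiable (at x)" if "x \<in> S" for x
      using Suc.prems[OF that] by auto
    show "higher_differentiable_on S (\<lambda>x. frechet_derivative f (at x) v) n" for v
    proof (rule Suc.IH)
      fix x assume "x \<in> S"
      then show "\<exists>T. open T \<and> x \<in> T \<and>
          higher_differentiable_on T (\<lambda>x. frechet_derivative f (at x) v) n"
        using Suc.prems[OF \<open>x \<in> S\<close>] by (auto simp del: higher_differentiable_on.simps(1))
    qed
  qed
qed

lemma smooth_on_cong:
  "open S \<Longrightarrow> (\<And>x. x \<in> S \<Longrightarrow> f x = g x) \<Longrightarrow> smooth_on S f \<longleftrightarrow> smooth_on S g"
  unfolding smooth_on_def by (intro iff_allI higher_differentiable_on_cong)

lemma smooth_on_subset: "smooth_on S f \<Longrightarrow> T \<subseteq> S \<Longrightarrow> smooth_on T f"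
  unfolding smooth_on_def by (intro allI) (rule higher_differentiable_on_subset, blast+)

lemma smooth_on_local:
  assumes "\<And>x. x \<in> S \<Longrightarrow> \<exists>T. open T \<and> x \<in> T \<and> smooth_on T f"
  shows "smooth_on S f"
  unfolding smooth_on_def
proof (intro allI higher_differentiable_on_local)
  fix n x assume "x \<in> S"
  then show "\<exists>T. open T \<and> x \<in> T \<and> higher_differentiable_on T f n"
    using assms unfolding smooth_on_def by blast
qed

lemma smooth_on_imp_continuous_on: "smooth_on S f \<Longrightarrow> continuous_on S f"
  unfolding smooth_on_def by (auto dest: spec[of _ 0])

lemma smooth_on_has_derivative:
  "smooth_on S f \<Longrightarrow> x \<in> S \<Longrightarrow> (f has_derivative frechet_derivative f (at x)) (at x)"
  unfolding smooth_on_def by (rule higher_differentiable_on_SucD(1)) blast+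

lemma smooth_on_frechet_derivative:
  "smooth_on S f \<Longrightarrow> smooth_on S (\<lambda>x. frechet_derivative f (at x) v)"
  unfolding smooth_on_def by (intro allI higher_differentiable_on_SucD(2)) blast

lemma smooth_on_const: "open S \<Longrightarrow> smooth_on S (\<lambda>x. c)"
  by (simp add: smooth_on_def higher_differentiable_on_const)

lemma smooth_on_id: "open S \<Longrightarrow> smooth_on S (\<lambda>x. x)"
  by (simp add: smooth_on_def higher_differentiable_on_id)

lemma smooth_on_add:
  "open S \<Longrightarrow> smooth_on S f \<Longrightarrow> smooth_on S g \<Longrightarrow> smooth_on S (\<lambda>x. f x + g x)"
  by (simp add: smooth_on_def higher_differentiable_on_add)

lemma smooth_on_sum:
  "open S \<Longrightarrow> (\<And>i. i \<in> I \<Longrightarrow> smooth_on S (f i)) \<Longrightarrow> smooth_on S (\<lambda>x. \<Sum>i\<in>I. f i x)"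
  by (simp add: smooth_on_def higher_differentiable_on_sum)

lemma smooth_on_bounded_linear:
  "open S \<Longrightarrow> bounded_linear L \<Longrightarrow> smooth_on S f \<Longrightarrow> smooth_on S (\<lambda>x. L (f x))"
  unfolding smooth_on_def by (rule allI, rule higher_differentiable_on_bounded_linear) blast+

lemma smooth_on_compose:
  fixes f :: "'a::real_normed_vector \<Rightarrow> 'b::finite_dim"
  shows "open S \<Longrightarrow> smooth_on S f \<Longrightarrow> smooth_on T g \<Longrightarrow> f ` S \<subseteq> T \<Longrightarrow> smooth_on S (\<lambda>x. g (f x))"
  unfolding smooth_on_def by (rule allI, rule higher_differentiable_on_compose[of S f T]) blast+

lemma smooth_on_Pair:
  assumes "open S" "smooth_on S f" "smooth_on S g"
  shows "smooth_on S (\<lambda>x. (f x, g x))"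
proof -
  have "smooth_on S (\<lambda>x. (\<lambda>y. (y, 0)) (f x) + (\<lambda>y. (0, y)) (g x))"
    using assms
    by (intro smooth_on_add smooth_on_bounded_linear[of S "\<lambda>y. (y, 0)"]
        smooth_on_bounded_linear[of S "\<lambda>y. (0, y)"] bounded_linear_Pair bounded_linear_zero
        bounded_linear_ident)
  then show ?thesis by simp
qed

section \<open>Symmetry of the second derivative\<close>

text \<open>The second difference of \<open>f\<close> over the parallelogram spanned by \<open>t v\<close> and \<open>t w\<close>, divided
  by \<open>t\<^sup>2\<close>, tends to \<open>Dv w\<close> by the mean value theorem along \<open>v\<close>; it is symmetric in \<open>v\<close> and \<open>w\<close>. Only
  the derivatives in the directions \<open>v\<close> and \<open>w\<close> have to be differentiable, and only at \<open>x\<close>; so the lemma applies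
  to a function whose derivative is given by an explicit formula, as for the action below.\<close>

lemma symmetric_second_derivative_real:
  fixes f :: "'a::real_normed_vector \<Rightarrow> real"
  assumes "open S" "x \<in> S"
    and f: "\<And>y. y \<in> S \<Longrightarrow> (f has_derivative f' y) (at y)"
    and v: "((\<lambda>y. f' y v) has_derivative Dv) (at x)"
    and w: "((\<lambda>y. f' y w) has_derivative Dw) (at x)"
  shows "Dv w = Dw v"
proof -
  have key: "((\<lambda>t. (f (x + t *\<^sub>R v + t *\<^sub>R w) - f (x + t *\<^sub>R v) - f (x + t *\<^sub>R w) + f x) / t\<^sup>2)
        \<longlongrightarrow> Dv w) (at_right 0)"
    if "((\<lambda>y. f' y v) has_derivative Dv) (at x)" for v w Dv
  proof (rule tendstoI)
    fix e :: real assume "e > 0"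
    \<comment> \<open>The second difference involves the derivative at two points, whose
  distances to \<open>x\<close> add up to less than \<open>t * C\<close>.\<close>
    define C where "C = 2 * norm v + norm w + 1"
    have "C > 0" by (auto simp: C_def intro: add_nonneg_pos)
    interpret Dv: bounded_linear Dv using that by (rule has_derivative_bounded_linear)
    have "\<exists>d>0. \<forall>y. norm (y - x) < d \<longrightarrow>
        \<bar>f' y v - f' x v - Dv (y - x)\<bar> \<le> (e / (2 * C)) * norm (y - x)"
    proof -
      have "0 < e / (2 * C)" using \<open>e > 0\<close> \<open>C > 0\<close> by simp
      then show ?thesis
        using that unfolding has_derivative_at_alt real_norm_def by blast
    qed
    then obtain d where d: "d > 0" "\<And>y. norm (y - x) < d \<Longrightarrow>
        \<bar>f' y v - f' x v - Dv (y - x)\<bar> \<le> (e / (2 * C)) * norm (y - x)"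
      by blast
    obtain r where r: "r > 0" "ball x r \<subseteq> S"
      using \<open>open S\<close> \<open>x \<in> S\<close> openE by blast
    define T where "T = min d r / C"
    have "T > 0" using d r \<open>C > 0\<close> by (simp add: T_def)
    have small: "norm (s *\<^sub>R v + u *\<^sub>R w) < min d r" if "0 \<le> s" "s \<le> t" "0 \<le> u" "u \<le> t" "0 < t" "t < T" for s t u
    proof -
      have "norm (s *\<^sub>R v + u *\<^sub>R w) \<le> s * norm v + u * norm w"
        using norm_triangle_ineq[of "s *\<^sub>R v" "u *\<^sub>R w"] that by simp
      also have "\<dots> \<le> t * norm v + t * norm w"
        using that by (intro add_mono mult_right_mono) auto
      also have "\<dots> \<le> t * C"
        using that by (simp add: C_def algebra_simps)
      also have "\<dots> < min d r"
        using that \<open>C > 0\<close> by (simp add: T_def field_simps)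
      finally show ?thesis .
    qed
    have "dist ((f (x + t *\<^sub>R v + t *\<^sub>R w) - f (x + t *\<^sub>R v) - f (x + t *\<^sub>R w) + f x) / t\<^sup>2) (Dv w) < e"
      if t: "0 < t" "t < T" for t
    proof -
      \<comment> \<open>The two sides of the parallelogram parallel to \<open>v\<close>; writing \<open>0 *\<^sub>R w\<close>
  treats both by the same formula.\<close>
      define g where "g s = f (x + (s *\<^sub>R v + t *\<^sub>R w)) - f (x + (s *\<^sub>R v + 0 *\<^sub>R w))" for s
      have inS: "x + (s *\<^sub>R v + u *\<^sub>R w) \<in> S" if "0 \<le> s" "s \<le> t" "0 \<le> u" "u \<le> t" for s u
        using small[OF that t] r by (auto simp: subset_iff mem_ball dist_norm norm_minus_commute)
      have dg: "(g has_derivative (\<lambda>h. h * (f' (x + (s *\<^sub>R v + t *\<^sub>R w)) v - f' (x + (s *\<^sub>R v + 0 *\<^sub>R w)) v))) (at s)"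
        if "0 \<le> s" "s \<le> t" for s
      proof -
        have *: "((\<lambda>s. f (x + (s *\<^sub>R v + u *\<^sub>R w))) has_derivative (\<lambda>h. h * f' (x + (s *\<^sub>R v + u *\<^sub>R w)) v)) (at s)"
          if "0 \<le> u" "u \<le> t" for u
        proof -
          have F: "(f has_derivative f' (x + (s *\<^sub>R v + u *\<^sub>R w))) (at (x + (s *\<^sub>R v + u *\<^sub>R w)))"
            using f inS \<open>0 \<le> s\<close> \<open>s \<le> t\<close> that by blast
          interpret F: bounded_linear "f' (x + (s *\<^sub>R v + u *\<^sub>R w))"
            using F by (rule has_derivative_bounded_linear)
          have "((\<lambda>s. x + (s *\<^sub>R v + u *\<^sub>R w)) has_derivative (\<lambda>h. h *\<^sub>R v)) (at s)"
            by (auto intro!: derivative_eq_intros)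
          from has_derivative_compose[OF this F] show ?thesis
            by (simp add: F.scaleR)
        qed
        show ?thesis
          unfolding g_def
          using has_derivative_diff[OF *[of t] *[of 0]] t by (simp add: algebra_simps)
      qed
      obtain s where s: "0 < s" "s < t" "g t - g 0 = (t - 0) * (f' (x + (s *\<^sub>R v + t *\<^sub>R w)) v - f' (x + (s *\<^sub>R v + 0 *\<^sub>R w)) v)"
      proof -
        have "\<exists>s\<in>{0<..<t}. g t - g 0 = (\<lambda>h. h * (f' (x + (s *\<^sub>R v + t *\<^sub>R w)) v - f' (x + (s *\<^sub>R v + 0 *\<^sub>R w)) v)) (t - 0)"
          by (rule mvt_simple[OF t(1)]) (rule has_derivative_at_withinI[OF dg])
        then show ?thesis using that by auto
      qed
      let ?a = "s *\<^sub>R v + t *\<^sub>R w" and ?b = "s *\<^sub>R v + 0 *\<^sub>R w"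
      have na: "norm ?a + norm ?b < t * C"
      proof -
        have "norm ?a + norm ?b \<le> s * norm v + t * norm w + s * norm v"
          using norm_triangle_ineq[of "s *\<^sub>R v" "t *\<^sub>R w"] s t by simp
        also have "\<dots> \<le> t * norm v + t * norm w + t * norm v"
          using s t by (intro add_mono mult_right_mono) auto
        also have "\<dots> < t * C"
          using t by (simp add: C_def algebra_simps)
        finally show ?thesis .
      qed
      have "\<bar>f' (x + ?a) v - f' x v - Dv ?a\<bar> \<le> (e / (2 * C)) * norm ?a"
        using d(2)[of "x + ?a"] small[of s t t] s t by simp
      moreover have "\<bar>f' (x + ?b) v - f' x v - Dv ?b\<bar> \<le> (e / (2 * C)) * norm ?b"
        using d(2)[of "x + ?b"] small[of s t 0] s t by simp
      moreover have "Dv ?a - Dv ?b = t * Dv w"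
        by (simp add: Dv.add Dv.scaleR)
      ultimately have "\<bar>f' (x + ?a) v - f' (x + ?b) v - t * Dv w\<bar> \<le> (e / (2 * C)) * (norm ?a + norm ?b)"
        by (simp only: distrib_left)
      also have "\<dots> < (e / (2 * C)) * (t * C)"
        using na \<open>e > 0\<close> \<open>C > 0\<close> by (intro mult_strict_left_mono) auto
      also have "\<dots> = e / 2 * t" using \<open>C > 0\<close> by simp
      finally have *: "\<bar>(f' (x + ?a) v - f' (x + ?b) v) - t * Dv w\<bar> < e / 2 * t" .
      have "(f (x + t *\<^sub>R v + t *\<^sub>R w) - f (x + t *\<^sub>R v) - f (x + t *\<^sub>R w) + f x)
          = t * (f' (x + ?a) v - f' (x + ?b) v)"
        (is "?N = t * ?K")
        using s(3) by (simp add: g_def add.assoc)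
      moreover have "t * ?K / t\<^sup>2 - Dv w = (?K - t * Dv w) / t"
        using t by (simp add: field_simps power2_eq_square)
      ultimately have "(f (x + t *\<^sub>R v + t *\<^sub>R w) - f (x + t *\<^sub>R v) - f (x + t *\<^sub>R w) + f x) / t\<^sup>2 - Dv w
          = ((f' (x + ?a) v - f' (x + ?b) v) - t * Dv w) / t"
        by (simp only:)
      then have "dist ((f (x + t *\<^sub>R v + t *\<^sub>R w) - f (x + t *\<^sub>R v) - f (x + t *\<^sub>R w) + f x) / t\<^sup>2) (Dv w)
          = \<bar>(f' (x + ?a) v - f' (x + ?b) v) - t * Dv w\<bar> / t"
        using t by (simp add: dist_real_def)
      also have "\<dots> < e / 2"
        using * t by (simp add: field_simps)
      finally show ?thesis using \<open>e > 0\<close> by simp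
    qed
    then show "\<forall>\<^sub>F t in at_right 0. dist ((f (x + t *\<^sub>R v + t *\<^sub>R w) - f (x + t *\<^sub>R v) - f (x + t *\<^sub>R w) + f x) / t\<^sup>2) (Dv w) < e"
      unfolding eventually_at_right_field using \<open>T > 0\<close> by blast
  qed
  have "((\<lambda>t. (f (x + t *\<^sub>R v + t *\<^sub>R w) - f (x + t *\<^sub>R v) - f (x + t *\<^sub>R w) + f x) / t\<^sup>2) \<longlongrightarrow> Dw v) (at_right 0)"
    using key[OF w, of v] by (simp add: algebra_simps)
  with key[OF v, of w] show ?thesis
    by (rule tendsto_unique[rotated]) simp
qed

lemma symmetric_second_derivative:
  fixes f :: "'a::real_normed_vector \<Rightarrow> 'b::euclidean_space"
  assumes "open S" "x \<in> S"
    and f: "\<And>y. y \<in> S \<Longrightarrow> (f has_derivative f' y) (at y)"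
    and v: "((\<lambda>y. f' y v) has_derivative Dv) (at x)"
    and w: "((\<lambda>y. f' y w) has_derivative Dw) (at x)"
  shows "Dv w = Dw v"
proof (rule euclidean_eqI)
  fix b :: 'b
  show "Dv w \<bullet> b = Dw v \<bullet> b"
    by (rule symmetric_second_derivative_real[OF assms(1,2), of "\<lambda>y. f y \<bullet> b" "\<lambda>y h. f' y h \<bullet> b"])
      (auto intro: has_derivative_inner_left f v w)
qed

section \<open>Families of linear maps\<close>

text \<open>A product rule for \<open>\<Phi> y (w y)\<close> which needs \<open>\<Phi>\<close> only as a family of linear maps that is
  differentiable pointwise; this is the form in which tangent maps of the group operations occur.\<close>

lemma has_derivative_linear_family:
  fixes w :: "'a::real_normed_vector \<Rightarrow> 'b::finite_dim" and \<Phi> :: "'a \<Rightarrow> 'b \<Rightarrow> 'c::real_normed_vector"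
  assumes "open S" "x \<in> S" and lin: "\<And>y. y \<in> S \<Longrightarrow> linear (\<Phi> y)"
    and \<Phi>: "\<And>b. ((\<lambda>y. \<Phi> y b) has_derivative \<Phi>' b) (at x)"
    and w: "(w has_derivative w') (at x)"
  shows "((\<lambda>y. \<Phi> y (w y)) has_derivative (\<lambda>u. \<Phi>' (w x) u + \<Phi> x (w' u))) (at x)"
proof -
  obtain B :: "'b set" and c :: "'b \<Rightarrow> 'b \<Rightarrow> real" where B: "finite B" "\<And>b. bounded_linear (c b)"
    and rep: "\<And>x. x = (\<Sum>b\<in>B. c b x *\<^sub>R b)"
    using finite_coords by metis
  have \<Phi>_rep: "\<Phi> y z = (\<Sum>b\<in>B. c b z *\<^sub>R \<Phi> y b)" if "y \<in> S" for y z
  proof -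
    have "\<Phi> y z = \<Phi> y (\<Sum>b\<in>B. c b z *\<^sub>R b)" using rep[of z] by simp
    then show ?thesis using lin[OF that] by (simp add: linear_sum linear_scale)
  qed
  have "((\<lambda>y. \<Sum>b\<in>B. c b (w x) *\<^sub>R \<Phi> y b) has_derivative (\<lambda>u. \<Sum>b\<in>B. c b (w x) *\<^sub>R \<Phi>' b u)) (at x)"
    by (auto intro!: derivative_eq_intros \<Phi>)
  then have "((\<lambda>y. \<Phi> y (w x)) has_derivative (\<lambda>u. \<Sum>b\<in>B. c b (w x) *\<^sub>R \<Phi>' b u)) (at x)"
    by (rule has_derivative_transform_within_open[OF _ assms(1,2)]) (simp add: \<Phi>_rep[symmetric])
  then have \<Phi>'_rep: "\<Phi>' (w x) = (\<lambda>u. \<Sum>b\<in>B. c b (w x) *\<^sub>R \<Phi>' b u)"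
    using \<Phi> has_derivative_unique by blast
  have "((\<lambda>y. \<Sum>b\<in>B. c b (w y) *\<^sub>R \<Phi> y b) has_derivative
      (\<lambda>u. \<Sum>b\<in>B. c b (w x) *\<^sub>R \<Phi>' b u + c b (w' u) *\<^sub>R \<Phi> x b)) (at x)"
    by (intro has_derivative_sum has_derivative_scaleR \<Phi> bounded_linear.has_derivative[OF B(2) w])
  then have "((\<lambda>y. \<Sum>b\<in>B. c b (w y) *\<^sub>R \<Phi> y b) has_derivative (\<lambda>u. \<Phi>' (w x) u + \<Phi> x (w' u))) (at x)"
    by (simp add: \<Phi>'_rep \<Phi>_rep[OF assms(2), of "w' _"] sum.distrib)
  then show ?thesis
    by (rule has_derivative_transform_within_open[OF _ assms(1,2)]) (simp add: \<Phi>_rep[symmetric])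
qed

lemma smooth_on_bounded_bilinear:
  "open S \<Longrightarrow> bounded_bilinear b \<Longrightarrow> smooth_on S f \<Longrightarrow> smooth_on S g \<Longrightarrow>
    smooth_on S (\<lambda>x. b (f x) (g x))"
  unfolding smooth_on_def by (rule allI, rule higher_differentiable_on_bounded_bilinear) blast+

lemma smooth_on_linear_family:
  fixes w :: "'a::real_normed_vector \<Rightarrow> 'b::finite_dim" and \<Phi> :: "'a \<Rightarrow> 'b \<Rightarrow> 'c::real_normed_vector"
  assumes "open S" and lin: "\<And>y. y \<in> S \<Longrightarrow> linear (\<Phi> y)"
    and \<Phi>: "\<And>b. smooth_on S (\<lambda>y. \<Phi> y b)" and w: "smooth_on S w"
  shows "smooth_on S (\<lambda>y. \<Phi> y (w y))"
proof -
  obtain B :: "'b set" and c :: "'b \<Rightarrow> 'b \<Rightarrow> real" where B: "finite B" "\<And>b. bounded_linear (c b)"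
    and rep: "\<And>x. x = (\<Sum>b\<in>B. c b x *\<^sub>R b)"
    using finite_coords by metis
  have "smooth_on S (\<lambda>y. c b (w y) *\<^sub>R \<Phi> y b)" for b
    by (rule smooth_on_bounded_bilinear[OF assms(1) bounded_bilinear_scaleR
          smooth_on_bounded_linear[OF assms(1) B(2) w] \<Phi>])
  then have "smooth_on S (\<lambda>y. \<Sum>b\<in>B. c b (w y) *\<^sub>R \<Phi> y b)"
    by (rule smooth_on_sum[OF assms(1)])
  moreover have "(\<Sum>b\<in>B. c b (w y) *\<^sub>R \<Phi> y b) = \<Phi> y (w y)" if "y \<in> S" for y
  proof -
    have "\<Phi> y (w y) = \<Phi> y (\<Sum>b\<in>B. c b (w y) *\<^sub>R b)" using rep[of "w y"] by simp
    then show ?thesis using lin[OF that] by (simp add: linear_sum linear_scale)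
  qed
  ultimately show ?thesis
    using smooth_on_cong[OF assms(1), of "\<lambda>y. \<Sum>b\<in>B. c b (w y) *\<^sub>R \<Phi> y b" "\<lambda>y. \<Phi> y (w y)"] by simp
qed

section \<open>Smooth maps between manifolds\<close>

lemma smooth_on_dual:
  fixes f :: "'a::real_normed_vector \<Rightarrow> 'b::euclidean_space dual_space"
  assumes "open S" "\<And>v. smooth_on S (\<lambda>x. blinfun_apply (f x) v)"
  shows "smooth_on S f"
proof -
  have "smooth_on S (\<lambda>x. \<Sum>b\<in>Basis. blinfun_apply (f x) b *\<^sub>R blinfun_inner_left b :: 'b dual_space)"
    by (intro smooth_on_sum[OF assms(1)]
        smooth_on_bounded_linear[OF assms(1) bounded_linear_scaleR_left] assms(2))
  then show ?thesis
    by (subst (asm) dual_representation[symmetric])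
qed

text \<open>What composition uses of the intermediate atlas is that its charts are homeomorphisms covering the
  manifold, a property that passes directly to the atlas of a product.\<close>

definition chart_cover :: "('m::topological_space, 'a::real_normed_vector) chart set \<Rightarrow> bool" where
  "chart_cover A \<longleftrightarrow> (\<forall>c\<in>A. is_chart c) \<and> (\<Union>c\<in>A. fst c) = UNIV"

lemma smooth_atlas_cover: "smooth_atlas A \<Longrightarrow> chart_cover A"
  by (simp add: smooth_atlas_def chart_cover_def)

lemma chart_cover_chart: "chart_cover A \<Longrightarrow> c \<in> A \<Longrightarrow> is_chart c"
  by (simp add: chart_cover_def)

lemma chart_cover_obtain:
  assumes "chart_cover A" obtains c where "c \<in> A" "is_chart c" "p \<in> fst c"
proof -
  have "p \<in> (\<Union>c\<in>A. fst c)" using assms by (simp add: chart_cover_def)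
  then show ?thesis using that assms by (auto simp: chart_cover_def)
qed

lemma chart_cover_vec: "chart_cover (vec_atlas :: ('a::real_normed_vector, 'a) chart set)"
  by (auto simp: chart_cover_def vec_atlas_def is_chart_def chart_inv_def homeomorphism_def
      inv_into_f_f intro!: continuous_on_id)

lemma chart_inv_vec: "chart_inv (UNIV, \<lambda>x. x) = (\<lambda>x. x)"
  by (auto simp: chart_inv_def inv_into_f_f)

lemma
  assumes "is_chart c"
  shows chart_open: "open (fst c)" and chart_open_image: "open (snd c ` fst c)"
    and chart_continuous: "continuous_on (fst c) (snd c)"
    and chart_inv_continuous: "continuous_on (snd c ` fst c) (chart_inv c)"
    and chart_inv_chart: "p \<in> fst c \<Longrightarrow> chart_inv c (snd c p) = p"
    and chart_chart_inv: "x \<in> snd c ` fst c \<Longrightarrow> snd c (chart_inv c x) = x"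
    and chart_inv_in: "x \<in> snd c ` fst c \<Longrightarrow> chart_inv c x \<in> fst c"
  using assms by (auto simp: is_chart_def homeomorphism_def)

lemma chart_image_open:
  assumes "is_chart c" "open S"
  shows "open (snd c ` (S \<inter> fst c))"
proof -
  have "snd c ` (S \<inter> fst c) = snd c ` fst c \<inter> chart_inv c -` S"
    using chart_inv_chart[OF assms(1)] by force
  then show ?thesis
    using chart_inv_continuous[OF assms(1)] chart_open_image[OF assms(1)] assms(2)
    by (metis continuous_on_open_vimage inf_commute)
qed

lemma smooth_map_on_open_vimage:
  "smooth_map_on A B S f \<Longrightarrow> open V \<Longrightarrow> open (S \<inter> f -` V)"
  unfolding smooth_map_on_def by (metis continuous_on_open_vimage inf_commute)

lemma smooth_map_on_subset:
  assumes "smooth_map_on A B S f" "open T" "T \<subseteq> S"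
  shows "smooth_map_on A B T f"
  unfolding smooth_map_on_def
proof (intro conjI ballI)
  show "continuous_on T f"
    using assms by (auto simp: smooth_map_on_def intro: continuous_on_subset)
  fix c d assume "c \<in> A" "d \<in> B"
  then have "smooth_on (snd c ` (S \<inter> fst c \<inter> f -` fst d)) (snd d \<circ> f \<circ> chart_inv c)"
    using assms by (auto simp: smooth_map_on_def)
  then show "smooth_on (snd c ` (T \<inter> fst c \<inter> f -` fst d)) (snd d \<circ> f \<circ> chart_inv c)"
    by (rule smooth_on_subset) (use assms in auto)
qed fact

lemma smooth_map_on_cong:
  assumes "chart_cover A" "chart_cover B" "smooth_map_on A B S f" "\<And>x. x \<in> S \<Longrightarrow> f x = g x"
  shows "smooth_map_on A B S g"
  unfolding smooth_map_on_def
proof (intro conjI ballI)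
  show "open S" using assms by (simp add: smooth_map_on_def)
  have "continuous_on S f" using assms by (simp add: smooth_map_on_def)
  then show "continuous_on S g" using assms(4) by (simp cong: continuous_on_cong)
  fix c d assume c: "c \<in> A" and d: "d \<in> B"
  have ic: "is_chart c" and id: "is_chart d" using c d assms chart_cover_chart by blast+
  have *: "S \<inter> fst c \<inter> f -` fst d = (S \<inter> f -` fst d) \<inter> fst c"
    "S \<inter> fst c \<inter> g -` fst d = (S \<inter> f -` fst d) \<inter> fst c" using assms(4) by auto
  have o: "open (snd c ` ((S \<inter> f -` fst d) \<inter> fst c))"
    by (intro chart_image_open[OF ic] smooth_map_on_open_vimage[OF assms(3)] chart_open[OF id])
  have "smooth_on (snd c ` ((S \<inter> f -` fst d) \<inter> fst c)) (snd d \<circ> f \<circ> chart_inv c)"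
    unfolding *(1)[symmetric] using assms(3) c d by (auto simp: smooth_map_on_def)
  then show "smooth_on (snd c ` (S \<inter> fst c \<inter> g -` fst d)) (snd d \<circ> g \<circ> chart_inv c)"
    unfolding *(2) by (subst (asm) smooth_on_cong[OF o, of _ "snd d \<circ> g \<circ> chart_inv c"])
      (auto simp: chart_inv_chart[OF ic] assms(4))
qed

text \<open>Near a point the composition, read in charts, is the composition of the two chart
  expressions through any chart of the middle manifold around the image point.\<close>

lemma smooth_map_on_compose:
  fixes A :: "('l::topological_space, 'a::real_normed_vector) chart set"
    and B :: "('m::topological_space, 'b::finite_dim) chart set"
    and C :: "('n::topological_space, 'c::real_normed_vector) chart set"
  assumes A: "chart_cover A" and B: "chart_cover B" and C: "chart_cover C"
    and g: "smooth_map_on B C T g" and f: "smooth_map_on A B S f" and sub: "f ` S \<subseteq> T"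
  shows "smooth_map_on A C S (\<lambda>x. g (f x))"
  unfolding smooth_map_on_def
proof (intro conjI ballI)
  show "open S" using f by (simp add: smooth_map_on_def)
  show "continuous_on S (\<lambda>x. g (f x))"
    using f g sub unfolding smooth_map_on_def by (metis continuous_on_compose2)
  fix c e assume c: "c \<in> A" and e: "e \<in> C"
  have ic: "is_chart c" and ie: "is_chart e" using c e A C chart_cover_chart by blast+
  show "smooth_on (snd c ` (S \<inter> fst c \<inter> (\<lambda>x. g (f x)) -` fst e)) (snd e \<circ> (\<lambda>x. g (f x)) \<circ> chart_inv c)"
  proof (rule smooth_on_local)
    fix x assume "x \<in> snd c ` (S \<inter> fst c \<inter> (\<lambda>x. g (f x)) -` fst e)"
    then obtain p where p: "p \<in> S" "p \<in> fst c" "g (f p) \<in> fst e" "x = snd c p" by auto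
    obtain d where d: "d \<in> B" "is_chart d" "f p \<in> fst d" by (rule chart_cover_obtain[OF B])
    define V where "V = fst d \<inter> (T \<inter> g -` fst e)"
    define W where "W = snd c ` ((S \<inter> f -` V) \<inter> fst c)"
    have "open V"
      unfolding V_def by (intro open_Int chart_open d smooth_map_on_open_vimage[OF g] ie)
    then have oW: "open W"
      unfolding W_def by (intro chart_image_open ic smooth_map_on_open_vimage[OF f])
    have "x \<in> W" using p d sub by (auto simp: W_def V_def)
    have F: "smooth_on W (snd d \<circ> f \<circ> chart_inv c)"
      using f c d(1) unfolding smooth_map_on_def W_def V_def
      by (elim conjE) (rule smooth_on_subset, blast, blast)
    have G: "smooth_on (snd d ` (T \<inter> fst d \<inter> g -` fst e)) (snd e \<circ> g \<circ> chart_inv d)"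
      using g d(1) e unfolding smooth_map_on_def by blast
    have im: "(snd d \<circ> f \<circ> chart_inv c) ` W \<subseteq> snd d ` (T \<inter> fst d \<inter> g -` fst e)"
      by (auto simp: W_def V_def chart_inv_chart[OF ic])
    have "smooth_on W (\<lambda>x. (snd e \<circ> g \<circ> chart_inv d) ((snd d \<circ> f \<circ> chart_inv c) x))"
      by (rule smooth_on_compose[OF oW F G im])
    then have "smooth_on W (snd e \<circ> (\<lambda>x. g (f x)) \<circ> chart_inv c)"
      by (subst (asm) smooth_on_cong[OF oW, of _ "snd e \<circ> (\<lambda>x. g (f x)) \<circ> chart_inv c"])
        (auto simp: W_def V_def chart_inv_chart[OF ic] chart_inv_chart[OF d(2)])
    then show "\<exists>W. open W \<and> x \<in> W \<and> smooth_on W (snd e \<circ> (\<lambda>x. g (f x)) \<circ> chart_inv c)"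
      using oW \<open>x \<in> W\<close> by blast
  qed
qed

lemma smooth_map_on_local:
  assumes A: "chart_cover A" and B: "chart_cover B"
    and loc: "\<And>p. p \<in> S \<Longrightarrow> \<exists>V. p \<in> V \<and> V \<subseteq> S \<and> smooth_map_on A B V f"
  shows "smooth_map_on A B S f"
  unfolding smooth_map_on_def
proof (intro conjI ballI)
  define \<V> where "\<V> = {V. V \<subseteq> S \<and> smooth_map_on A B V f}"
  have S: "\<Union>\<V> = S"
  proof
    show "S \<subseteq> \<Union>\<V>"
    proof
      fix p assume "p \<in> S"
      from loc[OF this] show "p \<in> \<Union>\<V>" unfolding \<V>_def by auto
    qed
  qed (auto simp: \<V>_def)
  have V: "open V" "continuous_on V f" if "V \<in> \<V>" for V
    using that by (simp_all add: \<V>_def smooth_map_on_def)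
  show "open S"
    unfolding S[symmetric] using V(1) by (intro open_Union) simp
  show "continuous_on S f"
    unfolding S[symmetric] by (rule continuous_on_open_Union) (simp_all add: V)
  fix c d assume c: "c \<in> A" and d: "d \<in> B"
  show "smooth_on (snd c ` (S \<inter> fst c \<inter> f -` fst d)) (snd d \<circ> f \<circ> chart_inv c)"
  proof (rule smooth_on_local)
    fix x assume "x \<in> snd c ` (S \<inter> fst c \<inter> f -` fst d)"
    then obtain p where p: "p \<in> S" "p \<in> fst c" "f p \<in> fst d" "x = snd c p" by auto
    obtain V where V: "p \<in> V" "V \<subseteq> S" "smooth_map_on A B V f" using loc[OF p(1)] by blast
    let ?W = "snd c ` ((V \<inter> f -` fst d) \<inter> fst c)"
    have "open ?W"
      by (intro chart_image_open chart_cover_chart[OF A c] smooth_map_on_open_vimage[OF V(3)]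
          chart_open[OF chart_cover_chart[OF B d]])
    moreover have "x \<in> ?W" using p V by blast
    moreover have "smooth_on ?W (snd d \<circ> f \<circ> chart_inv c)"
      using V(3) c d unfolding smooth_map_on_def by (elim conjE) (rule smooth_on_subset, blast, blast)
    ultimately show "\<exists>W. open W \<and> x \<in> W \<and> smooth_on W (snd d \<circ> f \<circ> chart_inv c)" by blast
  qed
qed

lemma smooth_map_on_vec_iff:
  "smooth_map_on vec_atlas vec_atlas S f \<longleftrightarrow> open S \<and> smooth_on S f"
  by (auto simp: smooth_map_on_def vec_atlas_def chart_inv_vec o_def
      dest: smooth_on_imp_continuous_on)

lemma smooth_map_on_to_vec:
  assumes "chart_cover A" "open S" "continuous_on S f"
    and "\<And>c. c \<in> A \<Longrightarrow> smooth_on (snd c ` (S \<inter> fst c)) (\<lambda>x. f (chart_inv c x))"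
  shows "smooth_map_on A vec_atlas S f"
  using assms by (auto simp: smooth_map_on_def vec_atlas_def chart_inv_vec o_def)

lemma smooth_map_on_chart:
  assumes "smooth_atlas A" "c \<in> A"
  shows "smooth_map_on A vec_atlas (fst c) (snd c)"
    and "smooth_map_on vec_atlas A (snd c ` fst c) (chart_inv c)"
proof -
  have ic: "is_chart c" using assms by (auto simp: smooth_atlas_def)
  have trans: "smooth_on (snd d ` (fst d \<inter> fst e)) (snd e \<circ> chart_inv d)" if "d \<in> A" "e \<in> A" for d e
    using assms that by (auto simp: smooth_atlas_def)
  show "smooth_map_on A vec_atlas (fst c) (snd c)"
    using trans[OF _ assms(2)]
    by (intro smooth_map_on_to_vec smooth_atlas_cover assms chart_open chart_continuous ic)
      (auto simp: o_def inf_commute)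
  have "snd c ` fst c \<inter> chart_inv c -` fst e = snd c ` (fst c \<inter> fst e)" for e
    using chart_inv_chart[OF ic] by force
  then show "smooth_map_on vec_atlas A (snd c ` fst c) (chart_inv c)"
    using trans[OF assms(2)] chart_open_image[OF ic] chart_inv_continuous[OF ic]
    by (auto simp: smooth_map_on_def vec_atlas_def chart_inv_vec o_def)
qed

lemma smooth_map_on_id:
  assumes "smooth_atlas A"
  shows "smooth_map_on A A UNIV (\<lambda>x. x)"
  using assms by (auto simp: smooth_map_on_def smooth_atlas_def o_def)

lemma smooth_map_on_const:
  assumes "chart_cover A" "chart_cover B" "open S"
  shows "smooth_map_on A B S (\<lambda>x. q)"
  unfolding smooth_map_on_def
proof (intro conjI ballI)
  fix c d assume cd: "c \<in> A" "d \<in> B"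
  have "open (snd c ` (S \<inter> fst c))"
    using chart_image_open[OF chart_cover_chart[OF assms(1) cd(1)] assms(3)] .
  then have "smooth_on (snd c ` (S \<inter> fst c)) (snd d \<circ> (\<lambda>x. q) \<circ> chart_inv c)"
    by (simp add: o_def smooth_on_const)
  then show "smooth_on (snd c ` (S \<inter> fst c \<inter> (\<lambda>x. q) -` fst d)) (snd d \<circ> (\<lambda>x. q) \<circ> chart_inv c)"
    by (rule smooth_on_subset) auto
qed (auto simp: assms(3) intro: continuous_on_const)

lemma smooth_map_on_Pair:
  assumes A: "chart_cover A" and B: "chart_cover B" and C: "chart_cover C"
    and f: "smooth_map_on A B S f" and g: "smooth_map_on A C S g"
  shows "smooth_map_on A (prod_atlas B C) S (\<lambda>x. (f x, g x))"
  unfolding smooth_map_on_def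
proof (intro conjI ballI)
  show "open S" using f by (simp add: smooth_map_on_def)
  show "continuous_on S (\<lambda>x. (f x, g x))"
    using f g by (auto simp: smooth_map_on_def intro: continuous_on_Pair)
  fix c k assume c: "c \<in> A" and "k \<in> prod_atlas B C"
  then obtain d e where k: "k = (fst d \<times> fst e, map_prod (snd d) (snd e))" and d: "d \<in> B" and e: "e \<in> C"
    by (auto simp: prod_atlas_def)
  have ic: "is_chart c" and id: "is_chart d" and ie: "is_chart e"
    using A B C c d e chart_cover_chart by blast+
  let ?W = "snd c ` (((S \<inter> f -` fst d) \<inter> (S \<inter> g -` fst e)) \<inter> fst c)"
  have o: "open ?W"
    by (intro chart_image_open ic open_Int smooth_map_on_open_vimage[OF f]
        smooth_map_on_open_vimage[OF g] chart_open id ie)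
  have "smooth_on ?W (snd d \<circ> f \<circ> chart_inv c)"
    using f c d unfolding smooth_map_on_def by (elim conjE) (rule smooth_on_subset, blast, blast)
  moreover have "smooth_on ?W (snd e \<circ> g \<circ> chart_inv c)"
    using g c e unfolding smooth_map_on_def by (elim conjE) (rule smooth_on_subset, blast, blast)
  ultimately have "smooth_on ?W (\<lambda>x. ((snd d \<circ> f \<circ> chart_inv c) x, (snd e \<circ> g \<circ> chart_inv c) x))"
    by (rule smooth_on_Pair[OF o])
  moreover have "(\<lambda>x. ((snd d \<circ> f \<circ> chart_inv c) x, (snd e \<circ> g \<circ> chart_inv c) x))
      = snd k \<circ> (\<lambda>x. (f x, g x)) \<circ> chart_inv c"
    by (auto simp: k)
  moreover have "S \<inter> fst c \<inter> (\<lambda>x. (f x, g x)) -` fst k = ((S \<inter> f -` fst d) \<inter> (S \<inter> g -` fst e)) \<inter> fst c"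
    by (auto simp: k)
  ultimately show "smooth_on (snd c ` (S \<inter> fst c \<inter> (\<lambda>x. (f x, g x)) -` fst k))
      (snd k \<circ> (\<lambda>x. (f x, g x)) \<circ> chart_inv c)"
    by simp
qed

lemma chart_cover_prod:
  assumes "chart_cover B" "chart_cover C"
  shows "chart_cover (prod_atlas B C)"
  unfolding chart_cover_def
proof
  show "\<forall>k\<in>prod_atlas B C. is_chart k"
  proof
    fix k assume "k \<in> prod_atlas B C"
    then obtain d e where k: "k = (fst d \<times> fst e, map_prod (snd d) (snd e))" and d: "d \<in> B" and e: "e \<in> C"
      by (auto simp: prod_atlas_def)
    have id: "is_chart d" and ie: "is_chart e"
      using assms d e chart_cover_chart by blast+
    have im: "snd k ` fst k = snd d ` fst d \<times> snd e ` fst e"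
      by (auto simp: k)
    have inj: "inj_on (snd k) (fst k)"
    proof (rule inj_onI)
      fix p q assume "p \<in> fst k" "q \<in> fst k" "snd k p = snd k q"
      then show "p = q"
        using chart_inv_chart[OF id] chart_inv_chart[OF ie]
        by (cases p, cases q) (simp add: k, metis)
    qed
    have inv: "chart_inv k (snd k p) = p" if "p \<in> fst k" for p
      unfolding chart_inv_def using inj that by (rule inv_into_f_f)
    have inv2: "chart_inv k x = (chart_inv d (fst x), chart_inv e (snd x))"
      if "x \<in> snd d ` fst d \<times> snd e ` fst e" for x
      using that inv chart_inv_chart[OF id] chart_inv_chart[OF ie] by (force simp: k)
    have co: "continuous_on (fst k) (snd k)"
    proof -
      have "continuous_on (fst d \<times> fst e) (\<lambda>p. (snd d (fst p), snd e (snd p)))"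
        by (intro continuous_on_Pair continuous_on_compose2[OF chart_continuous[OF id] continuous_on_fst[OF continuous_on_id]]
            continuous_on_compose2[OF chart_continuous[OF ie] continuous_on_snd[OF continuous_on_id]]) auto
      then show ?thesis by (simp add: k map_prod_def case_prod_beta' )
    qed
    have "continuous_on (snd d ` fst d \<times> snd e ` fst e) (\<lambda>p. (chart_inv d (fst p), chart_inv e (snd p)))"
      by (intro continuous_on_Pair continuous_on_compose2[OF chart_inv_continuous[OF id] continuous_on_fst[OF continuous_on_id]]
          continuous_on_compose2[OF chart_inv_continuous[OF ie] continuous_on_snd[OF continuous_on_id]]) auto
    then have ci: "continuous_on (snd k ` fst k) (chart_inv k)"
      unfolding im by (rule continuous_on_eq) (simp add: inv2)
    have oi: "open (fst k)" "open (snd k ` fst k)"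
      unfolding im using chart_open[OF id] chart_open[OF ie] chart_open_image[OF id] chart_open_image[OF ie]
      by (simp_all add: k open_Times)
    show "is_chart k"
      unfolding is_chart_def homeomorphism_def
      using oi co ci inv by (auto simp: image_image)
  qed
  have "p \<in> (\<Union>c\<in>prod_atlas B C. fst c)" for p
  proof -
    obtain d where "d \<in> B" "is_chart d" "fst p \<in> fst d" by (rule chart_cover_obtain[OF assms(1)])
    moreover obtain e where "e \<in> C" "is_chart e" "snd p \<in> fst e" by (rule chart_cover_obtain[OF assms(2)])
    ultimately have "(fst d \<times> fst e, map_prod (snd d) (snd e)) \<in> prod_atlas B C" "p \<in> fst d \<times> fst e"
      unfolding prod_atlas_def by (blast, simp add: mem_Times_iff)
    then show ?thesis by (metis UN_I fst_conv)
  qed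
  then show "(\<Union>c\<in>prod_atlas B C. fst c) = UNIV" by blast
qed

section \<open>Tangent maps\<close>

text \<open>Tangent maps are taken in the preferred charts, so that differentiability in
  these charts together with continuity, formulated by filters as the manifold is merely a topological space,
  is all that the chain rule requires.\<close>

definition differentiable_map ::
    "('m::topological_space, 'a::real_normed_vector) chart set \<Rightarrow>
     ('n::topological_space, 'b::real_normed_vector) chart set \<Rightarrow> ('m \<Rightarrow> 'n) \<Rightarrow> 'm \<Rightarrow> bool" where
  "differentiable_map A B f p \<longleftrightarrow> filterlim f (nhds (f p)) (nhds p) \<and>
     (snd (chart_at B (f p)) \<circ> f \<circ> chart_inv (chart_at A p)) differentiable
       (at (snd (chart_at A p) p))"

lemma chart_at:
  assumes "chart_cover A"
  shows "chart_at A p \<in> A" "is_chart (chart_at A p)" "p \<in> fst (chart_at A p)"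
proof -
  obtain c where "c \<in> A" "is_chart c" "p \<in> fst c" by (rule chart_cover_obtain[OF assms])
  then have "\<exists>c. c \<in> A \<and> p \<in> fst c" by blast
  then have "chart_at A p \<in> A \<and> p \<in> fst (chart_at A p)"
    unfolding chart_at_def by (rule someI_ex)
  then show "chart_at A p \<in> A" "is_chart (chart_at A p)" "p \<in> fst (chart_at A p)"
    using chart_cover_chart[OF assms] by auto
qed

lemma chart_at_vec: "chart_at vec_atlas p = (UNIV, \<lambda>x. x)"
  unfolding chart_at_def by (rule some_equality) (auto simp: vec_atlas_def)

lemma tangent_map_vec: "tangent_map vec_atlas vec_atlas f p = frechet_derivative f (at p)"
  by (simp add: tangent_map_def chart_at_vec chart_inv_vec o_def)

lemma tangent_map_from_vec:
  "tangent_map vec_atlas B f p = frechet_derivative (\<lambda>x. snd (chart_at B (f p)) (f x)) (at p)"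
  by (simp add: tangent_map_def chart_at_vec chart_inv_vec o_def)

lemma tendsto_nhdsI:
  assumes "open S" "p \<in> S" "continuous_on S f"
  shows "filterlim f (nhds (f p)) (nhds p)"
proof (rule topological_tendstoI)
  fix V assume "open V" "f p \<in> V"
  then have "open (f -` V \<inter> S)" "p \<in> f -` V \<inter> S"
    using assms continuous_on_open_vimage[OF assms(1)] by auto
  then show "eventually (\<lambda>x. f x \<in> V) (nhds p)"
    unfolding eventually_nhds by blast
qed

lemma smooth_map_on_differentiable:
  assumes "chart_cover A" "chart_cover B" "smooth_map_on A B S f" "p \<in> S"
  shows "differentiable_map A B f p"
proof -
  let ?c = "chart_at A p" and ?d = "chart_at B (f p)"
  have "filterlim f (nhds (f p)) (nhds p)"
    using assms(3,4) by (auto simp: smooth_map_on_def intro: tendsto_nhdsI)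
  moreover have "smooth_on (snd ?c ` (S \<inter> fst ?c \<inter> f -` fst ?d)) (snd ?d \<circ> f \<circ> chart_inv ?c)"
    using assms(3) chart_at[OF assms(1)] chart_at[OF assms(2)] unfolding smooth_map_on_def by blast
  then have "(snd ?d \<circ> f \<circ> chart_inv ?c) differentiable (at (snd ?c p))"
    using smooth_on_has_derivative[of _ "snd ?d \<circ> f \<circ> chart_inv ?c" "snd ?c p"]
      assms(4) chart_at(3)[OF assms(1)] chart_at(3)[OF assms(2)]
    unfolding differentiable_def by blast
  ultimately show ?thesis by (simp add: differentiable_map_def)
qed

lemma tangent_map_linear:
  "differentiable_map A B f p \<Longrightarrow> linear (tangent_map A B f p)"
  by (simp add: differentiable_map_def tangent_map_def linear_frechet_derivative)

lemma chart_inv_tendsto: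
  assumes "is_chart c" "p \<in> fst c"
  shows "filterlim (chart_inv c) (nhds p) (nhds (snd c p))"
  using tendsto_nhdsI[OF chart_open_image[OF assms(1)] _ chart_inv_continuous[OF assms(1)], of "snd c p"]
    chart_inv_chart[OF assms] assms(2) by simp

text \<open>The preferred chart at \<open>f p\<close> serves both as the target chart of \<open>f\<close> and as the source
  chart of \<open>g\<close>, so the chain rule of calculus applies as it stands. Continuity of \<open>f\<close> keeps nearby points inside that chart.\<close>

lemma tangent_map_compose:
  assumes A: "chart_cover A" and B: "chart_cover B"
    and f: "differentiable_map A B f p" and g: "differentiable_map B C g (f p)"
  shows "tangent_map A C (\<lambda>x. g (f x)) p = (\<lambda>v. tangent_map B C g (f p) (tangent_map A B f p v))"
proof -
  let ?c = "chart_at A p" and ?d = "chart_at B (f p)" and ?e = "chart_at C (g (f p))"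
  let ?f = "snd ?d \<circ> f \<circ> chart_inv ?c" and ?g = "snd ?e \<circ> g \<circ> chart_inv ?d"
  note c = chart_at[OF A, of p] and d = chart_at[OF B, of "f p"]
  have fp: "?f (snd ?c p) = snd ?d (f p)"
    using chart_inv_chart[OF c(2,3)] by simp
  have F: "(?f has_derivative tangent_map A B f p) (at (snd ?c p))"
    using f unfolding differentiable_map_def tangent_map_def by (elim conjE) (rule has_frechet_derivative)
  have G: "(?g has_derivative tangent_map B C g (f p)) (at (?f (snd ?c p)))"
    using g unfolding differentiable_map_def tangent_map_def fp by (elim conjE) (rule has_frechet_derivative)
  have GF: "((\<lambda>x. ?g (?f x)) has_derivative (\<lambda>v. tangent_map B C g (f p) (tangent_map A B f p v)))
      (at (snd ?c p))"
    by (rule has_derivative_compose[OF F G])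
  have "filterlim (\<lambda>x. f (chart_inv ?c x)) (nhds (f p)) (nhds (snd ?c p))"
    using f unfolding differentiable_map_def
    by (elim conjE) (rule filterlim_compose[OF _ chart_inv_tendsto[OF c(2,3)]])
  then have "eventually (\<lambda>x. f (chart_inv ?c x) \<in> fst ?d) (nhds (snd ?c p))"
    by (rule topological_tendstoD[OF _ chart_open[OF d(2)] d(3)])
  then have ev: "eventually (\<lambda>x. ?g (?f x) = (snd ?e \<circ> (\<lambda>x. g (f x)) \<circ> chart_inv ?c) x) (nhds (snd ?c p))"
    by (rule eventually_mono) (simp add: chart_inv_chart[OF d(2)])
  have H: "((snd ?e \<circ> (\<lambda>x. g (f x)) \<circ> chart_inv ?c) has_derivative
      (\<lambda>v. tangent_map B C g (f p) (tangent_map A B f p v))) (at (snd ?c p))"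
    by (rule has_derivative_transform_eventually[OF GF])
      (use ev eventually_nhds_x_imp_x[OF ev] in \<open>auto simp: eventually_at_filter elim: eventually_mono\<close>)
  show "tangent_map A C (\<lambda>x. g (f x)) p = (\<lambda>v. tangent_map B C g (f p) (tangent_map A B f p v))"
    unfolding tangent_map_def[of A C] by (rule frechet_derivative_eqI[OF H])
qed

lemma tangent_map_id:
  assumes "chart_cover A"
  shows "tangent_map A A (\<lambda>x. x) p = (\<lambda>v. v)"
  unfolding tangent_map_def
proof (rule frechet_derivative_eqI)
  let ?c = "chart_at A p"
  note c = chart_at[OF assms, of p]
  show "(snd ?c \<circ> (\<lambda>x. x) \<circ> chart_inv ?c has_derivative (\<lambda>v. v)) (at (snd ?c p))"
    by (rule has_derivative_transform_within_open[OF has_derivative_ident chart_open_image[OF c(2)]])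
      (use c(3) in \<open>auto simp: chart_chart_inv[OF c(2)]\<close>)
qed

section \<open>The group in coordinates around the unit\<close>

context lie_group
begin

lemma in_carrier [simp]: "x \<in> carrier G"
  by (simp add: carrier_eq)

lemma mult_cancel [simp]:
  "inv x \<otimes> (x \<otimes> y) = y" "x \<otimes> (inv x \<otimes> y) = y"
  by (simp_all flip: m_assoc)

lemma cover: "chart_cover (atlas G)"
  using atlas by (rule smooth_atlas_cover)

lemma smooth_map_on_mult:
  assumes A: "chart_cover A" and f: "smooth_map_on A (atlas G) S f" and g: "smooth_map_on A (atlas G) S g"
  shows "smooth_map_on A (atlas G) S (\<lambda>x. f x \<otimes> g x)"
  using smooth_map_on_compose[OF A chart_cover_prod[OF cover cover] cover smooth_mult
      smooth_map_on_Pair[OF A cover cover f g]] by simp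

lemma smooth_map_on_inv:
  assumes A: "chart_cover A" and f: "smooth_map_on A (atlas G) S f"
  shows "smooth_map_on A (atlas G) S (\<lambda>x. inv (f x))"
  using smooth_map_on_compose[OF A cover cover smooth_inv f] by simp

lemma smooth_map_on_const_group: "chart_cover A \<Longrightarrow> open S \<Longrightarrow> smooth_map_on A (atlas G) S (\<lambda>x. q)"
  by (rule smooth_map_on_const[OF _ cover])

definition unit_dom :: "'g set" where "unit_dom = fst (chart_at (atlas G) \<one>)"
definition coord :: "'g \<Rightarrow> 'a" where "coord = snd (chart_at (atlas G) \<one>)"
definition param :: "'a \<Rightarrow> 'g" where "param = chart_inv (chart_at (atlas G) \<one>)"
definition origin :: 'a where "origin = coord \<one>"
definition coord_range :: "'a set" where "coord_range = coord ` unit_dom"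

lemma
  shows one_in_unit_dom: "\<one> \<in> unit_dom" and open_unit_dom: "open unit_dom" and open_coord_range: "open coord_range"
    and origin_in: "origin \<in> coord_range"
    and param_coord: "g \<in> unit_dom \<Longrightarrow> param (coord g) = g"
    and coord_param: "x \<in> coord_range \<Longrightarrow> coord (param x) = x"
    and param_in: "x \<in> coord_range \<Longrightarrow> param x \<in> unit_dom"
    and param_origin: "param origin = \<one>"
proof -
  note c = chart_at(2,3)[OF cover, of \<one>]
  show "\<one> \<in> unit_dom" "open unit_dom" "open coord_range" "origin \<in> coord_range" "param origin = \<one>"
    "g \<in> unit_dom \<Longrightarrow> param (coord g) = g" "x \<in> coord_range \<Longrightarrow> coord (param x) = x"
    "x \<in> coord_range \<Longrightarrow> param x \<in> unit_dom"
    unfolding unit_dom_def coord_def param_def origin_def coord_range_def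
    using c(2) chart_open[OF c(1)] chart_open_image[OF c(1)] chart_inv_chart[OF c(1)]
      chart_chart_inv[OF c(1)] chart_inv_in[OF c(1)] by simp_all
qed

lemma smooth_coord: "smooth_map_on (atlas G) vec_atlas unit_dom coord"
  unfolding unit_dom_def coord_def by (rule smooth_map_on_chart(1)[OF atlas chart_at(1)[OF cover]])

lemma smooth_param: "smooth_map_on vec_atlas (atlas G) coord_range param"
  unfolding unit_dom_def coord_def param_def coord_range_def
  by (rule smooth_map_on_chart(2)[OF atlas chart_at(1)[OF cover]])

lemma smooth_on_coord:
  fixes f :: "'v::real_normed_vector \<Rightarrow> 'g"
  assumes "smooth_map_on vec_atlas (atlas G) S f"
  shows "open (S \<inter> f -` unit_dom)" "smooth_on (S \<inter> f -` unit_dom) (\<lambda>x. coord (f x))"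
proof -
  show o: "open (S \<inter> f -` unit_dom)"
    by (rule smooth_map_on_open_vimage[OF assms open_unit_dom])
  have "smooth_map_on vec_atlas vec_atlas (S \<inter> f -` unit_dom) (\<lambda>x. coord (f x))"
    by (rule smooth_map_on_compose[OF chart_cover_vec cover chart_cover_vec smooth_coord
          smooth_map_on_subset[OF assms o]]) auto
  then show "smooth_on (S \<inter> f -` unit_dom) (\<lambda>x. coord (f x))"
    by (simp add: smooth_map_on_vec_iff)
qed

text \<open>Multiplication and right division in the chart at the unit, defined near
  \<open>(origin, origin)\<close> only. Right division is what right-trivialized derivatives are made of, and it
  provides inverses of right translations without inverting linear maps.\<close>

definition coord_mult :: "'a \<times> 'a \<Rightarrow> 'a" where "coord_mult p = coord (param (fst p) \<otimes> param (snd p))"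
definition coord_div :: "'a \<times> 'a \<Rightarrow> 'a" where "coord_div p = coord (param (fst p) \<otimes> inv (param (snd p)))"
definition mult_dom :: "('a \<times> 'a) set" where
  "mult_dom = (coord_range \<times> coord_range) \<inter> (\<lambda>p. param (fst p) \<otimes> param (snd p)) -` unit_dom"
definition div_dom :: "('a \<times> 'a) set" where
  "div_dom = (coord_range \<times> coord_range) \<inter> (\<lambda>p. param (fst p) \<otimes> inv (param (snd p))) -` unit_dom"

lemma smooth_param_fst: "smooth_map_on vec_atlas (atlas G) (coord_range \<times> coord_range) (\<lambda>p. param (fst p))"
  and smooth_param_snd: "smooth_map_on vec_atlas (atlas G) (coord_range \<times> coord_range) (\<lambda>p. param (snd p))"
proof -
  have o: "open (coord_range \<times> coord_range)" by (intro open_Times open_coord_range)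
  have "smooth_map_on vec_atlas vec_atlas (coord_range \<times> coord_range) (fst :: 'a \<times> 'a \<Rightarrow> 'a)"
    "smooth_map_on vec_atlas vec_atlas (coord_range \<times> coord_range) (snd :: 'a \<times> 'a \<Rightarrow> 'a)"
    using smooth_on_bounded_linear[OF o bounded_linear_fst smooth_on_id[OF o]]
      smooth_on_bounded_linear[OF o bounded_linear_snd smooth_on_id[OF o]] o
    by (auto simp: smooth_map_on_vec_iff)
  then show "smooth_map_on vec_atlas (atlas G) (coord_range \<times> coord_range) (\<lambda>p. param (fst p))"
    "smooth_map_on vec_atlas (atlas G) (coord_range \<times> coord_range) (\<lambda>p. param (snd p))"
    by (auto intro!: smooth_map_on_compose[OF chart_cover_vec chart_cover_vec cover smooth_param])
qed

lemma open_mult_dom: "open mult_dom" and smooth_coord_mult: "smooth_on mult_dom coord_mult"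
  using smooth_on_coord[OF smooth_map_on_mult[OF chart_cover_vec smooth_param_fst smooth_param_snd]]
  unfolding mult_dom_def coord_mult_def[abs_def] by auto

lemma open_div_dom: "open div_dom" and smooth_coord_div: "smooth_on div_dom coord_div"
  using smooth_on_coord[OF smooth_map_on_mult[OF chart_cover_vec smooth_param_fst
        smooth_map_on_inv[OF chart_cover_vec smooth_param_snd]]]
  unfolding div_dom_def coord_div_def[abs_def] by auto

lemma has_derivative_coord_mult: "p \<in> mult_dom \<Longrightarrow> (coord_mult has_derivative frechet_derivative coord_mult (at p)) (at p)"
  by (rule smooth_on_has_derivative[OF smooth_coord_mult])

lemma has_derivative_coord_div: "p \<in> div_dom \<Longrightarrow> (coord_div has_derivative frechet_derivative coord_div (at p)) (at p)"
  by (rule smooth_on_has_derivative[OF smooth_coord_div])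

text \<open>The differentials, at the unit, of left and right translation by the point with coordinates \<open>x\<close>,
  and the differential at that point of the right translation back to the unit.\<close>

definition dleft :: "'a \<Rightarrow> 'a \<Rightarrow> 'a" where "dleft x v = frechet_derivative coord_mult (at (x, origin)) (0, v)"
definition dright :: "'a \<Rightarrow> 'a \<Rightarrow> 'a" where "dright x v = frechet_derivative coord_mult (at (origin, x)) (v, 0)"
definition dright_inv :: "'a \<Rightarrow> 'a \<Rightarrow> 'a" where "dright_inv x v = frechet_derivative coord_div (at (x, x)) (v, 0)"

lemma in_dom: "x \<in> coord_range \<Longrightarrow> (x, origin) \<in> mult_dom" "x \<in> coord_range \<Longrightarrow> (origin, x) \<in> mult_dom"
  "x \<in> coord_range \<Longrightarrow> (x, x) \<in> div_dom"
  by (simp_all add: mult_dom_def div_dom_def origin_in param_origin param_in one_in_unit_dom)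

lemma coord_mult_origin: "x \<in> coord_range \<Longrightarrow> coord_mult (x, origin) = x" "x \<in> coord_range \<Longrightarrow> coord_mult (origin, x) = x"
  by (simp_all add: coord_mult_def param_origin coord_param)

lemma dleft_derivative:
  assumes "x \<in> coord_range"
  shows "((\<lambda>y. coord_mult (x, y)) has_derivative dleft x) (at origin)"
  using has_derivative_compose[OF has_derivative_Pair[OF has_derivative_const has_derivative_ident]
      has_derivative_coord_mult[OF in_dom(1)[OF assms]]]
  by (simp add: dleft_def[abs_def])

lemma dright_derivative:
  assumes "x \<in> coord_range"
  shows "((\<lambda>y. coord_mult (y, x)) has_derivative dright x) (at origin)"
  using has_derivative_compose[OF has_derivative_Pair[OF has_derivative_ident has_derivative_const]
      has_derivative_coord_mult[OF in_dom(2)[OF assms]]]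
  by (simp add: dright_def[abs_def])

lemma dright_inv_derivative:
  assumes "x \<in> coord_range"
  shows "((\<lambda>y. coord_div (y, x)) has_derivative dright_inv x) (at x)"
  using has_derivative_compose[OF has_derivative_Pair[OF has_derivative_ident has_derivative_const]
      has_derivative_coord_div[OF in_dom(3)[OF assms]]]
  by (simp add: dright_inv_def[abs_def])

lemma linear_dright_inv: "x \<in> coord_range \<Longrightarrow> linear (dright_inv x)"
  using dright_inv_derivative has_derivative_linear by blast

lemma dleft_origin: "dleft origin v = v" and dright_origin: "dright origin v = v"
proof -
  have "((\<lambda>y. y) has_derivative dleft origin) (at origin)" "((\<lambda>y. y) has_derivative dright origin) (at origin)"
    using has_derivative_transform_within_open[OF dleft_derivative[OF origin_in] open_coord_range origin_in coord_mult_origin(2)]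
      has_derivative_transform_within_open[OF dright_derivative[OF origin_in] open_coord_range origin_in coord_mult_origin(1)]
    by auto
  then show "dleft origin v = v" "dright origin v = v"
    using has_derivative_unique[OF has_derivative_ident] by metis+
qed

text \<open>Differentiate \<open>(y x) x\<inverse> = y\<close> with respect to \<open>y\<close>.\<close>

lemma dright_inv_dright:
  assumes x: "x \<in> coord_range"
  shows "dright_inv x (dright x v) = v"
proof -
  have d: "((\<lambda>y. coord_div (y, x)) has_derivative dright_inv x) (at (coord_mult (origin, x)))"
    using dright_inv_derivative[OF x] by (simp add: coord_mult_origin(2)[OF x])
  have "((\<lambda>y. coord_div (coord_mult (y, x), x)) has_derivative (\<lambda>v. dright_inv x (dright x v))) (at origin)"
    by (rule has_derivative_compose[OF dright_derivative[OF x] d])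
  moreover have "open ((\<lambda>y. (y, x)) -` mult_dom)"
    by (rule open_vimage[OF open_mult_dom]) (intro continuous_on_Pair continuous_on_id continuous_on_const)
  ultimately have "((\<lambda>y. y) has_derivative (\<lambda>v. dright_inv x (dright x v))) (at origin)"
  proof (rule has_derivative_transform_within_open)
    show "origin \<in> (\<lambda>y. (y, x)) -` mult_dom" using in_dom(2)[OF x] by simp
    show "coord_div (coord_mult (y, x), x) = y" if "y \<in> (\<lambda>y. (y, x)) -` mult_dom" for y
      using that x by (auto simp: coord_div_def coord_mult_def mult_dom_def param_coord coord_param m_assoc)
  qed
  then have "(\<lambda>v. dright_inv x (dright x v)) = (\<lambda>v. v)"
    by (rule has_derivative_unique) (rule has_derivative_ident)
  then show ?thesis by (rule fun_cong)
qed

lemma dright_inv_origin: "dright_inv origin v = v"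
  using dright_inv_dright[OF origin_in] dright_origin by simp

text \<open>The mixed second derivative at the unit of the multiplication in coordinates, i.e. the bilinear term
  \<open>\<beta>\<close> in \<open>x y = x + y + \<beta>(x, y) + \<cdots>\<close> for coordinates centred at the unit. It governs the first-order
  behaviour of all translations: moving left translation in the direction \<open>u\<close> yields \<open>\<beta>(u, \<cdot>)\<close>, moving right
  translation yields \<open>\<beta>(\<cdot>, u)\<close>.\<close>

definition mixed_deriv :: "'a \<Rightarrow> 'a \<Rightarrow> 'a" where
  "mixed_deriv u v = frechet_derivative (\<lambda>p. frechet_derivative coord_mult (at p) (0, v)) (at (origin, origin)) (u, 0)"

lemma has_second_derivative_coord_mult:
  "p \<in> mult_dom \<Longrightarrow> ((\<lambda>p. frechet_derivative coord_mult (at p) w) has_derivative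
     frechet_derivative (\<lambda>p. frechet_derivative coord_mult (at p) w) (at p)) (at p)"
  by (rule smooth_on_has_derivative[OF smooth_on_frechet_derivative[OF smooth_coord_mult]])

lemma dleft_has_derivative: "((\<lambda>x. dleft x v) has_derivative (\<lambda>u. mixed_deriv u v)) (at origin)"
  using has_derivative_compose[OF has_derivative_Pair[OF has_derivative_ident has_derivative_const]
      has_second_derivative_coord_mult[OF in_dom(1)[OF origin_in]]]
  by (simp add: dleft_def mixed_deriv_def)

text \<open>Here the order of differentiation is the opposite of the one in the definition of
  \<open>mixed_deriv\<close>, whence the symmetry of second derivatives.\<close>

lemma dright_has_derivative: "((\<lambda>x. dright x v) has_derivative (\<lambda>u. mixed_deriv v u)) (at origin)"
proof -
  have "mixed_deriv v u = frechet_derivative (\<lambda>p. frechet_derivative coord_mult (at p) (v, 0)) (at (origin, origin)) (0, u)" for u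
    unfolding mixed_deriv_def
    by (rule symmetric_second_derivative[OF open_mult_dom in_dom(1)[OF origin_in] has_derivative_coord_mult
          has_second_derivative_coord_mult has_second_derivative_coord_mult]) (use in_dom(1)[OF origin_in] in auto)
  then show ?thesis
    using has_derivative_compose[OF has_derivative_Pair[OF has_derivative_const has_derivative_ident]
        has_second_derivative_coord_mult[OF in_dom(1)[OF origin_in]]]
    by (simp add: dright_def)
qed

lemma linear_mixed_deriv_left: "linear (\<lambda>u. mixed_deriv u v)"
  using dleft_has_derivative has_derivative_linear by blast

lemma linear_mixed_deriv_right: "linear (mixed_deriv v)"
  using dright_has_derivative has_derivative_linear by blast

lemma smooth_on_dright_inv: "smooth_on coord_range (\<lambda>x. dright_inv x v)"
  unfolding dright_inv_def
  by (rule smooth_on_compose[OF open_coord_range smooth_on_Pair[OF open_coord_range smooth_on_id[OF open_coord_range]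
          smooth_on_id[OF open_coord_range]] smooth_on_frechet_derivative[OF smooth_coord_div]])
    (auto simp: in_dom)

lemma smooth_on_dleft: "smooth_on coord_range (\<lambda>x. dleft x v)"
  unfolding dleft_def
  by (rule smooth_on_compose[OF open_coord_range smooth_on_Pair[OF open_coord_range smooth_on_id[OF open_coord_range]
          smooth_on_const[OF open_coord_range]] smooth_on_frechet_derivative[OF smooth_coord_mult]])
    (auto simp: in_dom)

text \<open>Differentiate the constant \<open>dright_inv x (dright x v) = v\<close> at the unit, where both factors
  are the identity.\<close>

lemma dright_inv_has_derivative: "((\<lambda>x. dright_inv x v) has_derivative (\<lambda>u. - mixed_deriv v u)) (at origin)"
proof -
  let ?D = "\<lambda>v. frechet_derivative (\<lambda>x. dright_inv x v) (at origin)"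
  have D: "((\<lambda>x. dright_inv x v) has_derivative ?D v) (at origin)" for v
    by (rule smooth_on_has_derivative[OF smooth_on_dright_inv origin_in])
  have "((\<lambda>x. dright_inv x (dright x v)) has_derivative (\<lambda>u. ?D (dright origin v) u + dright_inv origin (mixed_deriv v u))) (at origin)"
    by (rule has_derivative_linear_family[OF open_coord_range origin_in linear_dright_inv D dright_has_derivative])
  then have "((\<lambda>x. v) has_derivative (\<lambda>u. ?D v u + mixed_deriv v u)) (at origin)"
    unfolding dright_origin dright_inv_origin
    by (rule has_derivative_transform_within_open[OF _ open_coord_range origin_in]) (rule dright_inv_dright)
  then have "(\<lambda>u. ?D v u + mixed_deriv v u) = (\<lambda>u. 0)"
    by (rule has_derivative_unique) (rule has_derivative_const)
  then have "?D v = (\<lambda>u. - mixed_deriv v u)"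
    by (simp add: fun_eq_iff add_eq_0_iff2)
  with D[of v] show ?thesis by simp
qed

section \<open>The Lie bracket in coordinates\<close>

lemma smooth_left: "smooth_map_on (atlas G) (atlas G) UNIV (\<lambda>x. g \<otimes> x)"
  and smooth_right: "smooth_map_on (atlas G) (atlas G) UNIV (\<lambda>x. x \<otimes> g)"
  by (intro smooth_map_on_mult cover smooth_map_on_const_group open_UNIV smooth_map_on_id atlas)+

lemma smooth_conj: "smooth_map_on (atlas G) (atlas G) UNIV (\<lambda>x. g \<otimes> x \<otimes> inv g)"
  by (intro smooth_map_on_mult cover smooth_map_on_const_group open_UNIV smooth_map_on_id atlas)

lemma differentiable_left: "differentiable_map (atlas G) (atlas G) (\<lambda>x. g \<otimes> x) p"
  and differentiable_right: "differentiable_map (atlas G) (atlas G) (\<lambda>x. x \<otimes> g) p"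
  and differentiable_conj: "differentiable_map (atlas G) (atlas G) (\<lambda>x. g \<otimes> x \<otimes> inv g) p"
  by (rule smooth_map_on_differentiable[OF cover cover smooth_left UNIV_I]
      smooth_map_on_differentiable[OF cover cover smooth_right UNIV_I]
      smooth_map_on_differentiable[OF cover cover smooth_conj UNIV_I])+

lemma differentiable_coord: "g \<in> unit_dom \<Longrightarrow> differentiable_map (atlas G) vec_atlas coord g"
  by (rule smooth_map_on_differentiable[OF cover chart_cover_vec smooth_coord])

text \<open>The components of a left-invariant field at \<open>param x\<close> refer to the preferred chart at that
  point, which may change wildly with \<open>x\<close>; passing to the chart at the unit and to left translation in one
  application of the chain rule eliminates it.\<close>

lemma left_field_coord:
  assumes x: "x \<in> coord_range"
  shows "field_at_unit_chart G (left_invariant_field G \<xi>) x = dleft x \<xi>"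
proof -
  have "field_at_unit_chart G (left_invariant_field G \<xi>) x
      = tangent_map (atlas G) vec_atlas coord (param x \<otimes> \<one>)
          (tangent_map (atlas G) (atlas G) (\<lambda>y. param x \<otimes> y) \<one> \<xi>)"
    by (simp add: field_at_unit_chart_def Let_def left_invariant_field_def coord_def param_def)
  also have "\<dots> = tangent_map (atlas G) vec_atlas (\<lambda>y. coord (param x \<otimes> y)) \<one> \<xi>"
    by (subst tangent_map_compose[OF cover cover differentiable_left differentiable_coord])
      (simp_all add: param_in[OF x])
  also have "\<dots> = frechet_derivative (\<lambda>y. coord_mult (x, y)) (at origin) \<xi>"
    by (simp add: tangent_map_def chart_at_vec o_def coord_mult_def param_def[symmetric] coord_def[symmetric]
        origin_def[symmetric])
  also have "\<dots> = dleft x \<xi>"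
    using frechet_derivative_eqI[OF dleft_derivative[OF x]] by simp
  finally show ?thesis .
qed

lemma lie_bracket_coord: "lie_bracket G \<xi> \<eta> = mixed_deriv \<xi> \<eta> - mixed_deriv \<eta> \<xi>"
proof -
  have D: "frechet_derivative (field_at_unit_chart G (left_invariant_field G \<xi>)) (at origin) = (\<lambda>u. mixed_deriv u \<xi>)" for \<xi>
    by (rule frechet_derivative_eqI, rule has_derivative_transform_within_open[OF dleft_has_derivative open_coord_range origin_in])
      (simp add: left_field_coord)
  show ?thesis
    unfolding lie_bracket_def Let_def coord_def[symmetric] origin_def[symmetric] D
    by (simp add: left_field_coord[OF origin_in] dleft_origin)
qed

lemma lie_bracket_antisym: "lie_bracket G \<eta> \<xi> = - lie_bracket G \<xi> \<eta>"
  by (simp add: lie_bracket_coord)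

lemma linear_lie_bracket: "linear (lie_bracket G \<xi>)" "linear (\<lambda>\<xi>. lie_bracket G \<xi> \<eta>)"
  unfolding lie_bracket_coord[abs_def]
  by (intro linear_compose_sub linear_mixed_deriv_left linear_mixed_deriv_right)+

section \<open>The adjoint action\<close>

lemma tangent_map_unit:
  assumes "f \<one> = \<one>"
  shows "tangent_map (atlas G) (atlas G) f \<one> = frechet_derivative (\<lambda>x. coord (f (param x))) (at origin)"
  by (simp add: tangent_map_def assms o_def param_def[symmetric] coord_def[symmetric] origin_def[symmetric])

lemma linear_Ad: "linear (Ad G g)"
  unfolding Ad_def by (rule tangent_map_linear[OF differentiable_conj])

lemma Ad_mult: "Ad G (g \<otimes> h) \<xi> = Ad G g (Ad G h \<xi>)"
proof -
  have "Ad G (g \<otimes> h) = tangent_map (atlas G) (atlas G) (\<lambda>x. g \<otimes> (h \<otimes> x \<otimes> inv h) \<otimes> inv g) \<one>"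
    unfolding Ad_def by (simp add: m_assoc inv_mult_group)
  then show ?thesis
    unfolding Ad_def
    by (subst (asm) tangent_map_compose[OF cover cover differentiable_conj differentiable_conj]) simp
qed

lemma Ad_one: "Ad G \<one> \<xi> = \<xi>"
  unfolding Ad_def by (simp add: tangent_map_id[OF cover])

lemma Ad_inv: "Ad G (inv g) (Ad G g \<xi>) = \<xi>" "Ad G g (Ad G (inv g) \<xi>) = \<xi>"
  by (simp_all add: Ad_mult[symmetric] Ad_one)

text \<open>Conjugation is left translation followed by right division: \<open>x y x\<inverse> = (x y) / x\<close>.\<close>

lemma Ad_param:
  assumes x: "x \<in> coord_range"
  shows "Ad G (param x) \<eta> = dright_inv x (dleft x \<eta>)"
proof -
  have d: "((\<lambda>y. coord_div (y, x)) has_derivative dright_inv x) (at (coord_mult (x, origin)))"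
    using dright_inv_derivative[OF x] by (simp add: coord_mult_origin(1)[OF x])
  have "((\<lambda>y. coord_div (coord_mult (x, y), x)) has_derivative (\<lambda>v. dright_inv x (dleft x v))) (at origin)"
    by (rule has_derivative_compose[OF dleft_derivative[OF x] d])
  moreover have "open ((\<lambda>y. (x, y)) -` mult_dom)"
    by (rule open_vimage[OF open_mult_dom]) (intro continuous_on_Pair continuous_on_id continuous_on_const)
  ultimately have "((\<lambda>y. coord (param x \<otimes> param y \<otimes> inv (param x))) has_derivative
      (\<lambda>v. dright_inv x (dleft x v))) (at origin)"
  proof (rule has_derivative_transform_within_open)
    show "origin \<in> (\<lambda>y. (x, y)) -` mult_dom" using in_dom(1)[OF x] by simp
    show "coord_div (coord_mult (x, y), x) = coord (param x \<otimes> param y \<otimes> inv (param x))"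
      if "y \<in> (\<lambda>y. (x, y)) -` mult_dom" for y
      using that x by (auto simp: coord_div_def coord_mult_def mult_dom_def param_coord coord_param m_assoc)
  qed
  then show ?thesis
    unfolding Ad_def by (subst tangent_map_unit) (simp_all add: frechet_derivative_eqI)
qed

text \<open>The derivatives \<open>\<beta>(u, \<eta>)\<close> of left translation and \<open>-\<beta>(\<eta>, u)\<close> of inverse right translation
  combine to the bracket.\<close>

lemma Ad_param_has_derivative:
  "((\<lambda>x. Ad G (param x) \<eta>) has_derivative (\<lambda>u. lie_bracket G u \<eta>)) (at origin)"
proof -
  have "((\<lambda>x. dright_inv x (dleft x \<eta>)) has_derivative
      (\<lambda>u. - mixed_deriv (dleft origin \<eta>) u + dright_inv origin (mixed_deriv u \<eta>))) (at origin)"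
    by (rule has_derivative_linear_family[OF open_coord_range origin_in linear_dright_inv dright_inv_has_derivative
          dleft_has_derivative])
  then have "((\<lambda>x. dright_inv x (dleft x \<eta>)) has_derivative (\<lambda>u. lie_bracket G u \<eta>)) (at origin)"
    by (simp add: dleft_origin dright_inv_origin lie_bracket_coord)
  then show ?thesis
    by (rule has_derivative_transform_within_open[OF _ open_coord_range origin_in]) (simp add: Ad_param)
qed

lemma smooth_on_Ad_param: "smooth_on coord_range (\<lambda>x. Ad G (param x) \<eta>)"
proof (subst smooth_on_cong[OF open_coord_range Ad_param])
  show "smooth_on coord_range (\<lambda>x. dright_inv x (dleft x \<eta>))"
    by (rule smooth_on_linear_family[OF open_coord_range linear_dright_inv smooth_on_dright_inv smooth_on_dleft])
qed

text \<open>Near the unit this is read off from the coordinate formula; \<open>Ad\<^bsub>g\<^esub> = Ad\<^bsub>g h\<inverse>\<^esub> \<circ> Ad\<^bsub>h\<^esub>\<close> moves it to a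
  neighbourhood of any \<open>h\<close>.\<close>

lemma smooth_Ad: "smooth_map_on (atlas G) vec_atlas UNIV (\<lambda>g. Ad G g \<eta>)"
proof (rule smooth_map_on_local[OF cover chart_cover_vec])
  fix g0
  let ?V = "UNIV \<inter> (\<lambda>g. g \<otimes> inv g0) -` unit_dom"
  have o: "open ?V" by (rule smooth_map_on_open_vimage[OF smooth_right open_unit_dom])
  have 1: "smooth_map_on (atlas G) vec_atlas ?V (\<lambda>g. coord (g \<otimes> inv g0))"
    by (rule smooth_map_on_compose[OF cover cover chart_cover_vec smooth_coord
          smooth_map_on_subset[OF smooth_right o subset_UNIV]]) auto
  have 2: "smooth_map_on vec_atlas vec_atlas coord_range (\<lambda>x. Ad G (param x) (Ad G g0 \<eta>))"
    using smooth_on_Ad_param open_coord_range by (simp add: smooth_map_on_vec_iff)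
  have "smooth_map_on (atlas G) vec_atlas ?V (\<lambda>g. Ad G (param (coord (g \<otimes> inv g0))) (Ad G g0 \<eta>))"
    by (rule smooth_map_on_compose[OF cover chart_cover_vec chart_cover_vec 2 1])
      (auto simp: coord_range_def)
  then have "smooth_map_on (atlas G) vec_atlas ?V (\<lambda>g. Ad G g \<eta>)"
  proof (rule smooth_map_on_cong[OF cover chart_cover_vec])
    fix g assume "g \<in> ?V"
    then have "param (coord (g \<otimes> inv g0)) \<otimes> g0 = g" by (simp add: param_coord m_assoc)
    then show "Ad G (param (coord (g \<otimes> inv g0))) (Ad G g0 \<eta>) = Ad G g \<eta>"
      by (simp only: Ad_mult[symmetric])
  qed
  moreover have "g0 \<in> ?V" by (simp add: one_in_unit_dom)
  ultimately show "\<exists>V. g0 \<in> V \<and> V \<subseteq> UNIV \<and> smooth_map_on (atlas G) vec_atlas V (\<lambda>g. Ad G g \<eta>)"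
    by (intro exI[of _ ?V] conjI subset_UNIV)
qed

section \<open>Right-trivialized derivatives\<close>

text \<open>This is \<open>dP P\<inverse>\<close>. Translating the values back to the unit before differentiating, instead of
  translating tangent vectors, keeps the target in the chart at the unit, so that \<open>right_deriv P\<close> can be
  differentiated with respect to the base point.\<close>

definition right_deriv :: "('v::real_normed_vector \<Rightarrow> 'g) \<Rightarrow> 'v \<Rightarrow> 'v \<Rightarrow> 'a" where
  "right_deriv P \<mu> = tangent_map vec_atlas (atlas G) (\<lambda>\<epsilon>. P \<epsilon> \<otimes> inv (P \<mu>)) \<mu>"

lemma right_deriv_coord:
  "right_deriv P \<mu> = frechet_derivative (\<lambda>\<epsilon>. coord (P \<epsilon> \<otimes> inv (P \<mu>))) (at \<mu>)"
  by (simp add: right_deriv_def tangent_map_from_vec coord_def)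

context
  fixes S and P :: "'v::real_normed_vector \<Rightarrow> 'g"
  assumes P: "smooth_map_on vec_atlas (atlas G) S P"
begin

lemma smooth_right_quotient: "smooth_map_on vec_atlas (atlas G) S (\<lambda>\<epsilon>. P \<epsilon> \<otimes> inv g)"
  using P by (intro smooth_map_on_mult chart_cover_vec P smooth_map_on_const_group) (simp add: smooth_map_on_def)

lemma differentiable_right_quotient:
  "\<mu> \<in> S \<Longrightarrow> differentiable_map vec_atlas (atlas G) (\<lambda>\<epsilon>. P \<epsilon> \<otimes> inv g) \<mu>"
  by (rule smooth_map_on_differentiable[OF chart_cover_vec cover smooth_right_quotient])

lemma linear_right_deriv: "\<mu> \<in> S \<Longrightarrow> linear (right_deriv P \<mu>)"
  unfolding right_deriv_def by (rule tangent_map_linear[OF differentiable_right_quotient])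

context
  fixes \<mu> assumes \<mu>: "\<mu> \<in> S"
begin

text \<open>All right-trivialized derivatives near \<open>\<mu>\<close> are expressed by one coordinate map, that of
  \<open>P(\<epsilon>) P(\<mu>)\<inverse>\<close>, because a quotient \<open>P(\<epsilon>) P(\<nu>)\<inverse>\<close> is also the quotient of two such elements.\<close>

abbreviation "nbhd \<equiv> S \<inter> (\<lambda>\<epsilon>. P \<epsilon> \<otimes> inv (P \<mu>)) -` unit_dom"
abbreviation "rel_coord \<equiv> \<lambda>\<epsilon>. coord (P \<epsilon> \<otimes> inv (P \<mu>))"

lemma nbhd: "open nbhd" "\<mu> \<in> nbhd" "smooth_on nbhd rel_coord"
  using smooth_on_coord[OF smooth_right_quotient] \<mu> by (auto simp: one_in_unit_dom)

lemma rel_coord_in: "\<epsilon> \<in> nbhd \<Longrightarrow> rel_coord \<epsilon> \<in> coord_range" "rel_coord \<mu> = origin"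
  by (auto simp: coord_range_def origin_def)

lemma rel_coord_derivative: "(rel_coord has_derivative right_deriv P \<mu>) (at \<mu>)"
  unfolding right_deriv_coord by (rule smooth_on_has_derivative[OF nbhd(3,2)])

lemma right_deriv_nbhd:
  assumes \<nu>: "\<nu> \<in> nbhd"
  shows "right_deriv P \<nu> v = dright_inv (rel_coord \<nu>) (frechet_derivative rel_coord (at \<nu>) v)"
proof -
  have "((\<lambda>\<epsilon>. coord_div (rel_coord \<epsilon>, rel_coord \<nu>)) has_derivative (\<lambda>v. dright_inv (rel_coord \<nu>) (frechet_derivative rel_coord (at \<nu>) v))) (at \<nu>)"
    by (rule has_derivative_compose[OF smooth_on_has_derivative[OF nbhd(3) \<nu>] dright_inv_derivative[OF rel_coord_in(1)[OF \<nu>]]])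
  then have "((\<lambda>\<epsilon>. coord (P \<epsilon> \<otimes> inv (P \<nu>))) has_derivative
      (\<lambda>v. dright_inv (rel_coord \<nu>) (frechet_derivative rel_coord (at \<nu>) v))) (at \<nu>)"
    by (rule has_derivative_transform_within_open[OF _ nbhd(1) \<nu>])
      (use \<nu> in \<open>simp add: coord_div_def param_coord inv_mult_group m_assoc\<close>)
  then show ?thesis
    unfolding right_deriv_coord by (simp add: frechet_derivative_eqI)
qed

lemma right_deriv_has_derivative:
  "((\<lambda>\<nu>. right_deriv P \<nu> v) has_derivative
     (\<lambda>u. - mixed_deriv (right_deriv P \<mu> v) (right_deriv P \<mu> u)
        + frechet_derivative (\<lambda>\<nu>. frechet_derivative rel_coord (at \<nu>) v) (at \<mu>) u)) (at \<mu>)"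
proof -
  let ?dq = "\<lambda>\<nu>. frechet_derivative rel_coord (at \<nu>) v"
  have R: "((\<lambda>\<nu>. dright_inv (rel_coord \<nu>) b) has_derivative (\<lambda>u. - mixed_deriv b (right_deriv P \<mu> u))) (at \<mu>)" for b
    by (rule has_derivative_compose[OF rel_coord_derivative]) (unfold rel_coord_in(2), rule dright_inv_has_derivative)
  have W: "(?dq has_derivative frechet_derivative ?dq (at \<mu>)) (at \<mu>)"
    by (rule smooth_on_has_derivative[OF smooth_on_frechet_derivative[OF nbhd(3)] nbhd(2)])
  have "((\<lambda>\<nu>. dright_inv (rel_coord \<nu>) (?dq \<nu>)) has_derivative
      (\<lambda>u. - mixed_deriv (?dq \<mu>) (right_deriv P \<mu> u) + dright_inv (rel_coord \<mu>) (frechet_derivative ?dq (at \<mu>) u))) (at \<mu>)"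
    by (rule has_derivative_linear_family[OF nbhd(1,2) _ R W]) (rule linear_dright_inv[OF rel_coord_in(1)])
  then have "((\<lambda>\<nu>. dright_inv (rel_coord \<nu>) (?dq \<nu>)) has_derivative
      (\<lambda>u. - mixed_deriv (right_deriv P \<mu> v) (right_deriv P \<mu> u) + frechet_derivative ?dq (at \<mu>) u)) (at \<mu>)"
    unfolding rel_coord_in(2) dright_inv_origin by (simp only: right_deriv_coord)
  then show ?thesis
    by (rule has_derivative_transform_within_open[OF _ nbhd(1,2)]) (simp only: right_deriv_nbhd)
qed

text \<open>In the difference of the two derivatives the second derivatives of the coordinate map cancel, and
  the remaining terms \<open>\<beta>(A u, A v) - \<beta>(A v, A u)\<close> form the bracket.\<close>

lemma maurer_cartan:
  "frechet_derivative (\<lambda>\<nu>. right_deriv P \<nu> v) (at \<mu>) u - frechet_derivative (\<lambda>\<nu>. right_deriv P \<nu> u) (at \<mu>) v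
     = lie_bracket G (right_deriv P \<mu> u) (right_deriv P \<mu> v)"
proof -
  have "frechet_derivative (\<lambda>\<nu>. frechet_derivative rel_coord (at \<nu>) v) (at \<mu>) u
      = frechet_derivative (\<lambda>\<nu>. frechet_derivative rel_coord (at \<nu>) u) (at \<mu>) v"
    by (rule symmetric_second_derivative[OF nbhd(1,2) smooth_on_has_derivative[OF nbhd(3)]])
      (assumption, (rule smooth_on_has_derivative[OF smooth_on_frechet_derivative[OF nbhd(3)] nbhd(2)])+)
  then show ?thesis
    unfolding frechet_derivative_eqI[OF right_deriv_has_derivative] lie_bracket_coord by simp
qed

lemma Ad_has_derivative:
  "((\<lambda>\<nu>. Ad G (P \<nu>) \<eta>) has_derivative (\<lambda>u. lie_bracket G (right_deriv P \<mu> u) (Ad G (P \<mu>) \<eta>))) (at \<mu>)"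
proof -
  have "((\<lambda>\<nu>. Ad G (param (rel_coord \<nu>)) (Ad G (P \<mu>) \<eta>)) has_derivative
      (\<lambda>u. lie_bracket G (right_deriv P \<mu> u) (Ad G (P \<mu>) \<eta>))) (at \<mu>)"
    by (rule has_derivative_compose[OF rel_coord_derivative]) (unfold rel_coord_in(2), rule Ad_param_has_derivative)
  then show ?thesis
    by (rule has_derivative_transform_within_open[OF _ nbhd(1,2)])
      (simp add: param_coord Ad_mult[symmetric] m_assoc)
qed

end

end

text \<open>Differentiate \<open>Ad\<^bsub>g x g\<inverse>\<^esub> (Ad\<^bsub>g\<^esub> \<eta>) = Ad\<^bsub>g\<^esub> (Ad\<^bsub>x\<^esub> \<eta>)\<close> with respect to \<open>x\<close> at the unit: the
  right-trivialized derivative of \<open>x \<mapsto> g x g\<inverse>\<close> there is \<open>Ad\<^bsub>g\<^esub>\<close>.\<close>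

lemma Ad_lie_bracket: "Ad G g (lie_bracket G \<xi> \<eta>) = lie_bracket G (Ad G g \<xi>) (Ad G g \<eta>)"
proof -
  let ?P = "\<lambda>x. g \<otimes> param x \<otimes> inv g"
  have P: "smooth_map_on vec_atlas (atlas G) coord_range ?P"
    by (intro smooth_map_on_mult chart_cover_vec smooth_param smooth_map_on_const_group open_coord_range)
  have R: "right_deriv ?P origin = Ad G g"
    unfolding right_deriv_coord Ad_def by (subst tangent_map_unit) (simp_all add: param_origin)
  have "((\<lambda>x. Ad G (?P x) (Ad G g \<eta>)) has_derivative
      (\<lambda>u. lie_bracket G (Ad G g u) (Ad G (?P origin) (Ad G g \<eta>)))) (at origin)"
    using Ad_has_derivative[OF P origin_in, of "Ad G g \<eta>"] unfolding R .
  moreover have "Ad G (?P x) (Ad G g \<eta>) = Ad G g (Ad G (param x) \<eta>)" for x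
    by (simp add: Ad_mult Ad_inv)
  ultimately have "((\<lambda>x. Ad G g (Ad G (param x) \<eta>)) has_derivative
      (\<lambda>u. lie_bracket G (Ad G g u) (Ad G g \<eta>))) (at origin)"
    by (simp add: param_origin Ad_one)
  moreover have "((\<lambda>x. Ad G g (Ad G (param x) \<eta>)) has_derivative (\<lambda>u. Ad G g (lie_bracket G u \<eta>))) (at origin)"
    using linear_Ad by (intro bounded_linear.has_derivative[OF _ Ad_param_has_derivative])
      (simp add: linear_conv_bounded_linear)
  ultimately have "(\<lambda>u. lie_bracket G (Ad G g u) (Ad G g \<eta>)) = (\<lambda>u. Ad G g (lie_bracket G u \<eta>))"
    by (rule has_derivative_unique)
  from fun_cong[OF this, of \<xi>] show ?thesis by simp
qed

text \<open>The quotient \<open>P(\<epsilon>) Q(\<epsilon>) (P(\<mu>) Q(\<mu>))\<inverse>\<close> is the product of \<open>P(\<epsilon>) P(\<mu>)\<inverse>\<close> and the conjugate of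
  \<open>Q(\<epsilon>) Q(\<mu>)\<inverse>\<close> by \<open>P(\<mu>)\<close>, both near the unit, where multiplication is addition to first order.\<close>

lemma right_deriv_mult:
  assumes P: "smooth_map_on vec_atlas (atlas G) S P" and Q: "smooth_map_on vec_atlas (atlas G) S Q"
    and \<mu>: "\<mu> \<in> S"
  shows "right_deriv (\<lambda>\<epsilon>. P \<epsilon> \<otimes> Q \<epsilon>) \<mu> v = right_deriv P \<mu> v + Ad G (P \<mu>) (right_deriv Q \<mu> v)"
proof -
  let ?p = "\<lambda>\<epsilon>. P \<epsilon> \<otimes> inv (P \<mu>)" and ?q = "\<lambda>\<epsilon>. P \<mu> \<otimes> (Q \<epsilon> \<otimes> inv (Q \<mu>)) \<otimes> inv (P \<mu>)"
  have oS: "open S" using P by (simp add: smooth_map_on_def)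
  have q: "smooth_map_on vec_atlas (atlas G) S ?q"
    by (intro smooth_map_on_mult chart_cover_vec Q smooth_map_on_const_group oS)
  note sp = smooth_on_coord[OF smooth_right_quotient[OF P], of "P \<mu>"] and sq = smooth_on_coord[OF q]
  have dp: "((\<lambda>\<epsilon>. coord (?p \<epsilon>)) has_derivative right_deriv P \<mu>) (at \<mu>)"
    by (rule rel_coord_derivative[OF P \<mu>])
  have dq: "((\<lambda>\<epsilon>. coord (?q \<epsilon>)) has_derivative (\<lambda>v. Ad G (P \<mu>) (right_deriv Q \<mu> v))) (at \<mu>)"
  proof -
    have "tangent_map vec_atlas (atlas G) ?q \<mu> = (\<lambda>v. Ad G (P \<mu>) (right_deriv Q \<mu> v))"
      unfolding right_deriv_def Ad_def
      by (subst tangent_map_compose[OF chart_cover_vec cover differentiable_right_quotient[OF Q \<mu>] differentiable_conj])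
        simp
    moreover have "((\<lambda>\<epsilon>. coord (?q \<epsilon>)) has_derivative tangent_map vec_atlas (atlas G) ?q \<mu>) (at \<mu>)"
    proof -
      have "\<mu> \<in> S \<inter> ?q -` unit_dom" using \<mu> by (simp add: one_in_unit_dom)
      from smooth_on_has_derivative[OF sq(2) this] show ?thesis
        by (simp add: tangent_map_from_vec coord_def)
    qed
    ultimately show ?thesis by simp
  qed
  have m: "(coord_mult has_derivative (\<lambda>w. fst w + snd w)) (at (coord (?p \<mu>), coord (?q \<mu>)))"
  proof -
    have 0: "(coord (?p \<mu>), coord (?q \<mu>)) = (origin, origin)" by (simp add: origin_def)
    interpret D: bounded_linear "frechet_derivative coord_mult (at (origin, origin))"
      using has_derivative_coord_mult[OF in_dom(1)[OF origin_in]] by (rule has_derivative_bounded_linear)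
    have "frechet_derivative coord_mult (at (origin, origin)) w = fst w + snd w" for w
      using D.add[of "(fst w, 0)" "(0, snd w)"] dleft_origin[of "snd w"] dright_origin[of "fst w"]
      by (simp add: dleft_def dright_def)
    then show ?thesis
      using has_derivative_coord_mult[OF in_dom(1)[OF origin_in]] unfolding 0 by presburger
  qed
  have "((\<lambda>\<epsilon>. coord_mult (coord (?p \<epsilon>), coord (?q \<epsilon>))) has_derivative
      (\<lambda>v. right_deriv P \<mu> v + Ad G (P \<mu>) (right_deriv Q \<mu> v))) (at \<mu>)"
    using has_derivative_compose[OF has_derivative_Pair[OF dp dq] m] by simp
  moreover have "open ((S \<inter> ?p -` unit_dom) \<inter> (S \<inter> ?q -` unit_dom))"
    by (intro open_Int[of "S \<inter> ?p -` unit_dom"] sp sq)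
  ultimately have "((\<lambda>\<epsilon>. coord ((P \<epsilon> \<otimes> Q \<epsilon>) \<otimes> inv (P \<mu> \<otimes> Q \<mu>))) has_derivative
      (\<lambda>v. right_deriv P \<mu> v + Ad G (P \<mu>) (right_deriv Q \<mu> v))) (at \<mu>)"
  proof (rule has_derivative_transform_within_open)
    show "\<mu> \<in> (S \<inter> ?p -` unit_dom) \<inter> (S \<inter> ?q -` unit_dom)" using \<mu> by (simp add: one_in_unit_dom)
    fix \<epsilon> assume "\<epsilon> \<in> (S \<inter> ?p -` unit_dom) \<inter> (S \<inter> ?q -` unit_dom)"
    then show "coord_mult (coord (?p \<epsilon>), coord (?q \<epsilon>)) = coord ((P \<epsilon> \<otimes> Q \<epsilon>) \<otimes> inv (P \<mu> \<otimes> Q \<mu>))"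
      by (simp add: coord_mult_def param_coord inv_mult_group m_assoc)
  qed
  then show ?thesis
    unfolding right_deriv_coord[of "\<lambda>\<epsilon>. P \<epsilon> \<otimes> Q \<epsilon>"] by (simp add: frechet_derivative_eqI)
qed

end

section \<open>Dual spaces and momentum derivatives\<close>

lemma dual_map_apply:
  fixes L :: "'a::euclidean_space \<Rightarrow> 'b::euclidean_space"
  shows "linear L \<Longrightarrow> blinfun_apply (dual_map L \<mu>) \<eta> = blinfun_apply \<mu> (L \<eta>)"
proof -
  assume "linear L"
  then have "bounded_linear (\<lambda>\<eta>. blinfun_apply \<mu> (L \<eta>))"
    by (intro bounded_linear_compose[OF blinfun.bounded_linear_right]) (simp add: linear_conv_bounded_linear)
  then show ?thesis by (simp add: dual_map_def bounded_linear_Blinfun_apply)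
qed

lemma has_derivative_dual:
  fixes f :: "'v::real_normed_vector \<Rightarrow> 'a::euclidean_space dual_space"
  assumes "\<And>v. ((\<lambda>x. blinfun_apply (f x) v) has_derivative (\<lambda>u. blinfun_apply (f' u) v)) F"
  shows "(f has_derivative f') F"
proof -
  let ?r = "\<lambda>\<mu> :: 'a dual_space. \<Sum>b\<in>Basis. blinfun_apply \<mu> b *\<^sub>R (blinfun_inner_left b :: 'a dual_space)"
  have "((\<lambda>x. ?r (f x)) has_derivative (\<lambda>u. ?r (f' u))) F"
    by (intro has_derivative_sum has_derivative_scaleR_left assms)
  then show ?thesis by (subst (asm) (1 2) dual_representation[symmetric])
qed

text \<open>On a Euclidean space the inner products already separate points; hence the representative in
  \<open>momentum_derivative\<close> is unique.\<close>

lemma dual_separates: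
  fixes v w :: "'a::euclidean_space"
  assumes "\<And>\<nu>::'a dual_space. blinfun_apply \<nu> v = blinfun_apply \<nu> w"
  shows "v = w"
proof (rule euclidean_eqI)
  show "v \<bullet> b = w \<bullet> b" for b
    using assms[of "blinfun_inner_left b"] by simp
qed

lemma momentum_derivative_eqI:
  fixes v :: "'a::euclidean_space"
  assumes "(f has_derivative (\<lambda>\<nu>. blinfun_apply \<nu> v)) (at \<mu>)"
  shows "momentum_derivative f \<mu> = v"
  unfolding momentum_derivative_def frechet_derivative_eqI[OF assms]
proof (rule the_equality)
  show "w = v" if "\<forall>\<nu>::'a dual_space. blinfun_apply \<nu> v = blinfun_apply \<nu> w" for w
    by (rule dual_separates) (rule that[rule_format, symmetric])
qed simp

text \<open>Finite dimension makes every linear functional on the dual space an evaluation; the explicit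
  representative shows moreover that gradients of smooth functions are smooth.\<close>

lemma
  fixes f :: "'a::euclidean_space dual_space \<Rightarrow> real"
  assumes "f differentiable (at \<mu>)"
  shows momentum_derivative_sum:
      "momentum_derivative f \<mu> = (\<Sum>b\<in>Basis. frechet_derivative f (at \<mu>) (blinfun_inner_left b) *\<^sub>R b)"
    and has_derivative_momentum_derivative:
      "(f has_derivative (\<lambda>\<nu>. blinfun_apply \<nu> (momentum_derivative f \<mu>))) (at \<mu>)"
proof -
  let ?D = "frechet_derivative f (at \<mu>)" and ?v = "\<Sum>b\<in>Basis. frechet_derivative f (at \<mu>) (blinfun_inner_left b) *\<^sub>R b"
  have D: "(f has_derivative ?D) (at \<mu>)" using assms by (rule has_frechet_derivative)
  interpret bounded_linear ?D using D by (rule has_derivative_bounded_linear)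
  have "?D \<nu> = blinfun_apply \<nu> ?v" for \<nu>
  proof -
    have "?D \<nu> = ?D (\<Sum>b\<in>Basis. blinfun_apply \<nu> b *\<^sub>R blinfun_inner_left b)"
      by (rule arg_cong[OF dual_representation])
    also have "\<dots> = (\<Sum>b\<in>Basis. blinfun_apply \<nu> b * ?D (blinfun_inner_left b))"
      by (simp add: sum scaleR)
    also have "\<dots> = blinfun_apply \<nu> ?v"
      by (simp add: blinfun.sum_right blinfun.scaleR_right mult.commute)
    finally show ?thesis .
  qed
  then have "?D = (\<lambda>\<nu>. blinfun_apply \<nu> ?v)" by (rule ext)
  with D have v: "(f has_derivative (\<lambda>\<nu>. blinfun_apply \<nu> ?v)) (at \<mu>)" by (simp only:)
  then show m: "momentum_derivative f \<mu> = ?v" by (rule momentum_derivative_eqI)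
  show "(f has_derivative (\<lambda>\<nu>. blinfun_apply \<nu> (momentum_derivative f \<mu>))) (at \<mu>)"
    unfolding m by (rule v)
qed

lemma smooth_on_differentiable: "smooth_on S f \<Longrightarrow> x \<in> S \<Longrightarrow> f differentiable (at x)"
  unfolding differentiable_def by (rule exI, rule smooth_on_has_derivative)

lemma smooth_on_momentum_derivative:
  fixes f :: "'a::euclidean_space dual_space \<Rightarrow> real"
  assumes "open S" "smooth_on S f"
  shows "smooth_on S (momentum_derivative f)"
proof -
  have "smooth_on S (\<lambda>\<mu>. frechet_derivative f (at \<mu>) (blinfun_inner_left b) *\<^sub>R b)" for b
    by (rule smooth_on_bounded_linear[OF assms(1) bounded_linear_scaleR_left
          smooth_on_frechet_derivative[OF assms(2)]])
  then have "smooth_on S (\<lambda>\<mu>. \<Sum>b\<in>Basis. frechet_derivative f (at \<mu>) (blinfun_inner_left b) *\<^sub>R b)"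
    by (rule smooth_on_sum[OF assms(1)])
  then show ?thesis
    using smooth_on_cong[OF assms(1), of "momentum_derivative f"
        "\<lambda>\<mu>. \<Sum>b\<in>Basis. frechet_derivative f (at \<mu>) (blinfun_inner_left b) *\<^sub>R b"]
      momentum_derivative_sum[OF smooth_on_differentiable[OF assms(2)]] by simp
qed

lemma smooth_map_on_dual:
  fixes f :: "'m::topological_space \<Rightarrow> 'b::euclidean_space dual_space"
  assumes A: "chart_cover A" and S: "open S"
    and f: "\<And>v. smooth_map_on A vec_atlas S (\<lambda>x. blinfun_apply (f x) v)"
  shows "smooth_map_on A vec_atlas S f"
proof (rule smooth_map_on_to_vec[OF A S])
  have "continuous_on S (\<lambda>x. \<Sum>b\<in>Basis. blinfun_apply (f x) b *\<^sub>R (blinfun_inner_left b :: 'b dual_space))"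
    using f by (intro continuous_on_sum continuous_on_scaleR continuous_on_const) (simp add: smooth_map_on_def)
  then show "continuous_on S f" by (subst (asm) dual_representation[symmetric])
  fix c assume c: "c \<in> A"
  show "smooth_on (snd c ` (S \<inter> fst c)) (\<lambda>x. f (chart_inv c x))"
  proof (rule smooth_on_dual)
    show "open (snd c ` (S \<inter> fst c))" by (rule chart_image_open[OF chart_cover_chart[OF A c] S])
    show "smooth_on (snd c ` (S \<inter> fst c)) (\<lambda>x. blinfun_apply (f (chart_inv c x)) v)" for v
      using f[of v] c by (auto simp: smooth_map_on_def vec_atlas_def o_def)
  qed
qed

section \<open>Maps that move along coadjoint orbits\<close>

context lie_group
begin

lemma Ad_star_apply: "blinfun_apply (Ad_star G g \<mu>) \<eta> = blinfun_apply \<mu> (Ad G g \<eta>)"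
  unfolding Ad_star_def by (rule dual_map_apply[OF linear_Ad])

lemma ad_star_apply: "blinfun_apply (ad_star G \<xi> \<mu>) \<eta> = blinfun_apply \<mu> (lie_bracket G \<xi> \<eta>)"
  unfolding ad_star_def by (rule dual_map_apply[OF linear_lie_bracket(1)])

lemma Ad_star_mult: "Ad_star G (g \<otimes> h) \<mu> = Ad_star G h (Ad_star G g \<mu>)"
  by (rule blinfun_eqI) (simp add: Ad_star_apply Ad_mult)

lemma ad_star_add: "ad_star G (\<xi> + \<eta>) \<mu> = ad_star G \<xi> \<mu> + ad_star G \<eta> \<mu>"
  by (rule blinfun_eqI)
    (simp add: ad_star_apply blinfun.add_left linear_add[OF linear_lie_bracket(2)] blinfun.add_right)

lemma ad_star_scaleR: "ad_star G (r *\<^sub>R \<xi>) \<mu> = r *\<^sub>R ad_star G \<xi> \<mu>"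
  by (rule blinfun_eqI)
    (simp add: ad_star_apply blinfun.scaleR_left linear_scale[OF linear_lie_bracket(2)] blinfun.scaleR_right)

lemma Ad_star_ad_star: "Ad_star G g (ad_star G \<xi> \<mu>) = ad_star G (Ad G (inv g) \<xi>) (Ad_star G g \<mu>)"
  by (rule blinfun_eqI) (simp add: Ad_star_apply ad_star_apply Ad_lie_bracket Ad_inv)

text \<open>The bracket paired with \<open>\<nu>\<close> depends on \<open>\<xi>\<close> only through \<open>ad\<^sup>*\<^sub>\<xi> \<nu>\<close>, and by antisymmetry the same holds
  for \<open>\<eta>\<close>.\<close>

lemma kks_form_ad_star:
  "kks_form G \<nu> (ad_star G \<xi> \<nu>) (ad_star G \<eta> \<nu>) = - blinfun_apply \<nu> (lie_bracket G \<xi> \<eta>)"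
  unfolding kks_form_def
proof (rule the_equality)
  fix r assume "\<exists>\<xi>' \<eta>'. ad_star G \<xi> \<nu> = ad_star G \<xi>' \<nu> \<and> ad_star G \<eta> \<nu> = ad_star G \<eta>' \<nu> \<and>
    r = - blinfun_apply \<nu> (lie_bracket G \<xi>' \<eta>')"
  then obtain \<xi>' \<eta>' where *: "ad_star G \<xi> \<nu> = ad_star G \<xi>' \<nu>" "ad_star G \<eta> \<nu> = ad_star G \<eta>' \<nu>"
    and r: "r = - blinfun_apply \<nu> (lie_bracket G \<xi>' \<eta>')" by blast
  have "blinfun_apply \<nu> (lie_bracket G \<xi>' \<eta>') = blinfun_apply \<nu> (lie_bracket G \<xi> \<eta>')"
    using *(1) by (metis ad_star_apply)
  also have "\<dots> = - blinfun_apply \<nu> (lie_bracket G \<eta>' \<xi>)"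
    by (simp add: lie_bracket_antisym[of \<xi> \<eta>'] blinfun.minus_right)
  also have "\<dots> = - blinfun_apply \<nu> (lie_bracket G \<eta> \<xi>)"
    using *(2) by (metis ad_star_apply)
  also have "\<dots> = blinfun_apply \<nu> (lie_bracket G \<xi> \<eta>)"
    by (simp add: lie_bracket_antisym[of \<xi> \<eta>] blinfun.minus_right)
  finally show "r = - blinfun_apply \<nu> (lie_bracket G \<xi> \<eta>)" using r by simp
qed blast

lemma smooth_Ad_star: "smooth_map_on (atlas G) vec_atlas UNIV (\<lambda>g. Ad_star G g \<mu>)"
proof (rule smooth_map_on_dual[OF cover open_UNIV])
  fix v
  have b: "smooth_map_on vec_atlas vec_atlas UNIV (blinfun_apply \<mu>)"
    using smooth_on_bounded_linear[OF open_UNIV blinfun.bounded_linear_right[of \<mu>] smooth_on_id[OF open_UNIV]]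
    by (simp add: smooth_map_on_vec_iff)
  show "smooth_map_on (atlas G) vec_atlas UNIV (\<lambda>g. blinfun_apply (Ad_star G g \<mu>) v)"
    unfolding Ad_star_apply
    by (rule smooth_map_on_compose[OF cover chart_cover_vec chart_cover_vec b smooth_Ad subset_UNIV])
qed

text \<open>The following maps are those of the form \<open>F \<mu> = Ad\<^sup>*\<^bsub>P(\<mu>)\<^esub> \<mu>\<close> for which the one-form \<open>\<langle>\<mu>, dP P\<inverse>\<rangle>\<close> has a
  potential \<open>\<sigma>\<close>. For a variational integrator \<open>\<sigma>\<close> is the discrete action.\<close>

context
  fixes D :: "'a dual_space set" and P :: "'a dual_space \<Rightarrow> 'g" and \<sigma> :: "'a dual_space \<Rightarrow> real"
    and F :: "'a dual_space \<Rightarrow> 'a dual_space"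
  assumes P: "smooth_map_on vec_atlas (atlas G) D P"
    and \<sigma>: "\<And>\<mu>. \<mu> \<in> D \<Longrightarrow> (\<sigma> has_derivative (\<lambda>\<delta>. blinfun_apply \<mu> (right_deriv P \<mu> \<delta>))) (at \<mu>)"
    and F: "\<And>\<mu>. \<mu> \<in> D \<Longrightarrow> F \<mu> = Ad_star G (P \<mu>) \<mu>"
begin

lemma open_domain: "open D"
  using P by (simp add: smooth_map_on_def)

lemma coadjoint_map_has_derivative:
  assumes \<mu>: "\<mu> \<in> D"
  shows "(F has_derivative (\<lambda>\<delta>. Ad_star G (P \<mu>) (\<delta> + ad_star G (right_deriv P \<mu> \<delta>) \<mu>))) (at \<mu>)"
proof -
  have "((\<lambda>\<nu>. Ad_star G (P \<nu>) \<nu>) has_derivative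
      (\<lambda>\<delta>. Ad_star G (P \<mu>) (\<delta> + ad_star G (right_deriv P \<mu> \<delta>) \<mu>))) (at \<mu>)"
  proof (rule has_derivative_dual)
    fix \<eta>
    have "((\<lambda>\<nu>. blinfun_apply \<nu> (Ad G (P \<nu>) \<eta>)) has_derivative
        (\<lambda>\<delta>. blinfun_apply \<mu> (lie_bracket G (right_deriv P \<mu> \<delta>) (Ad G (P \<mu>) \<eta>))
          + blinfun_apply \<delta> (Ad G (P \<mu>) \<eta>))) (at \<mu>)"
      by (rule blinfun.FDERIV[OF has_derivative_ident Ad_has_derivative[OF P \<mu>]])
    then show "((\<lambda>\<nu>. blinfun_apply (Ad_star G (P \<nu>) \<nu>) \<eta>) has_derivative
        (\<lambda>\<delta>. blinfun_apply (Ad_star G (P \<mu>) (\<delta> + ad_star G (right_deriv P \<mu> \<delta>) \<mu>)) \<eta>)) (at \<mu>)"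
      by (simp add: Ad_star_apply ad_star_apply blinfun.add_left add.commute)
  qed
  then show ?thesis
    by (rule has_derivative_transform_within_open[OF _ open_domain \<mu>]) (simp add: F)
qed

text \<open>The symmetry of the second derivative of the potential, in which the
  antisymmetric part of the derivative of \<open>dP P\<inverse>\<close> is given by the Maurer--Cartan equation.\<close>

lemma action_form_closed:
  assumes \<mu>: "\<mu> \<in> D"
  shows "blinfun_apply u (right_deriv P \<mu> v) - blinfun_apply v (right_deriv P \<mu> u)
    + blinfun_apply \<mu> (lie_bracket G (right_deriv P \<mu> u) (right_deriv P \<mu> v)) = 0"
proof -
  let ?D = "\<lambda>w. frechet_derivative (\<lambda>\<nu>. right_deriv P \<nu> w) (at \<mu>)"
  have "((\<lambda>\<nu>. right_deriv P \<nu> w) has_derivative ?D w) (at \<mu>)" for w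
    by (intro has_frechet_derivative differentiableI) (rule right_deriv_has_derivative[OF P \<mu>])
  then have d: "((\<lambda>\<nu>. blinfun_apply \<nu> (right_deriv P \<nu> w)) has_derivative
      (\<lambda>\<delta>. blinfun_apply \<mu> (?D w \<delta>) + blinfun_apply \<delta> (right_deriv P \<mu> w))) (at \<mu>)" for w
    by (rule blinfun.FDERIV[OF has_derivative_ident])
  have "blinfun_apply \<mu> (?D v u) + blinfun_apply u (right_deriv P \<mu> v)
      = blinfun_apply \<mu> (?D u v) + blinfun_apply v (right_deriv P \<mu> u)"
    by (rule symmetric_second_derivative_real[OF open_domain \<mu> \<sigma> d d])
  then show ?thesis
    using maurer_cartan[OF P \<mu>, of v u, symmetric] by (simp add: blinfun.diff_right)
qed

text \<open>The derivative of \<open>F\<close> at \<open>\<mu>\<close> maps \<open>ad\<^sup>*\<^sub>\<xi> \<mu>\<close> to \<open>ad\<^sup>*\<^bsub>M \<xi>\<^esub> \<mu>\<close> up to the coadjoint action of \<open>P(\<mu>)\<close>, so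
  \<open>M\<close> is its lift to the Lie algebra. The three correction terms in the expanded bracket
  are those of \<open>action_form_closed\<close> for the tangent vectors \<open>ad\<^sup>*\<^sub>\<xi> \<mu>\<close> and \<open>ad\<^sup>*\<^sub>\<eta> \<mu>\<close> of the orbit.\<close>

lemma orbit_lift_bracket:
  fixes \<mu> defines "M \<equiv> \<lambda>\<xi>. \<xi> + right_deriv P \<mu> (ad_star G \<xi> \<mu>)"
  assumes \<mu>: "\<mu> \<in> D"
  shows "blinfun_apply \<mu> (lie_bracket G (M \<xi>) (M \<eta>)) = blinfun_apply \<mu> (lie_bracket G \<xi> \<eta>)"
proof -
  let ?a = "right_deriv P \<mu> (ad_star G \<xi> \<mu>)" and ?b = "right_deriv P \<mu> (ad_star G \<eta> \<mu>)"
  have "lie_bracket G (M \<xi>) (M \<eta>) = lie_bracket G \<xi> \<eta> + lie_bracket G \<xi> ?b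
      + lie_bracket G ?a \<eta> + lie_bracket G ?a ?b"
    by (simp add: M_def linear_add[OF linear_lie_bracket(1)] linear_add[OF linear_lie_bracket(2)])
  moreover have "lie_bracket G ?a \<eta> = - lie_bracket G \<eta> ?a" by (rule lie_bracket_antisym)
  moreover have "blinfun_apply \<mu> (lie_bracket G \<xi> ?b) - blinfun_apply \<mu> (lie_bracket G \<eta> ?a)
      + blinfun_apply \<mu> (lie_bracket G ?a ?b) = 0"
    using action_form_closed[OF \<mu>, of "ad_star G \<xi> \<mu>" "ad_star G \<eta> \<mu>"] by (simp add: ad_star_apply)
  ultimately show ?thesis
    by (simp add: blinfun.add_right blinfun.minus_right blinfun.diff_right)
qed

text \<open>If \<open>M \<xi> = 0\<close>, then \<open>\<mu>[\<xi>, \<eta>] = \<mu>[M \<xi>, M \<eta>] = 0\<close> for all \<open>\<eta>\<close>, that is \<open>ad\<^sup>*\<^sub>\<xi> \<mu> = 0\<close>, and then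
  \<open>M \<xi> = \<xi>\<close>. So \<open>M\<close> is injective on the whole Lie algebra, although it preserves a degenerate form.\<close>

lemma surj_orbit_lift:
  assumes \<mu>: "\<mu> \<in> D"
  shows "surj (\<lambda>\<xi>. \<xi> + right_deriv P \<mu> (ad_star G \<xi> \<mu>))" (is "surj ?M")
proof -
  note R = linear_right_deriv[OF P \<mu>]
  have lin: "linear ?M"
    by (rule linearI) (simp_all add: ad_star_add ad_star_scaleR linear_add[OF R] linear_scale[OF R]
        scaleR_add_right)
  have "\<xi> = 0" if "?M \<xi> = 0" for \<xi>
  proof -
    have "ad_star G \<xi> \<mu> = 0"
    proof (rule blinfun_eqI)
      fix \<eta>
      have "blinfun_apply \<mu> (lie_bracket G \<xi> \<eta>) = blinfun_apply \<mu> (lie_bracket G (?M \<xi>) (?M \<eta>))"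
        using orbit_lift_bracket[OF \<mu>] by simp
      then show "blinfun_apply (ad_star G \<xi> \<mu>) \<eta> = blinfun_apply 0 \<eta>"
        using linear_0[OF linear_lie_bracket(2)] by (simp add: that ad_star_apply)
    qed
    with that show "\<xi> = 0" by (simp add: linear_0[OF R])
  qed
  then have "inj ?M" using linear_injective_0[OF lin] by blast
  then show ?thesis by (rule linear_inj_imp_surj[OF lin])
qed

text \<open>With \<open>L\<close> the derivative of \<open>F\<close> stripped of \<open>Ad\<^sup>*\<^bsub>P(\<mu>)\<^esub>\<close>, the gradient of \<open>f \<circ> F\<close> is the transpose of
  \<open>L\<close> applied to \<open>a = Ad\<^bsub>P(\<mu>)\<^esub> (\<delta>f/\<delta>\<mu>)\<close>. On tangent vectors of the orbit \<open>L\<close> lifts to \<open>M\<close>, and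
  writing \<open>a = M \<theta>\<close> shows that this transpose moves \<open>a\<close> to \<open>\<theta>\<close> modulo the stabilizer of \<open>\<mu>\<close>; so the
  invariance of the bracket under \<open>M\<close> becomes its invariance under the transpose of \<open>L\<close>.\<close>

lemma coadjoint_map_poisson:
  fixes f g :: "'a dual_space \<Rightarrow> real"
  assumes f: "f differentiable (at (F \<mu>))" and g: "g differentiable (at (F \<mu>))" and \<mu>: "\<mu> \<in> D"
  shows "lie_poisson G (f \<circ> F) (g \<circ> F) \<mu> = lie_poisson G f g (F \<mu>)"
proof -
  let ?A = "right_deriv P \<mu>" and ?T = "\<lambda>\<xi>. ad_star G \<xi> \<mu>"
  let ?L = "\<lambda>\<delta>. \<delta> + ?T (?A \<delta>)" and ?M = "\<lambda>\<xi>. \<xi> + ?A (?T \<xi>)"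
  define a b where "a = Ad G (P \<mu>) (momentum_derivative f (F \<mu>))"
    and "b = Ad G (P \<mu>) (momentum_derivative g (F \<mu>))"
  define \<xi> \<eta> where "\<xi> = momentum_derivative (f \<circ> F) \<mu>" and "\<eta> = momentum_derivative (g \<circ> F) \<mu>"
  have grad: "blinfun_apply \<delta> (momentum_derivative (k \<circ> F) \<mu>)
      = blinfun_apply (?L \<delta>) (Ad G (P \<mu>) (momentum_derivative k (F \<mu>)))"
    if k: "k differentiable (at (F \<mu>))" for \<delta> k
  proof -
    have "((\<lambda>x. k (F x)) has_derivative
        (\<lambda>\<delta>. blinfun_apply (Ad_star G (P \<mu>) (?L \<delta>)) (momentum_derivative k (F \<mu>)))) (at \<mu>)"
      by (rule has_derivative_compose[OF coadjoint_map_has_derivative[OF \<mu>] has_derivative_momentum_derivative[OF k]])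
    then have c: "((k \<circ> F) has_derivative
        (\<lambda>\<delta>. blinfun_apply (?L \<delta>) (Ad G (P \<mu>) (momentum_derivative k (F \<mu>))))) (at \<mu>)"
      by (simp add: o_def Ad_star_apply)
    then have "(k \<circ> F) differentiable (at \<mu>)" by (rule differentiableI)
    from has_derivative_unique[OF has_derivative_momentum_derivative[OF this] c]
    show ?thesis by (rule fun_cong)
  qed
  have L_T: "?L (?T \<zeta>) = ?T (?M \<zeta>)" for \<zeta> by (simp add: ad_star_add)
  obtain \<theta> where \<theta>: "a = ?M \<theta>" using surj_orbit_lift[OF \<mu>] by (rule surjE)
  have swap: "blinfun_apply (?T x) y = - blinfun_apply (?T y) x" for x y
    by (simp add: ad_star_apply lie_bracket_antisym[of y x] blinfun.minus_right)
  have \<xi>: "blinfun_apply \<delta> \<xi> = blinfun_apply (?L \<delta>) a" for \<delta>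
    unfolding \<xi>_def a_def by (rule grad[OF f])
  have \<eta>: "blinfun_apply \<delta> \<eta> = blinfun_apply (?L \<delta>) b" for \<delta>
    unfolding \<eta>_def b_def by (rule grad[OF g])
  have T_eq: "?T \<xi> = ?T \<theta>"
  proof (rule blinfun_eqI)
    fix \<zeta>
    have "blinfun_apply (?T \<xi>) \<zeta> = - blinfun_apply (?T \<zeta>) \<xi>" by (rule swap)
    also have "blinfun_apply (?T \<zeta>) \<xi> = blinfun_apply (?L (?T \<zeta>)) a" by (rule \<xi>)
    also have "\<dots> = blinfun_apply (?T (?M \<zeta>)) (?M \<theta>)" by (simp only: L_T \<theta>)
    also have "- \<dots> = blinfun_apply (?T (?M \<theta>)) (?M \<zeta>)" by (rule swap[symmetric])
    also have "\<dots> = blinfun_apply (?T \<theta>) \<zeta>"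
      by (simp only: ad_star_apply orbit_lift_bracket[OF \<mu>])
    finally show "blinfun_apply (?T \<xi>) \<zeta> = blinfun_apply (?T \<theta>) \<zeta>" .
  qed
  have "blinfun_apply (?T \<xi>) \<eta> = blinfun_apply (?T \<theta>) \<eta>" by (simp only: T_eq)
  also have "\<dots> = blinfun_apply (?L (?T \<theta>)) b" by (rule \<eta>)
  also have "\<dots> = blinfun_apply (?T a) b" by (simp only: L_T \<theta>)
  finally have "blinfun_apply \<mu> (lie_bracket G \<xi> \<eta>) = blinfun_apply \<mu> (lie_bracket G a b)"
    by (simp add: ad_star_apply)
  then show ?thesis
    unfolding lie_poisson_def \<xi>_def[symmetric] \<eta>_def[symmetric]
    by (simp add: F[OF \<mu>] Ad_star_apply Ad_lie_bracket a_def b_def)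
qed

text \<open>In terms of the group, \<open>F\<close> sends \<open>Ad\<^sup>*\<^bsub>x\<^esub> \<mu>\<close> to \<open>Ad\<^sup>*\<^bsub>y\<^esub> \<mu>\<close> with \<open>y = x P(Ad\<^sup>*\<^bsub>x\<^esub> \<mu>)\<close>, which gives
  the local lift that smoothness on the orbit requires. On tangent vectors of the orbit it is \<open>M\<close> followed by the
  coadjoint action.\<close>

lemma coadjoint_map_symplectic: "symplectic_on_orbit G \<mu> D F"
  unfolding symplectic_on_orbit_def
proof (intro conjI ballI)
  show "F ` (coadjoint_orbit G \<mu> \<inter> D) \<subseteq> coadjoint_orbit G \<mu>"
    by (auto simp: coadjoint_orbit_def F Ad_star_mult[symmetric])
  show "smooth_on_orbit G \<mu> D F"
    unfolding smooth_on_orbit_def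
  proof (intro allI impI)
    fix g assume g: "Ad_star G g \<mu> \<in> D"
    let ?V = "UNIV \<inter> (\<lambda>x. Ad_star G x \<mu>) -` D" and ?\<Phi> = "\<lambda>x. x \<otimes> P (Ad_star G x \<mu>)"
    have o: "open ?V" by (rule smooth_map_on_open_vimage[OF smooth_Ad_star open_domain])
    have "smooth_map_on (atlas G) (atlas G) ?V (\<lambda>x. P (Ad_star G x \<mu>))"
      by (rule smooth_map_on_compose[OF cover chart_cover_vec cover P
            smooth_map_on_subset[OF smooth_Ad_star o subset_UNIV]]) auto
    then have "smooth_map_on (atlas G) (atlas G) ?V ?\<Phi>"
      by (intro smooth_map_on_mult cover smooth_map_on_subset[OF smooth_map_on_id[OF atlas] o subset_UNIV])
    moreover have "\<forall>x\<in>?V. Ad_star G x \<mu> \<in> D \<and> F (Ad_star G x \<mu>) = Ad_star G (?\<Phi> x) \<mu>"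
      by (auto simp: F Ad_star_mult)
    moreover have "g \<in> ?V" using g by simp
    ultimately show "\<exists>V \<Phi>. g \<in> V \<and> smooth_map_on (atlas G) (atlas G) V \<Phi> \<and>
        (\<forall>x\<in>V. Ad_star G x \<mu> \<in> D \<and> F (Ad_star G x \<mu>) = Ad_star G (\<Phi> x) \<mu>)"
      by (intro exI[of _ ?V] exI[of _ ?\<Phi>]) simp
  qed
  fix \<nu> v w
  assume \<nu>: "\<nu> \<in> coadjoint_orbit G \<mu> \<inter> D" and v: "v \<in> orbit_tangent_space G \<nu>"
    and w: "w \<in> orbit_tangent_space G \<nu>"
  then have D: "\<nu> \<in> D" by simp
  let ?M = "\<lambda>\<xi>. \<xi> + right_deriv P \<nu> (ad_star G \<xi> \<nu>)"
  have DF: "frechet_derivative F (at \<nu>) (ad_star G \<xi> \<nu>) = ad_star G (Ad G (inv (P \<nu>)) (?M \<xi>)) (F \<nu>)" for \<xi>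
    unfolding frechet_derivative_eqI[OF coadjoint_map_has_derivative[OF D]] F[OF D] Ad_star_ad_star[symmetric]
    by (simp add: ad_star_add)
  obtain \<xi> \<eta> where \<xi>: "v = ad_star G \<xi> \<nu>" and \<eta>: "w = ad_star G \<eta> \<nu>"
    using v w by (auto simp: orbit_tangent_space_def)
  show "frechet_derivative F (at \<nu>) v \<in> orbit_tangent_space G (F \<nu>)"
    "frechet_derivative F (at \<nu>) w \<in> orbit_tangent_space G (F \<nu>)"
    unfolding \<xi> \<eta> DF orbit_tangent_space_def by (rule rangeI)+
  show "kks_form G (F \<nu>) (frechet_derivative F (at \<nu>) v) (frechet_derivative F (at \<nu>) w) = kks_form G \<nu> v w"
    unfolding \<xi> \<eta> DF kks_form_ad_star
    by (simp only: F[OF D] Ad_star_apply Ad_lie_bracket Ad_inv orbit_lift_bracket[OF D])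
qed

end

section \<open>Retraction maps\<close>

context
  fixes U :: "'a set" and \<tau> :: "'a \<Rightarrow> 'g"
  assumes ret: "lie_retraction G U \<tau>"
begin

lemma smooth_retraction: "smooth_map_on vec_atlas (atlas G) U \<tau>"
  and smooth_retraction_inv: "smooth_map_on (atlas G) vec_atlas (\<tau> ` U) (inv_into U \<tau>)"
  and inj_retraction: "inj_on \<tau> U"
  using ret by (simp_all add: lie_retraction_def diffeomorphism_on_def)

lemma differentiable_retraction_inv:
  "\<zeta> \<in> U \<Longrightarrow> differentiable_map (atlas G) vec_atlas (inv_into U \<tau>) (\<tau> \<zeta>)"
  by (rule smooth_map_on_differentiable[OF cover chart_cover_vec smooth_retraction_inv]) simp

lemma linear_dtau_inv:
  assumes "\<zeta> \<in> U"
  shows "linear (dtau_inv G U \<tau> \<zeta>)"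
  unfolding dtau_inv_def[abs_def]
  using linear_compose[OF tangent_map_linear[OF differentiable_right]
      tangent_map_linear[OF differentiable_retraction_inv[OF assms]], of _ "\<one>"]
  by (simp add: o_def)

text \<open>Multiplying the right-trivialized derivative by \<open>\<tau>(\<zeta>)\<close> restores the derivative of \<open>\<tau>(\<zeta>)\<close> itself, which
  the inverse of \<open>\<tau>\<close> carries back to that of \<open>\<zeta>\<close>.\<close>

lemma dtau_inv_right_deriv:
  fixes \<zeta> :: "'v::real_normed_vector \<Rightarrow> 'a"
  assumes \<zeta>: "open D" "smooth_on D \<zeta>" "\<zeta> ` D \<subseteq> U" and \<mu>: "\<mu> \<in> D"
  shows "smooth_map_on vec_atlas (atlas G) D (\<lambda>\<epsilon>. \<tau> (\<zeta> \<epsilon>))"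
    and "dtau_inv G U \<tau> (\<zeta> \<mu>) (right_deriv (\<lambda>\<epsilon>. \<tau> (\<zeta> \<epsilon>)) \<mu> \<delta>) = frechet_derivative \<zeta> (at \<mu>) \<delta>"
proof -
  have z: "smooth_map_on vec_atlas vec_atlas D \<zeta>" using \<zeta> by (simp add: smooth_map_on_vec_iff)
  let ?g = "\<lambda>\<epsilon>. \<tau> (\<zeta> \<epsilon>)"
  show g: "smooth_map_on vec_atlas (atlas G) D ?g"
    by (rule smooth_map_on_compose[OF chart_cover_vec chart_cover_vec cover smooth_retraction z \<zeta>(3)])
  have U: "\<zeta> \<mu> \<in> U" using \<zeta> \<mu> by blast
  have "tangent_map (atlas G) (atlas G) (\<lambda>x. x \<otimes> ?g \<mu>) \<one> (right_deriv ?g \<mu> \<delta>)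
      = tangent_map vec_atlas (atlas G) (\<lambda>\<epsilon>. ?g \<epsilon> \<otimes> inv (?g \<mu>) \<otimes> ?g \<mu>) \<mu> \<delta>"
    unfolding right_deriv_def
    by (subst tangent_map_compose[OF chart_cover_vec cover differentiable_right_quotient[OF g \<mu>] differentiable_right])
      simp
  also have "\<dots> = tangent_map vec_atlas (atlas G) ?g \<mu> \<delta>"
    by (simp add: m_assoc)
  finally have 1: "tangent_map (atlas G) (atlas G) (\<lambda>x. x \<otimes> ?g \<mu>) \<one> (right_deriv ?g \<mu> \<delta>)
      = tangent_map vec_atlas (atlas G) ?g \<mu> \<delta>" .
  have "dtau_inv G U \<tau> (\<zeta> \<mu>) (right_deriv ?g \<mu> \<delta>)
      = tangent_map (atlas G) vec_atlas (inv_into U \<tau>) (?g \<mu>) (tangent_map vec_atlas (atlas G) ?g \<mu> \<delta>)"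
    unfolding dtau_inv_def 1 ..
  also have "\<dots> = tangent_map vec_atlas vec_atlas (\<lambda>\<epsilon>. inv_into U \<tau> (?g \<epsilon>)) \<mu> \<delta>"
    by (subst tangent_map_compose[OF chart_cover_vec cover
          smooth_map_on_differentiable[OF chart_cover_vec cover g \<mu>] differentiable_retraction_inv[OF U]]) simp
  also have "\<dots> = frechet_derivative (\<lambda>\<epsilon>. inv_into U \<tau> (?g \<epsilon>)) (at \<mu>) \<delta>"
    by (simp add: tangent_map_vec)
  also have "frechet_derivative (\<lambda>\<epsilon>. inv_into U \<tau> (?g \<epsilon>)) (at \<mu>) = frechet_derivative \<zeta> (at \<mu>)"
    by (rule frechet_derivative_eqI,
        rule has_derivative_transform_within_open[OF smooth_on_has_derivative[OF \<zeta>(2) \<mu>] \<zeta>(1) \<mu>])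
      (use \<zeta>(3) in \<open>auto simp: inv_into_f_f[OF inj_retraction] image_subset_iff\<close>)
  finally show "dtau_inv G U \<tau> (\<zeta> \<mu>) (right_deriv ?g \<mu> \<delta>) = frechet_derivative \<zeta> (at \<mu>) \<delta>" .
qed

end

end

section \<open>The reduced midpoint scheme\<close>

text \<open>The Hamiltonian of a single step, with the noise contributing constant coefficients. Half its
  gradient at the midpoint is the velocity of the step; on the diagonal the midpoint of \<open>\<mu>\<close> and \<open>\<mu>\<close> is \<open>\<mu>\<close>.\<close>

definition step_energy ::
    "('a::real_normed_vector dual_space \<Rightarrow> real) \<Rightarrow> (nat \<Rightarrow> 'a dual_space \<Rightarrow> real) \<Rightarrow> nat \<Rightarrow> real \<Rightarrow>
     (nat \<Rightarrow> real) \<Rightarrow> 'a dual_space \<Rightarrow> real" where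
  "step_energy h hs N \<Delta>t dW \<mu> = h \<mu> + (\<Sum>i=1..N. (dW i / \<Delta>t) * hs i \<mu>)"

context
  fixes h :: "'a::euclidean_space dual_space \<Rightarrow> real" and hs :: "nat \<Rightarrow> 'a dual_space \<Rightarrow> real"
    and N :: nat and \<Delta>t :: real and dW :: "nat \<Rightarrow> real"
  assumes h: "smooth_on UNIV h" and hs: "\<And>i. i \<in> {1..N} \<Longrightarrow> smooth_on UNIV (hs i)"
begin

lemma step_energy_has_derivative:
  "(step_energy h hs N \<Delta>t dW has_derivative
     (\<lambda>\<delta>. blinfun_apply \<delta> (2 *\<^sub>R midpoint_velocity h hs N \<Delta>t dW \<mu> \<mu>))) (at \<mu>)"
proof -
  have d: "(k has_derivative (\<lambda>\<nu>. blinfun_apply \<nu> (momentum_derivative k \<mu>))) (at \<mu>)"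
    if "smooth_on UNIV k" for k
    by (rule has_derivative_momentum_derivative[OF smooth_on_differentiable[OF that UNIV_I]])
  have m: "(1/2) *\<^sub>R (\<mu> + \<mu>) = \<mu>" by (simp flip: scaleR_2)
  have "((\<lambda>\<mu>. h \<mu> + (\<Sum>i=1..N. (dW i / \<Delta>t) * hs i \<mu>)) has_derivative
      (\<lambda>\<delta>. blinfun_apply \<delta> (momentum_derivative h \<mu>)
        + (\<Sum>i=1..N. (dW i / \<Delta>t) * blinfun_apply \<delta> (momentum_derivative (hs i) \<mu>)))) (at \<mu>)"
    by (intro has_derivative_add has_derivative_sum has_derivative_mult_right d h hs)
  then show ?thesis
    unfolding step_energy_def[abs_def] midpoint_velocity_def m
    by (simp add: blinfun.add_right blinfun.scaleR_right blinfun.sum_right scaleR_add_right)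
qed

lemma smooth_on_midpoint_velocity:
  fixes m1 m2 :: "'v::real_normed_vector \<Rightarrow> 'a dual_space"
  assumes D: "open D" and m: "smooth_on D m1" "smooth_on D m2"
  shows "smooth_on D (\<lambda>\<mu>. midpoint_velocity h hs N \<Delta>t dW (m1 \<mu>) (m2 \<mu>))"
proof -
  have mid: "smooth_on D (\<lambda>\<mu>. (1/2) *\<^sub>R (m1 \<mu> + m2 \<mu>))"
    by (rule smooth_on_bounded_linear[OF D bounded_linear_scaleR_right smooth_on_add[OF D m]])
  have grad: "smooth_on D (\<lambda>\<mu>. r *\<^sub>R momentum_derivative k ((1/2) *\<^sub>R (m1 \<mu> + m2 \<mu>)))"
    if "smooth_on UNIV k" for k r
    by (rule smooth_on_bounded_linear[OF D bounded_linear_scaleR_right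
          smooth_on_compose[OF D mid smooth_on_momentum_derivative[OF open_UNIV that] subset_UNIV]])
  show ?thesis
    unfolding midpoint_velocity_def
    by (rule smooth_on_add[OF D grad[OF h] smooth_on_bounded_linear[OF D bounded_linear_scaleR_right
            smooth_on_sum[OF D grad[OF hs]]]])
qed

text \<open>Let \<open>p\<close> be the midpoint and \<open>E\<close> the energy of the step. Then \<open>m\<^sub>1 + m\<^sub>2 = 2 p\<close> and
  \<open>2 \<zeta> = \<Delta>t \<nabla>E(p)\<close>, so \<open>\<langle>m\<^sub>1 + m\<^sub>2, d\<zeta>\<rangle>\<close> is the differential of
  \<open>\<Delta>t (\<langle>p, \<nabla>E(p)\<rangle> - E(p))\<close>: the terms containing \<open>dp\<close> cancel.\<close>

lemma step_action_has_derivative: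
  fixes m1 m2 :: "'v::real_normed_vector \<Rightarrow> 'a dual_space"
  defines "mid \<equiv> \<lambda>\<mu>. (1/2) *\<^sub>R (m1 \<mu> + m2 \<mu>)"
    and "\<zeta> \<equiv> \<lambda>\<mu>. \<Delta>t *\<^sub>R midpoint_velocity h hs N \<Delta>t dW (m1 \<mu>) (m2 \<mu>)"
  assumes D: "open D" and m: "smooth_on D m1" "smooth_on D m2" and \<mu>: "\<mu> \<in> D"
  shows "((\<lambda>\<mu>. 2 * blinfun_apply (mid \<mu>) (\<zeta> \<mu>) - \<Delta>t * step_energy h hs N \<Delta>t dW (mid \<mu>))
    has_derivative (\<lambda>\<delta>. blinfun_apply (m1 \<mu> + m2 \<mu>) (frechet_derivative \<zeta> (at \<mu>) \<delta>))) (at \<mu>)"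
proof -
  have mid: "smooth_on D mid"
    unfolding mid_def by (rule smooth_on_bounded_linear[OF D bounded_linear_scaleR_right smooth_on_add[OF D m]])
  have \<zeta>: "smooth_on D \<zeta>"
    unfolding \<zeta>_def by (rule smooth_on_bounded_linear[OF D bounded_linear_scaleR_right smooth_on_midpoint_velocity[OF D m]])
  note dm = smooth_on_has_derivative[OF mid \<mu>] and dz = smooth_on_has_derivative[OF \<zeta> \<mu>]
  have \<zeta>_mid: "\<zeta> \<mu> = \<Delta>t *\<^sub>R midpoint_velocity h hs N \<Delta>t dW (mid \<mu>) (mid \<mu>)"
  proof -
    have "mid \<mu> = (1/2) *\<^sub>R (mid \<mu> + mid \<mu>)" by (simp flip: scaleR_2)
    then show ?thesis unfolding \<zeta>_def midpoint_velocity_def by (simp add: mid_def)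
  qed
  have E: "((\<lambda>\<mu>. step_energy h hs N \<Delta>t dW (mid \<mu>)) has_derivative
      (\<lambda>\<delta>. blinfun_apply (frechet_derivative mid (at \<mu>) \<delta>)
        (2 *\<^sub>R midpoint_velocity h hs N \<Delta>t dW (mid \<mu>) (mid \<mu>)))) (at \<mu>)"
    by (rule has_derivative_compose[OF dm step_energy_has_derivative])
  have "((\<lambda>\<mu>. 2 * blinfun_apply (mid \<mu>) (\<zeta> \<mu>) - \<Delta>t * step_energy h hs N \<Delta>t dW (mid \<mu>)) has_derivative
      (\<lambda>\<delta>. 2 * (blinfun_apply (mid \<mu>) (frechet_derivative \<zeta> (at \<mu>) \<delta>)
            + blinfun_apply (frechet_derivative mid (at \<mu>) \<delta>) (\<zeta> \<mu>))
          - \<Delta>t * blinfun_apply (frechet_derivative mid (at \<mu>) \<delta>)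
              (2 *\<^sub>R midpoint_velocity h hs N \<Delta>t dW (mid \<mu>) (mid \<mu>)))) (at \<mu>)"
    by (rule has_derivative_diff[OF has_derivative_mult_right[OF blinfun.FDERIV[OF dm dz]]
          has_derivative_mult_right[OF E]])
  moreover have "m1 \<mu> + m2 \<mu> = 2 *\<^sub>R mid \<mu>" by (simp add: mid_def)
  ultimately show ?thesis
    by (simp add: \<zeta>_mid blinfun.scaleR_right blinfun.scaleR_left)
qed

end

context lie_group
begin

text \<open>Every step acts twice by the same group element, as the two velocities of a step coincide.\<close>

primrec step_product :: "(nat \<Rightarrow> 'v \<Rightarrow> 'g) \<Rightarrow> nat \<Rightarrow> 'v \<Rightarrow> 'g" where
  "step_product t 0 = (\<lambda>\<mu>. \<one>)"
| "step_product t (Suc n) = (\<lambda>\<mu>. step_product t n \<mu> \<otimes> (t (Suc n) \<mu> \<otimes> t (Suc n) \<mu>))"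

text \<open>Induction on the number of steps. The momentum that the first \<open>n\<close> steps produce is
  at the same time the one at which step \<open>n + 1\<close> starts, so the pairing with the right-trivialized derivative of
  the next two factors is a pairing of the unknowns of that step with the derivative of its increment; the potential
  is the sum of the actions of the steps.\<close>

lemma midpoint_flow_generated:
  assumes ret: "lie_retraction G U \<tau>"
    and h: "smooth_on UNIV h" and hs: "\<And>i. i \<in> {1..N} \<Longrightarrow> smooth_on UNIV (hs i)"
    and M: "M \<ge> 1" and flow: "reduced_midpoint_flow G U \<tau> h hs N \<Delta>t M dW D F"
  obtains P \<sigma> where "smooth_map_on vec_atlas (atlas G) D P"
    and "\<And>\<mu>. \<mu> \<in> D \<Longrightarrow> (\<sigma> has_derivative (\<lambda>\<delta>. blinfun_apply \<mu> (right_deriv P \<mu> \<delta>))) (at \<mu>)"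
    and "\<And>\<mu>. \<mu> \<in> D \<Longrightarrow> F \<mu> = Ad_star G (P \<mu>) \<mu>"
proof -
  obtain m1 m2 where m: "\<And>k. k \<in> {1..M} \<Longrightarrow> smooth_on D (\<lambda>\<mu>. m1 \<mu> k)"
      "\<And>k. k \<in> {1..M} \<Longrightarrow> smooth_on D (\<lambda>\<mu>. m2 \<mu> k)"
    and scheme: "\<And>\<mu>. \<mu> \<in> D \<Longrightarrow> reduced_midpoint_scheme G U \<tau> h hs N \<Delta>t M dW (m1 \<mu>) (m2 \<mu>) \<mu> (F \<mu>)"
    using flow unfolding reduced_midpoint_flow_def by blast
  have D: "open D"
    using flow by (simp add: reduced_midpoint_flow_def diffeomorphism_on_def smooth_map_on_def)
  define \<zeta> where "\<zeta> k \<mu> = \<Delta>t *\<^sub>R midpoint_velocity h hs N \<Delta>t (\<lambda>i. dW i k) (m1 \<mu> k) (m2 \<mu> k)" for k \<mu>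
  define t where "t k \<mu> = \<tau> (\<zeta> k \<mu>)" for k \<mu>
  define mid where "mid k \<mu> = (1/2) *\<^sub>R (m1 \<mu> k + m2 \<mu> k)" for k \<mu>
  define a where "a k \<mu> = 2 * blinfun_apply (mid k \<mu>) (\<zeta> k \<mu>)
    - \<Delta>t * step_energy h hs N \<Delta>t (\<lambda>i. dW i k) (mid k \<mu>)" for k \<mu>
  let ?P = "step_product t"
  have U: "\<zeta> k \<mu> \<in> U"
    and mid_eq: "Ad_star G (t k \<mu>) (dtau_inv_star G U \<tau> (\<zeta> k \<mu>) (m1 \<mu> k)) = dtau_inv_star G U \<tau> (\<zeta> k \<mu>) (m2 \<mu> k)"
    if "\<mu> \<in> D" "k \<in> {1..M}" for \<mu> k
    using scheme[OF that(1)] that(2) unfolding reduced_midpoint_scheme_def Let_def \<zeta>_def t_def by blast+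
  have next_eq: "Ad_star G (t k \<mu>) (dtau_inv_star G U \<tau> (\<zeta> k \<mu>) (m2 \<mu> k))
      = dtau_inv_star G U \<tau> (\<zeta> (k + 1) \<mu>) (m1 \<mu> (k + 1))" if "\<mu> \<in> D" "k \<in> {1..<M}" for \<mu> k
    using scheme[OF that(1)] that(2) unfolding reduced_midpoint_scheme_def Let_def \<zeta>_def t_def by blast
  have first_eq: "\<mu> = dtau_inv_star G U \<tau> (\<zeta> 1 \<mu>) (m1 \<mu> 1)"
    and last_eq: "F \<mu> = Ad_star G (t M \<mu>) (dtau_inv_star G U \<tau> (\<zeta> M \<mu>) (m2 \<mu> M))" if "\<mu> \<in> D" for \<mu>
    using scheme[OF that] unfolding reduced_midpoint_scheme_def Let_def \<zeta>_def t_def by blast+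
  have \<zeta>_smooth: "smooth_on D (\<zeta> k)" if "k \<in> {1..M}" for k
    unfolding \<zeta>_def
    by (rule smooth_on_bounded_linear[OF D bounded_linear_scaleR_right
          smooth_on_midpoint_velocity[OF h hs D m(1)[OF that] m(2)[OF that]]])
  have \<zeta>_U: "\<zeta> k ` D \<subseteq> U" if "k \<in> {1..M}" for k
    using U that by blast
  have t_smooth: "smooth_map_on vec_atlas (atlas G) D (t k)" if "k \<in> {1..M}" for k
    unfolding t_def using \<zeta>_smooth[OF that] D
    by (intro smooth_map_on_compose[OF chart_cover_vec chart_cover_vec cover smooth_retraction[OF ret] _ \<zeta>_U[OF that]])
      (simp add: smooth_map_on_vec_iff)
  have P_smooth: "smooth_map_on vec_atlas (atlas G) D (?P n)" if "n \<le> M" for n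
    using that
  proof (induction n)
    case 0
    then show ?case by (simp add: smooth_map_on_const_group[OF chart_cover_vec D])
  next
    case (Suc n)
    then show ?case
      by (simp, intro smooth_map_on_mult chart_cover_vec t_smooth) auto
  qed
  have start: "Ad_star G (?P n \<mu>) \<mu> = dtau_inv_star G U \<tau> (\<zeta> (Suc n) \<mu>) (m1 \<mu> (Suc n))"
    if "n < M" "\<mu> \<in> D" for n \<mu>
    using that(1)
  proof (induction n)
    case 0
    have "Ad_star G \<one> \<mu> = \<mu>" by (rule blinfun_eqI) (simp add: Ad_star_apply Ad_one)
    then show ?case using first_eq[OF that(2)] by simp
  next
    case (Suc n)
    then show ?case
      using mid_eq[OF that(2), of "Suc n"] next_eq[OF that(2), of "Suc n"]
      by (simp add: Ad_star_mult)
  qed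
  have deriv: "((\<lambda>\<mu>. \<Sum>k=1..n. a k \<mu>) has_derivative
      (\<lambda>\<delta>. blinfun_apply \<mu> (right_deriv (?P n) \<mu> \<delta>))) (at \<mu>)" if "n \<le> M" "\<mu> \<in> D" for n \<mu>
    using that(1)
  proof (induction n)
    case 0
    have "right_deriv (?P 0) \<mu> = (\<lambda>\<delta>. 0)"
      by (simp add: right_deriv_coord)
    then show ?case by (simp del: step_product.simps)
  next
    case (Suc n)
    let ?k = "Suc n"
    let ?R = "right_deriv (t ?k) \<mu>" and ?dz = "frechet_derivative (\<zeta> ?k) (at \<mu>)"
    have k: "?k \<in> {1..M}" using Suc.prems by simp
    have z: "\<zeta> ?k \<mu> \<in> U" by (rule U[OF that(2) k])
    have tt: "smooth_map_on vec_atlas (atlas G) D (\<lambda>\<mu>. t ?k \<mu> \<otimes> t ?k \<mu>)"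
      by (intro smooth_map_on_mult chart_cover_vec t_smooth k)
    \<comment> \<open>The dual of \<open>d\<tau>\<inverse>\<close> in the scheme is exactly what trivializes the derivative of
  \<open>\<tau>(\<zeta>)\<close>.\<close>
    have pair: "blinfun_apply (dtau_inv_star G U \<tau> (\<zeta> ?k \<mu>) \<nu>) (?R \<delta>) = blinfun_apply \<nu> (?dz \<delta>)" for \<nu> \<delta>
      unfolding dtau_inv_star_def dual_map_apply[OF linear_dtau_inv[OF ret z]] t_def[abs_def]
        dtau_inv_right_deriv(2)[OF ret D \<zeta>_smooth[OF k] \<zeta>_U[OF k] that(2)] ..
    have "right_deriv (?P ?k) \<mu> \<delta> = right_deriv (?P n) \<mu> \<delta>
        + Ad G (?P n \<mu>) (?R \<delta> + Ad G (t ?k \<mu>) (?R \<delta>))" for \<delta>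
      using right_deriv_mult[OF P_smooth tt that(2)] right_deriv_mult[OF t_smooth t_smooth that(2), OF k k] Suc.prems
      by simp
    then have split: "blinfun_apply \<mu> (right_deriv (?P ?k) \<mu> \<delta>) = blinfun_apply \<mu> (right_deriv (?P n) \<mu> \<delta>)
        + (blinfun_apply (Ad_star G (?P n \<mu>) \<mu>) (?R \<delta>)
          + blinfun_apply (Ad_star G (t ?k \<mu>) (Ad_star G (?P n \<mu>) \<mu>)) (?R \<delta>))" for \<delta>
      by (simp add: blinfun.add_right Ad_star_apply linear_add[OF linear_Ad] del: step_product.simps)
    have "Ad_star G (?P n \<mu>) \<mu> = dtau_inv_star G U \<tau> (\<zeta> ?k \<mu>) (m1 \<mu> ?k)"
      using start[of n \<mu>] Suc.prems that(2) by simp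
    then have R: "blinfun_apply \<mu> (right_deriv (?P ?k) \<mu> \<delta>) = blinfun_apply \<mu> (right_deriv (?P n) \<mu> \<delta>)
        + blinfun_apply (m1 \<mu> ?k + m2 \<mu> ?k) (?dz \<delta>)" for \<delta>
      unfolding split by (simp only: mid_eq[OF that(2) k] pair blinfun.add_left)
    have "(a ?k has_derivative (\<lambda>\<delta>. blinfun_apply (m1 \<mu> ?k + m2 \<mu> ?k) (?dz \<delta>))) (at \<mu>)"
      unfolding a_def[abs_def] mid_def[abs_def] \<zeta>_def[abs_def]
      by (rule step_action_has_derivative[OF h hs D m(1)[OF k] m(2)[OF k] that(2)])
    with Suc show ?case
      unfolding R by (simp del: step_product.simps add: has_derivative_add)
  qed
  have "F \<mu> = Ad_star G (?P M \<mu>) \<mu>" if "\<mu> \<in> D" for \<mu>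
  proof -
    obtain n where n: "M = Suc n" using M by (cases M) auto
    show ?thesis
      using last_eq[OF that] start[of n \<mu>] mid_eq[OF that, of M] that n by (simp add: Ad_star_mult)
  qed
  with P_smooth[of M] deriv[of M] show ?thesis by (intro that) auto
qed

end

theorem proposition4p4:
  fixes G :: "('g::{t2_space, second_countable_topology}, 'a::euclidean_space) lie_group"
    and U :: "'a set" and \<tau> :: "'a \<Rightarrow> 'g"
    and H :: "'g \<Rightarrow> 'a dual_space \<Rightarrow> real" and Hs :: "nat \<Rightarrow> 'g \<Rightarrow> 'a dual_space \<Rightarrow> real"
    and h :: "'a dual_space \<Rightarrow> real" and hs :: "nat \<Rightarrow> 'a dual_space \<Rightarrow> real"
    and N M :: nat and \<Delta>t :: real
    and P :: "'w measure" and W :: "nat \<Rightarrow> real \<Rightarrow> 'w \<Rightarrow> real" and \<omega> :: 'w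
    and D :: "'a dual_space set" and F :: "'a dual_space \<Rightarrow> 'a dual_space"
  assumes "lie_group G"
    and "lie_retraction G U \<tau>"
    and "left_invariant_hamiltonian G H"
    and "\<And>i. i \<in> {1..N} \<Longrightarrow> left_invariant_hamiltonian G (Hs i)"
    and "h = reduced_hamiltonian G H" and "smooth_on UNIV h"
    and "\<And>i. i \<in> {1..N} \<Longrightarrow> hs i = reduced_hamiltonian G (Hs i)"
    and "\<And>i. i \<in> {1..N} \<Longrightarrow> smooth_on UNIV (hs i)"
    and "\<Delta>t > 0" and "M \<ge> 1"
    and "independent_wiener_processes P N W" and "\<omega> \<in> space P"
    and "reduced_midpoint_flow G U \<tau> h hs N \<Delta>t M (wiener_increment \<Delta>t W \<omega>) D F"
  shows "(\<forall>f g. smooth_on UNIV f \<longrightarrow> smooth_on UNIV g \<longrightarrow>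
            (\<forall>\<mu>\<in>D. lie_poisson G (f \<circ> F) (g \<circ> F) \<mu> = lie_poisson G f g (F \<mu>)))
       \<and> (\<forall>\<mu>. symplectic_on_orbit G \<mu> D F)"
proof -
  interpret lie_group G by fact
  obtain P \<sigma> where P: "smooth_map_on vec_atlas (atlas G) D P"
    and \<sigma>: "\<And>\<mu>. \<mu> \<in> D \<Longrightarrow> (\<sigma> has_derivative (\<lambda>\<delta>. blinfun_apply \<mu> (right_deriv P \<mu> \<delta>))) (at \<mu>)"
    and F: "\<And>\<mu>. \<mu> \<in> D \<Longrightarrow> F \<mu> = Ad_star G (P \<mu>) \<mu>"
    using midpoint_flow_generated[OF assms(2) assms(6) assms(8) assms(10) assms(13)] by blast
  show ?thesis
    by (intro conjI allI impI ballI coadjoint_map_symplectic[OF P \<sigma> F] coadjoint_map_poisson[OF P \<sigma> F] smooth_on_differentiable[OF _ UNIV_I])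
qed

end
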